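(* Almost every piecewise affine homeomorphism of the circle with two break points is dynamically Morse-Smale. That is, in the $4$-parameter family of piecewise affine circle homeomorphisms with two break points, parametrised by the two break points and their two images, the set of parameters for which the homeomorphism is not Morse-Smale has zero ($4$-dimensional) Lebesgue measure.
   Context: The circle is $S^1=\mathbb{R}/\mathbb{Z}$. A piecewise affine circle homeomorphism with two break points is an orientation-preserving homeomorphism $f$ of $S^1$ whose derivative has exactly two discontinuity points $a_1\neq a_2$ (the break points) and which is affine on each of the two arcs of $S^1\setminus\{a_1,a_2\}$. Such an $f$ is completely determined by $(a_1,a_2,f(a_1),f(a_2))$, so the family is parametrised by $4$ real parameters and carries the standard Lebesgue measure in these parameters. A circle homeomorphism $f$ is (dynamically) Morse-Smale if there is a finite number of attracting or repelling periodic orbits such that the $\alpha$-limit set and the $\omega$-limit set of every orbit is one of these periodic orbits. *)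

theory Defs
  imports "HOL-Analysis.Analysis"
begin

section \<open>The circle \<open>\<real>/\<int>\<close>\<close>

quotient_type circle = real / "\<lambda>x y :: real. x - y \<in> \<int>"
  morphisms circle_rep to_circle
proof (rule equivpI)
  show "reflp (\<lambda>x y :: real. x - y \<in> \<int>)"
    by (auto intro: reflpI)
  show "symp (\<lambda>x y :: real. x - y \<in> \<int>)"
    by (rule sympI) (metis Ints_minus minus_diff_eq)
  show "transp (\<lambda>x y :: real. x - y \<in> \<int>)"
    by (rule transpI) (metis Ints_add diff_add_cancel add_diff_eq)
qed

lemma to_circle_eq_iff: "to_circle x = to_circle y \<longleftrightarrow> x - y \<in> \<int>"
  by (rule circle.abs_eq_iff)

text \<open>The quotient topology.\<close>

instantiation circle :: topological_space
begin

definition open_circle :: "circle set \<Rightarrow> bool" where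
  "open_circle U \<longleftrightarrow> open (to_circle -` U)"

instance
proof
  show "open (UNIV :: circle set)"
    by (simp add: open_circle_def)
next
  fix S T :: "circle set"
  assume "open S" "open T"
  then show "open (S \<inter> T)"
    by (simp add: open_circle_def vimage_Int open_Int)
next
  fix K :: "circle set set"
  assume "\<forall>S\<in>K. open S"
  then show "open (\<Union>K)"
    by (auto simp: open_circle_def vimage_Union)
qed

end


section \<open>Piecewise affine circle homeomorphisms\<close>

definition circle_lift :: "(real \<Rightarrow> real) \<Rightarrow> (circle \<Rightarrow> circle) \<Rightarrow> bool" where
  "circle_lift F f \<longleftrightarrow> continuous_on UNIV F \<and> (\<forall>x. to_circle (F x) = f (to_circle x))"

definition circle_homeo :: "(circle \<Rightarrow> circle) \<Rightarrow> bool" where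
  "circle_homeo f \<longleftrightarrow> (\<exists>g. homeomorphism UNIV UNIV f g)"

definition orientation_preserving :: "(circle \<Rightarrow> circle) \<Rightarrow> bool" where
  "orientation_preserving f \<longleftrightarrow> (\<exists>F. circle_lift F f \<and> strict_mono F)"

text \<open>The derivative of \<open>f\<close> at \<open>to_circle x\<close> is \<open>deriv F x\<close> for any lift \<open>F\<close>; since two lifts
  differ by an integer constant, this is independent of \<open>F\<close>.  As \<open>deriv F y\<close> is an arbitrary value
  where \<open>F\<close> is not differentiable, continuity of the derivative at \<open>x\<close> includes its existence
  near \<open>x\<close>; a point where \<open>f\<close> has no derivative is thus a discontinuity point.\<close>

definition deriv_continuous_at :: "(real \<Rightarrow> real) \<Rightarrow> real \<Rightarrow> bool" where
  "deriv_continuous_at F x \<longleftrightarrow>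
     (\<forall>\<^sub>F y in nhds x. F differentiable (at y)) \<and> isCont (deriv F) x"

definition break_points :: "(circle \<Rightarrow> circle) \<Rightarrow> circle set" where
  "break_points f = {to_circle x |x. \<exists>F. circle_lift F f \<and> \<not> deriv_continuous_at F x}"

text \<open>Quantifying over all open intervals mapped into \<open>A\<close> includes those mapped onto its components:
  if \<open>A\<close> is the complement of two points, these are the two arcs.\<close>

definition affine_on_arcs_of :: "circle set \<Rightarrow> (circle \<Rightarrow> circle) \<Rightarrow> bool" where
  "affine_on_arcs_of A f \<longleftrightarrow>
     (\<forall>u v. u < v \<and> to_circle ` {u<..<v} \<subseteq> A \<longrightarrow>
        (\<exists>s c. \<forall>x\<in>{u<..<v}. f (to_circle x) = to_circle (s * x + c)))"

definition pa_homeo_two_breaks :: "(circle \<Rightarrow> circle) \<Rightarrow> circle \<Rightarrow> circle \<Rightarrow> bool" where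
  "pa_homeo_two_breaks f a\<^sub>1 a\<^sub>2 \<longleftrightarrow>
     circle_homeo f \<and> orientation_preserving f \<and>
     a\<^sub>1 \<noteq> a\<^sub>2 \<and> break_points f = {a\<^sub>1, a\<^sub>2} \<and>
     affine_on_arcs_of (- {a\<^sub>1, a\<^sub>2}) f"


section \<open>Morse-Smale homeomorphisms\<close>

definition omega_limit :: "('a::topological_space \<Rightarrow> 'a) \<Rightarrow> 'a \<Rightarrow> 'a set" where
  "omega_limit f x = {y. \<exists>r :: nat \<Rightarrow> nat. strict_mono r \<and> (\<lambda>k. (f ^^ r k) x) \<longlonglongrightarrow> y}"

definition alpha_limit :: "('a::topological_space \<Rightarrow> 'a) \<Rightarrow> 'a \<Rightarrow> 'a set" where
  "alpha_limit f x = omega_limit (inv f) x"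

definition periodic_orbit :: "('a \<Rightarrow> 'a) \<Rightarrow> 'a set \<Rightarrow> bool" where
  "periodic_orbit f C \<longleftrightarrow>
     (\<exists>p n. n > 0 \<and> (f ^^ n) p = p \<and> C = {(f ^^ k) p |k. True})"

text \<open>Lyapunov stability is required in addition to attraction of a neighbourhood: a circle
  homeomorphism whose only periodic orbit is a fixed point that attracts on one side and repels
  on the other has every orbit converging to that point, yet the point is not an attractor.\<close>

definition attracting :: "('a::topological_space \<Rightarrow> 'a) \<Rightarrow> 'a set \<Rightarrow> bool" where
  "attracting f C \<longleftrightarrow>
     (\<forall>V. open V \<and> C \<subseteq> V \<longrightarrow> (\<exists>U. open U \<and> C \<subseteq> U \<and> (\<forall>n. (f ^^ n) ` U \<subseteq> V))) \<and>
     (\<exists>U. open U \<and> C \<subseteq> U \<and> (\<forall>x\<in>U. omega_limit f x = C))"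

definition repelling :: "('a::topological_space \<Rightarrow> 'a) \<Rightarrow> 'a set \<Rightarrow> bool" where
  "repelling f C \<longleftrightarrow> attracting (inv f) C"

definition morse_smale :: "(circle \<Rightarrow> circle) \<Rightarrow> bool" where
  "morse_smale f \<longleftrightarrow>
     circle_homeo f \<and>
     (\<exists>\<P>. finite \<P> \<and>
        (\<forall>C\<in>\<P>. periodic_orbit f C \<and> (attracting f C \<or> repelling f C)) \<and>
        (\<forall>x. alpha_limit f x \<in> \<P> \<and> omega_limit f x \<in> \<P>))"

end

theory Submission
  imports Defs
begin

text \<open>
  Normalise the first break point to \<open>0\<close>. The lifts with fixed arc lengths \<open>l\<close> and \<open>L\<close> are
  \<open>F\<^sub>t = H + t\<close>, with slopes \<open>\<lambda> = L / l\<close> and \<open>\<mu> = (1 - L) / (1 - l)\<close>. If \<open>F\<^sub>t\<close> has a periodic point, no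
  break point is periodic and \<open>ln \<lambda>\<close>, \<open>ln \<mu>\<close> satisfy no rational relation, then every periodic point is
  hyperbolic, so the map is Morse-Smale. The latter two conditions exclude a null set.

  It remains to see that for almost every \<open>(l, L)\<close> almost every \<open>F\<^sub>t\<close> has a periodic point. Let \<open>F\<^sub>t\<close>
  have irrational rotation number \<open>\<theta>\<close>, let \<open>p / q\<close> be a suitable Farey approximation of \<open>\<theta>\<close>, and let
  \<open>F\<^sub>s\<close> be the nearby map for which \<open>x\<close> becomes periodic of type \<open>p / q\<close>. Disjointness of the first
  returns and bounded distortion give, with \<open>S\<^sub>k = ln ((F\<^sub>t\<^sup>k)' x)\<close>,
  \<open>\<bar>s - t\<bar> \<cdot> (\<Sum>k<q. exp S\<^sub>k) \<cdot> (\<Sum>k<q. exp (- S\<^sub>k)) \<le> C\<close>, whereas \<open>\<bar>\<rho>(s) - \<rho>(t)\<bar> \<ge> c / q\<^sup>2\<close>.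
  By Cauchy-Schwarz \<open>\<bar>\<rho>(s) - \<rho>(t)\<bar> \<ge> c' \<cdot> \<bar>s - t\<bar>\<close> always, and the constant \<open>c'\<close> may be taken
  arbitrarily large if the variance of \<open>S\<^sub>k\<close>, \<open>k < q\<close>, is unbounded. The sums \<open>S\<^sub>k\<close> are Birkhoff sums over
  the rotation by \<open>\<theta>\<close> of a step function with two values; if their mean does not vanish, the variance
  is unbounded, and if it vanishes the step has length \<open>\<kappa> = - ln \<mu> / (ln \<lambda> - ln \<mu>)\<close> and Bessel's
  inequality shows the same for almost all pairs \<open>(\<theta>, \<kappa>)\<close>. A Vitali covering of the set of aperiodic
  parameters by the intervals between \<open>t\<close> and \<open>s\<close> then shows that it is null.
\<close>


section \<open>Rotation numbers\<close>

text \<open>The obstacle is that the rotation number is only known to be monotone in t, so nothing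
  can be differentiated: at an aperiodic t the estimate compares t with one nearby parameter at a
  time, on a side that is not controlled. An expansion factor bounded below merely shows that
  preimages of null sets are null. The covering argument is therefore used twice: for rotation
  numbers in a null exceptional set the fixed factor suffices, and for all others the factor is
  taken arbitrarily large over a bounded range of rotation numbers. The Birkhoff sums live on the
  rotation side of a semiconjugacy h, where the break points sit at 0 and \<open>h l\<close>. The
  number \<open>h l\<close> varies with t and cannot be prescribed, so every step length has to be
  treated. Vanishing mean pins it to \<kappa>, which depends on l and L alone; this is why a
  condition on pairs (\<theta>, \<kappa>) can be turned by Fubini's theorem into one on \<kappa>.
  For fixed l, \<kappa> has positive derivative in L on either side of L = l, so null sets of
  \<kappa> pull back to null sets of L.\<close>

lemma add_of_int:
  fixes h :: "real \<Rightarrow> real"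
  assumes "\<And>x. h (x + 1) = h x + 1" shows "h (x + of_int m) = h x + of_int m"
proof (induction m rule: int_induct[where k=0])
  case (step1 i) then show ?case using assms[of "x + of_int i"] by (simp add: add.assoc)
next
  case (step2 i) then show ?case using assms[of "x + of_int (i - 1)"] by (simp add: algebra_simps)
qed simp

locale lift_map =
  fixes F :: "real \<Rightarrow> real"
  assumes cont: "continuous_on UNIV F" and smono: "strict_mono F" and deg1: "F (x + 1) = F x + 1"
begin

lemma add_int: "F (x + of_int m) = F x + of_int m"
  by (rule add_of_int) (rule deg1)

lemma less_iff: "F x < F y \<longleftrightarrow> x < y"
  using smono by (simp add: strict_mono_less)

lemma le_iff: "F x \<le> F y \<longleftrightarrow> x \<le> y"
  using smono by (simp add: strict_mono_less_eq)

lemma lift_map_axioms': "lift_map F" by unfold_locales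

end

lemma lift_map_comp:
  assumes "lift_map F" "lift_map G" shows "lift_map (\<lambda>x. F (G x))"
proof -
  interpret F: lift_map F by fact
  interpret G: lift_map G by fact
  show ?thesis
  proof
    show "continuous_on UNIV (\<lambda>x. F (G x))"
      by (rule continuous_on_compose2[OF F.cont G.cont]) auto
    show "strict_mono (\<lambda>x. F (G x))"
      by (simp add: strict_mono_def F.less_iff G.less_iff)
    show "F (G (x + 1)) = F (G x) + 1" for x by (simp add: F.deg1 G.deg1)
  qed
qed

lemma lift_map_funpow:
  assumes "lift_map F" shows "lift_map (F ^^ n)"
proof (induction n)
  case 0 show ?case by unfold_locales (auto simp: strict_mono_def)
next
  case (Suc n)
  show ?case using lift_map_comp[OF assms Suc] by (simp add: comp_def)
qed

context lift_map
begin

lemma funpow_lift: "lift_map (F ^^ n)"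
  by (rule lift_map_funpow) unfold_locales

lemma funpow_add_int: "(F ^^ n) (x + of_int m) = (F ^^ n) x + of_int m"
  by (rule lift_map.add_int[OF funpow_lift])

lemma funpow_less_iff: "(F ^^ n) x < (F ^^ n) y \<longleftrightarrow> x < y"
  by (rule lift_map.less_iff[OF funpow_lift])

lemma funpow_le_iff: "(F ^^ n) x \<le> (F ^^ n) y \<longleftrightarrow> x \<le> y"
  by (rule lift_map.le_iff[OF funpow_lift])

lemma funpow_cont: "continuous_on UNIV (F ^^ n)"
  by (rule lift_map.cont[OF funpow_lift])

lemma surj_F: "\<exists>x. F x = y"
proof -
  define m where "m = \<lfloor>y - F 0\<rfloor>"
  have "F (of_int m) \<le> y" using add_int[of 0 m] by (simp add: m_def) linarith
  moreover have "y \<le> F (of_int (m + 1))" using add_int[of 0 "m+1"] by (simp add: m_def) linarith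
  ultimately show ?thesis
    using IVT'[of F "of_int m" y "of_int (m+1)"] continuous_on_subset[OF cont] by auto
qed

lemma funpow_surj: "\<exists>x. (F ^^ n) x = y"
  by (rule lift_map.surj_F[OF funpow_lift])

lemma iter_ge:
  assumes "(F ^^ q) x \<ge> x + of_int p" shows "(F ^^ (N * q)) x \<ge> x + real N * of_int p"
proof (induction N)
  case (Suc N)
  have "(F ^^ (Suc N * q)) x = (F ^^ (N * q)) ((F ^^ q) x)"
    by (metis add.commute comp_apply funpow_add mult_Suc)
  also have "\<dots> \<ge> (F ^^ (N * q)) (x + of_int p)" using assms by (simp add: funpow_le_iff)
  finally have "(F ^^ (Suc N * q)) x \<ge> (F ^^ (N * q)) x + of_int p" by (simp add: funpow_add_int)
  then show ?case using Suc by (simp add: algebra_simps)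
qed simp

lemma iter_le:
  assumes "(F ^^ q) x \<le> x + of_int p" shows "(F ^^ (N * q)) x \<le> x + real N * of_int p"
proof (induction N)
  case (Suc N)
  have "(F ^^ (Suc N * q)) x = (F ^^ (N * q)) ((F ^^ q) x)"
    by (metis add.commute comp_apply funpow_add mult_Suc)
  also have "\<dots> \<le> (F ^^ (N * q)) (x + of_int p)" using assms by (simp add: funpow_le_iff)
  finally have "(F ^^ (Suc N * q)) x \<le> (F ^^ (N * q)) x + of_int p" by (simp add: funpow_add_int)
  then show ?case using Suc by (simp add: algebra_simps)
qed simp

text \<open>After a shift by an integer the two points are less than 1 apart, and they stay so
  ordered under a common iterate. Taking \<open>2 * q * q'\<close> instead of \<open>q * q'\<close>
  iterates doubles the displacements, so the error 1 is absorbed by integrality.\<close>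

lemma displacement_compare:
  assumes "(F ^^ q) x \<ge> x + of_int p" "(F ^^ q') x' \<le> x' + of_int p'"
  shows "p * int q' \<le> p' * int q"
proof -
  define m where "m = \<lceil>x - x'\<rceil>"
  have m: "x \<le> x' + of_int m" "x' + of_int m < x + 1" unfolding m_def by linarith+
  have "(F ^^ (2 * q' * q)) x \<ge> x + real (2 * q') * of_int p" using iter_ge[OF assms(1)] by blast
  moreover have "(F ^^ (2 * q' * q)) x \<le> (F ^^ (2 * q' * q)) (x' + of_int m)"
    using m by (simp add: funpow_le_iff)
  moreover have "(F ^^ (2 * q * q')) x' \<le> x' + real (2 * q) * of_int p'" using iter_le[OF assms(2)] by blast
  moreover have "2 * q' * q = 2 * q * q'" by simp
  ultimately have "real (2 * q') * of_int p < real (2 * q) * of_int p' + 1"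
    using m by (simp add: funpow_add_int)
  then have "real_of_int (2 * int q' * p) < real_of_int (2 * int q * p' + 1)" by simp
  then have "2 * int q' * p < 2 * int q * p' + 1" by (rule of_int_less_iff[THEN iffD1])
  then show ?thesis by (simp add: algebra_simps)
qed

text \<open>The rotation number as a cut in the rationals. This makes comparison with p / q and
  monotonicity in the map immediate and needs no limit; \<open>rho_close\<close> recovers the usual
  description.\<close>

definition rho :: real where
  "rho = Inf {of_int p / real q | p q. q > 0 \<and> (\<exists>x. (F ^^ q) x \<le> x + of_int p)}"

lemma rho_set_lower:
  assumes "(F ^^ q) x \<ge> x + of_int p" "q > 0"
    and "s \<in> {of_int p / real q | p q. q > 0 \<and> (\<exists>x. (F ^^ q) x \<le> x + of_int p)}"
  shows "of_int p / real q \<le> s"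
proof -
  obtain p' q' x' where s: "s = of_int p' / real q'" "q' > 0" "(F ^^ q') x' \<le> x' + of_int p'"
    using assms(3) by auto
  have "p * int q' \<le> p' * int q" using displacement_compare[OF assms(1) s(3)] .
  then have "real_of_int (p * int q') \<le> real_of_int (p' * int q)" by (rule of_int_le_iff[THEN iffD2])
  then have "of_int p * real q' \<le> of_int p' * real q" by simp
  then show ?thesis using s(1,2) assms(2) by (simp only: divide_le_eq pos_le_divide_eq of_nat_0_less_iff) (simp add: field_simps)
qed

lemma rho_set_props:
  "{of_int p / real q | p q. q > 0 \<and> (\<exists>x. (F ^^ q) x \<le> x + of_int p)} \<noteq> {}"
  "bdd_below {of_int p / real q | p q. q > 0 \<and> (\<exists>x. (F ^^ q) x \<le> x + of_int p)}"
proof -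
  have "(F ^^ 1) 0 \<le> 0 + of_int \<lceil>F 0\<rceil>" by simp
  then show "{of_int p / real q | p q. q > 0 \<and> (\<exists>x. (F ^^ q) x \<le> x + of_int p)} \<noteq> {}"
    by blast
  have "(F ^^ 1) 0 \<ge> 0 + of_int \<lfloor>F 0\<rfloor>" by simp
  from rho_set_lower[OF this] show "bdd_below {of_int p / real q | p q. q > 0 \<and> (\<exists>x. (F ^^ q) x \<le> x + of_int p)}"
    by (intro bdd_belowI) auto
qed

lemma rho_le: "q > 0 \<Longrightarrow> (F ^^ q) x \<le> x + of_int p \<Longrightarrow> rho \<le> of_int p / real q"
  unfolding rho_def by (rule cInf_lower[OF _ rho_set_props(2)]) blast

lemma rho_ge: "q > 0 \<Longrightarrow> (F ^^ q) x \<ge> x + of_int p \<Longrightarrow> rho \<ge> of_int p / real q"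
  unfolding rho_def by (rule cInf_greatest[OF rho_set_props(1)]) (rule rho_set_lower)

lemma rho_periodic: "q > 0 \<Longrightarrow> (F ^^ q) x = x + of_int p \<Longrightarrow> rho = of_int p / real q"
  using rho_le[of q x p] rho_ge[of q x p] by auto

lemma rho_close: "\<bar>(F ^^ n) x - x - real n * rho\<bar> \<le> 1"
proof (cases "n = 0")
  case False
  define p where "p = \<lfloor>(F ^^ n) x - x\<rfloor>"
  have p: "x + of_int p \<le> (F ^^ n) x" "(F ^^ n) x \<le> x + of_int (p + 1)"
    unfolding p_def by linarith+
  have "of_int p / real n \<le> rho" "rho \<le> of_int (p+1) / real n"
    using rho_ge[OF _ p(1)] rho_le[OF _ p(2)] False by auto
  then have "of_int p \<le> real n * rho" "real n * rho \<le> of_int p + 1" using False by (auto simp: field_simps)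
  then show ?thesis using p by auto
qed simp

lemma displacement_away:
  assumes "\<And>x. F x \<noteq> x + c" shows "\<exists>e>0. \<forall>x. e \<le> \<bar>F x - x - c\<bar>"
proof -
  have "continuous_on {0..1} (\<lambda>x. \<bar>F x - x - c\<bar>)" using cont
    by (auto intro!: continuous_intros intro: continuous_on_subset)
  then obtain x0 where x0: "\<forall>x\<in>{0..1}. \<bar>F x0 - x0 - c\<bar> \<le> \<bar>F x - x - c\<bar>"
    using continuous_attains_inf[of "{0..1::real}" "\<lambda>x. \<bar>F x - x - c\<bar>"] by auto
  have "\<bar>F x0 - x0 - c\<bar> \<le> \<bar>F x - x - c\<bar>" for x
    using bspec[OF x0, of "frac x"] frac_lt_1[of x] add_int[of "frac x" "\<lfloor>x\<rfloor>"] by (simp add: frac_def)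
  moreover have "\<bar>F x0 - x0 - c\<bar> > 0" using assms[of x0] by auto
  ultimately show ?thesis by blast
qed

lemma no_periodic_sign:
  assumes "\<And>x. (F ^^ q) x \<noteq> x + of_int p"
  shows "(\<forall>x. (F ^^ q) x > x + of_int p) \<or> (\<forall>x. (F ^^ q) x < x + of_int p)"
proof (rule ccontr)
  let ?g = "\<lambda>x. (F ^^ q) x - x"
  assume "\<not> ?thesis"
  then obtain x y where "\<not> (F ^^ q) y < y + of_int p" "\<not> (F ^^ q) x > x + of_int p" by blast
  then have xy: "?g x < of_int p" "?g y > of_int p" using assms[of x] assms[of y] by linarith+
  have c: "continuous_on S ?g" for S using funpow_cont
    by (auto intro!: continuous_intros intro: continuous_on_subset)
  have "\<exists>z. ?g z = of_int p"
  proof (cases "x \<le> y")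
    case True then show ?thesis using IVT'[of ?g x "of_int p" y] xy c by (meson less_imp_le)
  next
    case False then show ?thesis using IVT2'[of ?g x "of_int p" y] xy c by (meson less_imp_le nle_le)
  qed
  then show False using assms by (metis add.commute diff_add_cancel)
qed

text \<open>If \<open>rho\<close> were p / q, the displacement of \<open>F ^^ q\<close> minus p
  would keep one sign and, by compactness, stay at least e away from 0. The drift over N blocks of q
  steps would then be at least N e > 1, against \<open>rho_close\<close>.\<close>

lemma rho_irrational:
  assumes "\<And>q p x. q > 0 \<Longrightarrow> (F ^^ q) x \<noteq> x + of_int p" shows "rho \<notin> \<rat>"
proof
  assume "rho \<in> \<rat>"
  then obtain p r where pr: "rho = of_int p / of_int r" "r > 0" by (rule Rats_cases') auto
  define q where "q = nat r"
  have q: "rho = of_int p / real q" "q > 0" using pr by (auto simp: q_def)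
  interpret G: lift_map "F ^^ q" by (rule funpow_lift)
  obtain e where e: "e > 0" "\<And>x. e \<le> \<bar>(F ^^ q) x - x - of_int p\<bar>"
    using G.displacement_away[OF assms[OF q(2)]] by blast
  obtain N :: nat where N: "real N * e > 1" using reals_Archimedean3[OF e(1)] by blast
  have step: "(F ^^ (Suc n * q)) 0 = (F ^^ q) ((F ^^ (n * q)) 0)" for n by (simp add: funpow_add)
  have "real n * e \<le> \<bar>(F ^^ (n * q)) 0 - real n * of_int p\<bar>" for n
    using no_periodic_sign[OF assms[OF q(2)], of p]
  proof
    assume s: "\<forall>x. (F ^^ q) x > x + of_int p"
    have "real n * e \<le> (F ^^ (n * q)) 0 - real n * of_int p"
    proof (induction n)
      case (Suc n)
      let ?y = "(F ^^ (n * q)) 0"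
      have "e \<le> (F ^^ q) ?y - ?y - of_int p" using e(2)[of ?y] spec[OF s, of ?y] by linarith
      then show ?case unfolding step using Suc by (simp add: algebra_simps)
    qed simp
    then show ?thesis by linarith
  next
    assume s: "\<forall>x. (F ^^ q) x < x + of_int p"
    have "real n * e \<le> real n * of_int p - (F ^^ (n * q)) 0"
    proof (induction n)
      case (Suc n)
      let ?y = "(F ^^ (n * q)) 0"
      have "e \<le> ?y + of_int p - (F ^^ q) ?y" using e(2)[of ?y] spec[OF s, of ?y] by linarith
      then show ?case unfolding step using Suc by (simp add: algebra_simps)
    qed simp
    then show ?thesis by linarith
  qed
  from this[of N] show False using rho_close[of "N * q" 0] N q by simp
qed

end

lemma dense_orbit:
  fixes \<theta> :: real
  assumes "\<theta> \<notin> \<rat>" "\<epsilon> > 0"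
  obtains k :: nat and m :: int where "\<bar>real k * \<theta> + of_int m - \<alpha>\<bar> < \<epsilon>"
proof -
  obtain h k where "k > 0" "\<bar>of_int k * \<theta> - of_int h - \<alpha>\<bar> < \<epsilon>"
    using sequence_of_fractional_parts_is_dense[OF assms] by blast
  then have "\<bar>real (nat k) * \<theta> + of_int (-h) - \<alpha>\<bar> < \<epsilon>" by simp
  then show ?thesis by (rule that)
qed

lemma mono_dense_range_continuous:
  fixes h :: "real \<Rightarrow> real"
  assumes "mono h" and dense: "\<And>a b. a < b \<Longrightarrow> \<exists>x. a < h x \<and> h x < b"
  shows "continuous_on UNIV h"
proof -
  have "isCont h x" for x
    unfolding continuous_at_eps_delta
  proof (intro allI impI)
    fix e :: real assume e: "e > 0"
    obtain u v where uv: "h x - e < h u" "h u < h x" "h x < h v" "h v < h x + e"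
      using dense[of "h x - e" "h x"] dense[of "h x" "h x + e"] e by auto
    have "u < x" "x < v" using uv \<open>mono h\<close> by (metis linorder_not_le monoD)+
    then have "\<bar>h y - h x\<bar> < e" if "\<bar>y - x\<bar> < min (x - u) (v - x)" for y
    proof -
      have "u \<le> y" "y \<le> v" using that by auto
      then have "h u \<le> h y" "h y \<le> h v" using \<open>mono h\<close> by (auto simp: monoD)
      then show ?thesis using uv by auto
    qed
    moreover have "min (x - u) (v - x) > 0" using \<open>u < x\<close> \<open>x < v\<close> by simp
    ultimately show "\<exists>d>0. \<forall>y. dist y x < d \<longrightarrow> dist (h y) (h x) < e"
      unfolding dist_real_def by blast
  qed
  then show ?thesis by (simp add: continuous_on_eq_continuous_at)
qed

context lift_map
begin

text \<open>By \<open>rho_close\<close> the limsup of \<open>(F ^^ n) x - n * rho\<close> is finite,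
  and it inherits monotonicity and the functional equations. Continuity comes for free: the range
  contains the dense set of all h 0 + k rho + m, and a monotone function with dense range has no
  jumps.\<close>

lemma rotation_semiconjugacy:
  assumes "rho \<notin> \<rat>"
  obtains h where "continuous_on UNIV h" "mono h" "\<And>x. h (x + 1) = h x + 1" "\<And>x. h (F x) = h x + rho"
proof -
  define l where "l x = limsup (\<lambda>n. ereal ((F ^^ n) x - real n * rho))" for x
  define h where "h x = real_of_ereal (l x)" for x
  have ub: "l x \<le> ereal (x + 1)" for x
    unfolding l_def by (intro Limsup_bounded always_eventually allI) (use rho_close[of _ x] in \<open>simp add: abs_le_iff algebra_simps\<close>)
  have lb: "l x \<ge> ereal (x - 1)" for x
  proof -
    have "ereal (x - 1) \<le> liminf (\<lambda>n. ereal ((F ^^ n) x - real n * rho))"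
      by (intro Liminf_bounded always_eventually allI) (use rho_close[of _ x] in \<open>simp add: abs_le_iff algebra_simps\<close>)
    also have "\<dots> \<le> l x" unfolding l_def by (rule Liminf_le_Limsup) simp
    finally show ?thesis .
  qed
  have l: "l x = ereal (h x)" for x
    unfolding h_def using ub[of x] lb[of x] by (cases "l x") auto
  have lc: "limsup (\<lambda>n. ereal (u n + c)) = limsup (\<lambda>n. ereal (u n)) + ereal c" for u :: "nat \<Rightarrow> real" and c
  proof -
    have "limsup (\<lambda>n. (\<lambda>n. ereal c) n + ereal (u n)) = ereal c + limsup (\<lambda>n. ereal (u n))"
      by (rule ereal_limsup_lim_add) auto
    then show ?thesis by (simp add: add.commute)
  qed
  have mono: "mono h"
  proof (rule monoI)
    fix x y :: real assume "x \<le> y"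
    then have "l x \<le> l y" unfolding l_def
      by (intro Limsup_mono always_eventually allI) (simp add: funpow_le_iff)
    then show "h x \<le> h y" by (simp add: l)
  qed
  have one: "h (x + 1) = h x + 1" for x
  proof -
    have "l (x + 1) = limsup (\<lambda>n. ereal (((F ^^ n) x - real n * rho) + 1))"
      unfolding l_def using funpow_add_int[of _ x 1] by (simp add: algebra_simps)
    also have "\<dots> = l x + ereal 1" unfolding lc l_def ..
    finally show ?thesis by (simp add: l)
  qed
  have hF: "h (F x) = h x + rho" for x
  proof -
    have "l x = limsup (\<lambda>n. ereal ((F ^^ Suc n) x - real (Suc n) * rho))"
      unfolding l_def using limsup_shift[of "\<lambda>n. ereal ((F ^^ n) x - real n * rho)"] by simp
    also have "\<dots> = limsup (\<lambda>n. ereal (((F ^^ n) (F x) - real n * rho) + (- rho)))"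
      by (simp add: funpow_swap1 algebra_simps)
    also have "\<dots> = l (F x) + ereal (- rho)" unfolding lc l_def ..
    finally show ?thesis by (simp add: l)
  qed
  have hFn: "h ((F ^^ n) x + of_int m) = h x + real n * rho + of_int m" for n x m
  proof -
    have "h ((F ^^ n) x) = h x + real n * rho"
      by (induction n) (auto simp: hF algebra_simps)
    then show ?thesis by (simp add: add_of_int[of h, OF one])
  qed
  have dense: "\<exists>x. a < h x \<and> h x < b" if "a < b" for a b
  proof -
    obtain k :: nat and m :: int where "\<bar>real k * rho + of_int m - ((a + b) / 2 - h 0)\<bar> < (b - a) / 2"
      using dense_orbit[OF assms, of "(b - a) / 2" "(a + b) / 2 - h 0"] \<open>a < b\<close> by auto
    then have "\<bar>h ((F ^^ k) 0 + of_int m) - (a + b) / 2\<bar> < (b - a) / 2"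
      unfolding hFn by (simp only: algebra_simps)
    then have "a < h ((F ^^ k) 0 + of_int m)" "h ((F ^^ k) 0 + of_int m) < b"
      unfolding abs_diff_less_iff by (simp_all add: field_simps)
    then show ?thesis by blast
  qed
  show ?thesis
    by (rule that[OF mono_dense_range_continuous[OF mono dense] mono one hF])
qed

end


section \<open>Farey neighbours of an irrational number\<close>

definition farey_around :: "real \<Rightarrow> int \<Rightarrow> int \<Rightarrow> int \<Rightarrow> int \<Rightarrow> bool" where
  "farey_around \<theta> p q p' q' \<longleftrightarrow>
     q > 0 \<and> q' > 0 \<and> p' * q - p * q' = 1 \<and> of_int p < of_int q * \<theta> \<and> of_int q' * \<theta> < of_int p'"

lemma farey_around_reflect: "farey_around \<theta> p q p' q' \<Longrightarrow> farey_around (- \<theta>) (- p') q' (- p) q"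
  by (auto simp: farey_around_def)

lemma irrational_int_comb:
  fixes \<theta> :: real
  assumes "\<theta> \<notin> \<rat>" "q \<noteq> 0" shows "of_int q * \<theta> \<noteq> of_int p"
proof
  assume "of_int q * \<theta> = of_int p"
  then have "\<theta> = of_int p / of_int q" using assms by (simp add: field_simps)
  then show False using assms by simp
qed

text \<open>One step of the continued fraction: mediants with p / q are inserted as long as they
  remain to the right of \<theta>, which happens j times. The next mediant falls to the left and
  becomes the new left neighbour.\<close>

lemma farey_flip:
  assumes irr: "\<theta> \<notin> \<rat>" and "farey_around \<theta> p q p' q'" "q \<le> q'"
  obtains P Q P' Q' where "farey_around \<theta> P Q P' Q'" "Q' \<le> Q" "Q \<le> 2 * Q'" "q' \<le> Q'" "q + q' \<le> Q"
proof -
  define \<alpha> where "\<alpha> = of_int q * \<theta> - of_int p"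
  define \<beta> where "\<beta> = of_int p' - of_int q' * \<theta>"
  have pos: "\<alpha> > 0" "\<beta> > 0" and q: "q > 0" "q' > 0" and det: "p' * q - p * q' = 1"
    using assms(2) by (auto simp: farey_around_def \<alpha>_def \<beta>_def)
  define j where "j = \<lfloor>\<beta> / \<alpha>\<rfloor>"
  have j0: "j \<ge> 0" using pos by (simp add: j_def)
  have "of_int j \<le> \<beta> / \<alpha>" "\<beta> / \<alpha> < of_int j + 1" unfolding j_def by linarith+
  then have j: "of_int j * \<alpha> \<le> \<beta>" "\<beta> < (of_int j + 1) * \<alpha>" using pos by (auto simp: field_simps)
  define P' where "P' = j * p + p'"
  define Q' where "Q' = j * q + q'"
  have Q': "Q' \<ge> q'" using j0 q by (simp add: Q'_def)
  have r: "of_int P' - of_int Q' * \<theta> = \<beta> - of_int j * \<alpha>"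
    by (simp add: P'_def Q'_def \<alpha>_def \<beta>_def algebra_simps)
  then have "of_int Q' * \<theta> < of_int P'"
    using j(1) irrational_int_comb[OF irr, of Q' P'] Q' q by linarith
  moreover have "of_int (Q' + q) * \<theta> - of_int (P' + p) = (of_int j + 1) * \<alpha> - \<beta>"
    by (simp add: P'_def Q'_def \<alpha>_def \<beta>_def algebra_simps)
  then have "of_int (P' + p) < of_int (Q' + q) * \<theta>" using j(2) by linarith
  moreover have "P' * (Q' + q) - (P' + p) * Q' = 1" using det by (simp add: P'_def Q'_def algebra_simps)
  ultimately have "farey_around \<theta> (P' + p) (Q' + q) P' Q'" using Q' q by (auto simp: farey_around_def)
  then show thesis by (rule that) (use Q' q assms(3) in auto)
qed

lemma farey_flip':
  assumes irr: "\<theta> \<notin> \<rat>" and "farey_around \<theta> p q p' q'" "q' \<le> q"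
  obtains P Q P' Q' where "farey_around \<theta> P Q P' Q'" "Q \<le> Q'" "Q' \<le> 2 * Q" "q \<le> Q" "q + q' \<le> Q'"
proof -
  have irr': "- \<theta> \<notin> \<rat>" using irr by (metis Rats_minus_iff)
  obtain P Q P' Q' where "farey_around (- \<theta>) P Q P' Q'" "Q' \<le> Q" "Q \<le> 2 * Q'" "q \<le> Q'" "q' + q \<le> Q"
    by (rule farey_flip[OF irr' farey_around_reflect[OF assms(2)] assms(3)])
  then show thesis using farey_around_reflect[of "-\<theta>" P Q P' Q'] that[of "- P'" Q' "- P" Q] by auto
qed

lemma balanced_farey_around:
  assumes irr: "\<theta> \<notin> \<rat>"
  obtains p q p' q' where "farey_around \<theta> p q p' q'" "q \<le> 2 * q'" "q' \<le> 2 * q" "int N \<le> q" "int N \<le> q'"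
proof -
  have "\<exists>p q p' q'. farey_around \<theta> p q p' q' \<and> q \<le> q' \<and> int N \<le> q"
  proof (induction N)
    case 0
    have "of_int 1 * \<theta> \<noteq> of_int \<lfloor>\<theta>\<rfloor>" by (rule irrational_int_comb[OF irr]) simp
    then have "of_int \<lfloor>\<theta>\<rfloor> < \<theta>" by linarith
    moreover have "\<theta> < of_int (\<lfloor>\<theta>\<rfloor> + 1)" by linarith
    ultimately have "farey_around \<theta> \<lfloor>\<theta>\<rfloor> 1 (\<lfloor>\<theta>\<rfloor> + 1) 1" by (auto simp: farey_around_def)
    then show ?case by force
  next
    case (Suc N)
    then obtain p q p' q' where 1: "farey_around \<theta> p q p' q'" "q \<le> q'" "int N \<le> q" by blast
    obtain P Q P' Q' where 2: "farey_around \<theta> P Q P' Q'" "Q' \<le> Q" "q' \<le> Q'" "q + q' \<le> Q"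
      by (rule farey_flip[OF irr 1(1,2)])
    obtain R S R' S' where 3: "farey_around \<theta> R S R' S'" "S \<le> S'" "Q \<le> S"
      by (rule farey_flip'[OF irr 2(1,2)])
    \<comment> \<open>Two flips restore the order of the denominators and enlarge the smaller one,
      since S >= Q >= q + q' > q.\<close>
    moreover have "int (Suc N) \<le> S" using 1(1,3) 2(4) 3(3) unfolding farey_around_def by linarith
    ultimately show ?case by blast
  qed
  then obtain p q p' q' where 1: "farey_around \<theta> p q p' q'" "q \<le> q'" "int N \<le> q" by blast
  obtain P Q P' Q' where 2: "farey_around \<theta> P Q P' Q'" "Q' \<le> Q" "Q \<le> 2 * Q'" "q' \<le> Q'" "q + q' \<le> Q"
    by (rule farey_flip[OF irr 1(1,2)])
  show thesis by (rule that[OF 2(1)]) (use 1 2 in auto)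
qed

text \<open>By unimodularity (j, m) is an integer combination of (q, p) and (q', p') with
  coefficients a, b, and j \<theta> - m = a \<alpha> - b \<beta>. If a and b had weakly equal signs,
  |j| would reach q or q'. So the signs are opposite and the two errors add up.\<close>

lemma farey_gap:
  assumes "farey_around \<theta> p q p' q'" "j \<noteq> 0" "\<bar>j\<bar> < q" "\<bar>j\<bar> < q'"
  shows "\<bar>of_int j * \<theta> - of_int m\<bar> \<ge> (of_int q * \<theta> - of_int p) + (of_int p' - of_int q' * \<theta>)"
proof -
  define \<alpha> where "\<alpha> = of_int q * \<theta> - of_int p"
  define \<beta> where "\<beta> = of_int p' - of_int q' * \<theta>"
  have pos: "\<alpha> > 0" "\<beta> > 0" and q: "q > 0" "q' > 0" and det: "p' * q - p * q' = 1"
    using assms(1) by (auto simp: farey_around_def \<alpha>_def \<beta>_def)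
  define a where "a = j * p' - m * q'"
  define b where "b = m * q - j * p"
  have "a * q + b * q' = j * (p' * q - p * q')" by (simp add: a_def b_def algebra_simps)
  then have j: "j = a * q + b * q'" using det by simp
  have "a * p + b * p' = m * (p' * q - p * q')" by (simp add: a_def b_def algebra_simps)
  then have m: "m = a * p + b * p'" using det by simp
  have e: "of_int j * \<theta> - of_int m = of_int a * \<alpha> - of_int b * \<beta>"
    unfolding j m by (simp add: \<alpha>_def \<beta>_def algebra_simps)
  consider "a \<ge> 1 \<and> b \<le> -1" | "a \<le> -1 \<and> b \<ge> 1" | "a \<ge> 0 \<and> b \<ge> 0" | "a \<le> 0 \<and> b \<le> 0" by linarith
  then show ?thesis
  proof cases
    case 1
    then have "1 \<le> real_of_int a" "1 \<le> real_of_int (- b)" by linarith+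
    then have "1 * \<alpha> \<le> of_int a * \<alpha>" "1 * \<beta> \<le> of_int (- b) * \<beta>" using pos by (intro mult_right_mono; simp)+
    then show ?thesis unfolding e \<alpha>_def[symmetric] \<beta>_def[symmetric] by simp
  next
    case 2
    then have "1 \<le> real_of_int (- a)" "1 \<le> real_of_int b" by linarith+
    then have "1 * \<alpha> \<le> of_int (- a) * \<alpha>" "1 * \<beta> \<le> of_int b * \<beta>" using pos by (intro mult_right_mono; simp)+
    then show ?thesis unfolding e \<alpha>_def[symmetric] \<beta>_def[symmetric] by simp
  next
    case 3
    have "a * q + b * q' \<ge> q \<or> a * q + b * q' \<ge> q'"
    proof (cases "a = 0")
      case True
      then have "b \<ge> 1" using 3 assms(2) j by (cases "b = 0") auto
      then show ?thesis using True mult_right_mono[of 1 b q'] q by auto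
    next
      case False
      then have "a \<ge> 1" using 3 by auto
      then have "1 * q \<le> a * q" using q by (intro mult_right_mono) auto
      moreover have "0 \<le> b * q'" using 3 q by auto
      ultimately show ?thesis by auto
    qed
    then show ?thesis using j assms by auto
  next
    case 4
    have "- (a * q + b * q') \<ge> q \<or> - (a * q + b * q') \<ge> q'"
    proof (cases "a = 0")
      case True
      then have "- b \<ge> 1" using 4 assms(2) j by (cases "b = 0") auto
      then show ?thesis using True mult_right_mono[of 1 "- b" q'] q by auto
    next
      case False
      then have "- a \<ge> 1" using 4 by auto
      then have "1 * q \<le> (- a) * q" using q by (intro mult_right_mono) auto
      moreover have "0 \<le> (- b) * q'" using 4 q by (intro mult_nonneg_nonneg) auto
      ultimately show ?thesis by auto
    qed
    then show ?thesis using j assms by auto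
  qed
qed

lemma farey_identity:
  assumes "farey_around \<theta> p q p' q'"
  shows "of_int q' * (of_int q * \<theta> - of_int p) + of_int q * (of_int p' - of_int q' * \<theta>) = 1"
proof -
  have "of_int q' * (of_int q * \<theta> - of_int p) + of_int q * (of_int p' - of_int q' * \<theta>) = of_int (p' * q - p * q')"
    by (simp add: algebra_simps)
  then show ?thesis using assms by (simp add: farey_around_def del: of_int_diff of_int_mult)
qed

text \<open>The two terms in \<open>farey_identity\<close> sum to 1, and exchanging q and q' in them
  costs a factor 2; hence one of q \<alpha>, q' \<beta> is at least 1 / 4.\<close>

lemma farey_far_endpoint:
  assumes "farey_around \<theta> p q p' q'" "q \<le> 2 * q'" "q' \<le> 2 * q"
  shows "of_int q * \<theta> - of_int p \<ge> 1 / (4 * of_int q) \<or> of_int p' - of_int q' * \<theta> \<ge> 1 / (4 * of_int q')"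
proof -
  define \<alpha> where "\<alpha> = of_int q * \<theta> - of_int p"
  define \<beta> where "\<beta> = of_int p' - of_int q' * \<theta>"
  have pos: "\<alpha> > 0" "\<beta> > 0" and q: "q > 0" "q' > 0"
    using assms(1) by (auto simp: farey_around_def \<alpha>_def \<beta>_def)
  have s: "of_int q' * \<alpha> + of_int q * \<beta> = 1" unfolding \<alpha>_def \<beta>_def by (rule farey_identity[OF assms(1)])
  have "real_of_int q \<le> of_int (2 * q')" "real_of_int q' \<le> of_int (2 * q)" using assms(2,3) by (simp_all only: of_int_le_iff)
  then have "of_int q' * \<alpha> \<le> 2 * of_int q * \<alpha>" "of_int q * \<beta> \<le> 2 * of_int q' * \<beta>"
    using pos by (auto intro!: mult_right_mono)
  then have "of_int q * \<alpha> \<ge> 1/4 \<or> of_int q' * \<beta> \<ge> 1/4" using s by linarith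
  then show ?thesis using q unfolding \<alpha>_def \<beta>_def by (auto simp: field_simps)
qed

lemma farey_small:
  assumes "farey_around \<theta> p q p' q'"
  shows "of_int q * \<theta> - of_int p < 1 / of_int q'" "of_int p' - of_int q' * \<theta> < 1 / of_int q"
proof -
  define \<alpha> where "\<alpha> = of_int q * \<theta> - of_int p"
  define \<beta> where "\<beta> = of_int p' - of_int q' * \<theta>"
  have pos: "\<alpha> > 0" "\<beta> > 0" and q: "q > 0" "q' > 0"
    using assms(1) by (auto simp: farey_around_def \<alpha>_def \<beta>_def)
  have s: "of_int q' * \<alpha> + of_int q * \<beta> = 1" unfolding \<alpha>_def \<beta>_def by (rule farey_identity[OF assms(1)])
  have "of_int q' * \<alpha> > 0" "of_int q * \<beta> > 0" using pos q by auto
  then have "of_int q' * \<alpha> < 1" "of_int q * \<beta> < 1" using s by linarith+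
  then show "of_int q * \<theta> - of_int p < 1 / of_int q'" "of_int p' - of_int q' * \<theta> < 1 / of_int q"
    using q unfolding \<alpha>_def[symmetric] \<beta>_def[symmetric] by (auto simp: field_simps)
qed


section \<open>A covering argument for monotone functions\<close>

text \<open>Vitali's theorem selects disjoint intervals that cover \<open>E\<close> up to a null
  set. By monotonicity their images do not overlap, they lie in \<open>U\<close>, and each is at
  least \<open>K\<close> times as long as its interval. The conclusion bounds an outer measure, so
  it applies to sets \<open>E\<close> not known to be measurable.\<close>

lemma expanding_cover:
  fixes f :: "real \<Rightarrow> real"
  assumes mono: "mono_on S f" and K: "K > 0" and U: "U \<in> lmeasurable"
    and cover: "\<And>t d. t \<in> E \<Longrightarrow> d > 0 \<Longrightarrow>
      \<exists>a b. a \<in> S \<and> b \<in> S \<and> a < b \<and> b - a < d \<and> a \<le> t \<and> t \<le> b \<and> K * (b - a) \<le> f b - f a \<and> {f a..f b} \<subseteq> U"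
  obtains T where "E \<subseteq> T" "T \<in> lmeasurable" "measure lebesgue T \<le> measure lebesgue U / K"
proof -
  define I where "I = {(a, b). a \<in> S \<and> b \<in> S \<and> a < b \<and> K * (b - a) \<le> f b - f a \<and> {f a..f b} \<subseteq> U}"
  let ?c = "\<lambda>(a, b). (a + b) / 2 :: real" and ?r = "\<lambda>(a, b). (b - a) / 2 :: real"
  have cb: "cball (?c i) (?r i) = {fst i..snd i}" for i
    by (cases i) (auto simp: cball_eq_atLeastAtMost field_simps)
  have cov: "\<exists>i. i \<in> I \<and> x \<in> cball (?c i) (?r i) \<and> ?r i < d" if xd: "x \<in> E" "0 < d" for x d
  proof -
    obtain a b where ab: "a \<in> S" "b \<in> S" "a < b" "b - a < d" "a \<le> x" "x \<le> b" "K * (b - a) \<le> f b - f a" "{f a..f b} \<subseteq> U"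
      using cover[OF xd] by metis
    then have "(a, b) \<in> I" "x \<in> {fst (a, b)..snd (a, b)}" "?r (a, b) < d" by (auto simp: I_def)
    then show ?thesis unfolding cb by blast
  qed
  have rpos: "0 < ?r i" if "i \<in> I" for i using that by (auto simp: I_def)
  obtain C where C: "countable C" "C \<subseteq> I"
      "pairwise (\<lambda>i j. disjnt (cball (?c i) (?r i)) (cball (?c j) (?r j))) C"
      "negligible (E - (\<Union>i\<in>C. cball (?c i) (?r i)))"
    by (rule Vitali_covering_theorem_cballs[of I ?r E ?c, OF rpos cov])
  let ?J = "\<lambda>i. {fst i..snd i} :: real set" and ?J' = "\<lambda>i. {f (fst i)<..<f (snd i)}"
  have disj: "disjoint_family_on ?J C"
    using C(3) unfolding cb disjoint_family_on_def pairwise_def disjnt_def by auto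
  have disj': "disjoint_family_on ?J' C"
    \<comment> \<open>The images are taken open: \<open>f\<close> need not be strictly increasing,
      so disjoint intervals may have images with a common end point.\<close>
    unfolding disjoint_family_on_def
  proof (intro ballI impI)
    fix i j assume ij: "i \<in> C" "j \<in> C" "i \<noteq> j"
    obtain a b a' b' where i: "i = (a, b)" "j = (a', b')" by (cases i, cases j)
    have s: "a \<in> S" "b \<in> S" "a' \<in> S" "b' \<in> S" "a < b" "a' < b'" using ij C(2) i by (auto simp: I_def)
    have "{a..b} \<inter> {a'..b'} = {}" using disjoint_family_onD[OF disj ij] unfolding i by simp
    then have "b < a' \<or> b' < a" using s
      by (metis atLeastAtMost_iff disjoint_iff less_imp_le linorder_not_le nle_le)
    then have "f b \<le> f a' \<or> f b' \<le> f a" using s mono by (auto intro: mono_onD)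
    then show "?J' i \<inter> ?J' j = {}" unfolding i by auto
  qed
  have "emeasure lebesgue (\<Union>i\<in>C. ?J i) = (\<integral>\<^sup>+ i. emeasure lebesgue (?J i) \<partial>count_space C)"
    by (rule emeasure_UN_countable[OF _ C(1) disj]) auto
  also have "\<dots> \<le> (\<integral>\<^sup>+ i. ennreal (1 / K) * emeasure lebesgue (?J' i) \<partial>count_space C)"
  proof (rule nn_integral_mono)
    fix i assume "i \<in> space (count_space C)"
    then have "i \<in> I" using C(2) by auto
    then have i: "fst i < snd i" "K * (snd i - fst i) \<le> f (snd i) - f (fst i)" by (auto simp: I_def)
    then have "0 \<le> f (snd i) - f (fst i)" using K by (smt (verit) mult_pos_pos)
    moreover have "snd i - fst i \<le> 1 / K * (f (snd i) - f (fst i))" using i K by (simp add: field_simps)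
    ultimately show "emeasure lebesgue (?J i) \<le> ennreal (1 / K) * emeasure lebesgue (?J' i)"
      using i K by (simp add: ennreal_mult[symmetric] ennreal_leI del: times_divide_eq_left)
  qed
  also have "\<dots> = ennreal (1 / K) * (\<integral>\<^sup>+ i. emeasure lebesgue (?J' i) \<partial>count_space C)"
    by (rule nn_integral_cmult) simp
  also have "(\<integral>\<^sup>+ i. emeasure lebesgue (?J' i) \<partial>count_space C) = emeasure lebesgue (\<Union>i\<in>C. ?J' i)"
    by (rule emeasure_UN_countable[OF _ C(1) disj', symmetric]) auto
  also have "\<dots> \<le> emeasure lebesgue U"
  proof (rule emeasure_mono)
    show "(\<Union>i\<in>C. ?J' i) \<subseteq> U"
    proof safe
      fix x a b assume "(a, b) \<in> C" "x \<in> ?J' (a, b)"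
      then have "{f a..f b} \<subseteq> U" "x \<in> {f a..f b}" using C(2) by (auto simp: I_def)
      then show "x \<in> U" by blast
    qed
  qed (use U in auto)
  also have "emeasure lebesgue U = ennreal (measure lebesgue U)"
    using U by (simp add: emeasure_eq_measure2)
  finally have em: "emeasure lebesgue (\<Union>i\<in>C. ?J i) \<le> ennreal (measure lebesgue U / K)"
    using K by (auto simp: ennreal_mult[symmetric] mult_left_mono)
  have J: "(\<Union>i\<in>C. ?J i) \<in> lmeasurable"
    using em C(1) by (intro fmeasurableI) (auto simp: le_less_trans intro!: sets.countable_UN')
  have "measure lebesgue (\<Union>i\<in>C. ?J i) \<le> measure lebesgue U / K"
    using em K by (simp add: measure_def enn2real_leI)
  moreover define Z where "Z = E - (\<Union>i\<in>C. ?J i)"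
  have "negligible Z" using C(4) unfolding cb Z_def .
  ultimately have "measure lebesgue ((\<Union>i\<in>C. ?J i) \<union> Z) \<le> measure lebesgue U / K"
    and "(\<Union>i\<in>C. ?J i) \<union> Z \<in> lmeasurable"
    using J measure_Un_le[of "\<Union>i\<in>C. ?J i" lebesgue Z] negligible_imp_measurable[of Z] negligible_imp_measure0[of Z]
    by (auto intro: fmeasurable.Un)
  moreover have "E \<subseteq> (\<Union>i\<in>C. ?J i) \<union> Z" unfolding Z_def by blast
  ultimately show thesis using that by blast
qed


section \<open>Fourier analysis of Birkhoff sums over a rotation\<close>

abbreviation unit_interval :: "real measure" where
  "unit_interval \<equiv> restrict_space lborel {0..<1}"

interpretation unit_interval: finite_measure unit_interval
  by (rule finite_measureI) (simp add: emeasure_restrict_space)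

definition circle_char :: "int \<Rightarrow> real \<Rightarrow> complex" where
  "circle_char n y = cis (2 * pi * (of_int n * y))"

lemma norm_circle_char [simp]: "norm (circle_char n y) = 1"
  by (simp add: circle_char_def)

lemma circle_char_add: "circle_char n (x + y) = circle_char n x * circle_char n y"
  by (simp add: circle_char_def cis_mult algebra_simps)

lemma circle_char_of_nat_mult: "circle_char n (real k * y) = circle_char n y ^ k"
  by (simp add: circle_char_def Complex.DeMoivre algebra_simps)

lemma circle_char_of_int [simp]: "circle_char n (of_int m) = 1"
  unfolding circle_char_def by (metis cis_multiple_2pi Ints_mult Ints_of_int)

lemma circle_char_0 [simp]: "circle_char 0 y = 1" "circle_char n 0 = 1" by (auto simp: circle_char_def)

lemma circle_char_mult_cnj: "circle_char n y * cnj (circle_char m y) = circle_char (n - m) y"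
  by (simp add: circle_char_def cis_cnj cis_mult algebra_simps)

lemma cnj_circle_char: "cnj (circle_char n y) = circle_char (- n) y"
  by (simp add: circle_char_def cis_cnj)

lemma cnj_measurable [measurable (raw)]:
  "f \<in> borel_measurable M \<Longrightarrow> (\<lambda>x. cnj (f x)) \<in> borel_measurable M"
  by (rule borel_measurable_continuous_on[where f = cnj]) (intro continuous_intros)

lemma circle_char_measurable [measurable]: "circle_char n \<in> borel_measurable borel"
  unfolding circle_char_def cis_conv_exp by (intro borel_measurable_continuous_onI continuous_intros)

lemma circle_char_eq_1_iff: "n \<noteq> 0 \<Longrightarrow> y \<notin> \<rat> \<Longrightarrow> circle_char n y \<noteq> 1"
proof
  assume "n \<noteq> 0" "y \<notin> \<rat>" "circle_char n y = 1"
  then have "cos (2 * pi * (of_int n * y)) = 1" by (simp add: circle_char_def complex_eq_iff)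
  then obtain k where "2 * pi * (of_int n * y) = of_int k * 2 * pi" using cos_one_2pi_int by blast
  then have "of_int n * y = of_int k" by (simp add: field_simps)
  then have "y = of_int k / of_int n" using \<open>n \<noteq> 0\<close> by (simp add: field_simps)
  then show False using \<open>y \<notin> \<rat>\<close> by simp
qed

lemma unit_interval_measurable: "f \<in> borel_measurable borel \<Longrightarrow> f \<in> borel_measurable unit_interval"
  by (intro measurable_restrict_space1) simp

lemma integrable_unit_interval:
  fixes f :: "real \<Rightarrow> 'a::{banach, second_countable_topology}"
  assumes "f \<in> borel_measurable borel" "\<And>x. norm (f x) \<le> B"
  shows "integrable unit_interval f"
  by (rule unit_interval.integrable_const_bound[of _ B]) (use assms in \<open>auto simp: unit_interval_measurable\<close>)

lemma integral_unit_interval: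
  fixes f :: "real \<Rightarrow> 'a::{banach, second_countable_topology}"
  shows "integral\<^sup>L unit_interval f = (\<integral>x. indicator {0..<1} x *\<^sub>R f x \<partial>lborel)"
  by (rule integral_restrict_space) simp

lemma measure_unit_interval [simp]: "measure unit_interval {0..<1} = 1"
  by (simp add: measure_restrict_space)

lemma integral_circle_char_initial:
  assumes "n \<noteq> 0" "0 \<le> c"
  shows "(\<integral>y. indicator {0..<c} y *\<^sub>R circle_char n y \<partial>lborel) = (circle_char n c - 1) / (2 * pi * \<i> * of_int n)"
proof -
  let ?F = "\<lambda>y. circle_char n y / (2 * pi * \<i> * of_int n)"
  have e: "circle_char n y = exp (\<i> * (2 * pi * (of_int n * of_real y)))" for y
    by (simp add: circle_char_def cis_conv_exp)
  have "(\<integral>y. indicator {0..<c} y *\<^sub>R circle_char n y \<partial>lborel) = (\<integral>y. indicator {0..c} y *\<^sub>R circle_char n y \<partial>lborel)"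
  proof (rule integral_cong_AE)
    have "AE y in lborel. y \<noteq> c" by (rule AE_lborel_singleton)
    then show "AE y in lborel. indicator {0..<c} y *\<^sub>R circle_char n y = indicator {0..c} y *\<^sub>R circle_char n y"
      by eventually_elim (auto simp: indicator_def)
  qed measurable
  also have "\<dots> = ?F c - ?F 0"
  proof (rule integral_FTC_Icc[OF \<open>0 \<le> c\<close>])
    fix x :: real
    have "((\<lambda>y. exp (\<i> * (2 * pi * (of_int n * of_real y))) / (2 * pi * \<i> * of_int n)) has_vector_derivative
        exp (\<i> * (2 * pi * (of_int n * of_real x)))) (at x within {0..c})"
      using assms(1) by (auto intro!: derivative_eq_intros has_vector_derivative_real_field simp: field_simps)
    then show "(?F has_vector_derivative circle_char n x) (at x within {0..c})" by (simp add: e)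
  next
    show "continuous_on {0..c} (circle_char n)" unfolding circle_char_def by (intro continuous_intros)
  qed
  finally show ?thesis by (simp add: diff_divide_distrib)
qed

lemma integral_circle_char: "(\<integral>y. circle_char n y \<partial>unit_interval) = (if n = 0 then 1 else 0)"
proof (cases "n = 0")
  case True
  then have "circle_char n = (\<lambda>_. 1)" by auto
  then show ?thesis using True by simp
next
  case False
  then show ?thesis using integral_circle_char_initial[of n 1] circle_char_of_int[of n 1]
    by (simp add: integral_unit_interval del: circle_char_of_int)
qed

lemma emeasure_Ico_finite: "emeasure lborel {u..<v::real} < \<infinity>"
  by (cases "u \<le> v") auto

lemma integral_periodic_shift:
  fixes f :: "real \<Rightarrow> 'a::{banach, second_countable_topology}"
  assumes f [measurable]: "f \<in> borel_measurable borel" and B: "\<And>x. norm (f x) \<le> B"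
    and per: "\<And>x. f (x + 1) = f x"
  shows "(\<integral>y. f (y + a) \<partial>unit_interval) = (\<integral>y. f y \<partial>unit_interval)"
proof -
  have per': "f (x + of_int m) = f x" for x m
  proof (induction m rule: int_induct[where k=0])
    case (step1 i) then show ?case using per[of "x + of_int i"] by (simp add: add.assoc)
  next
    case (step2 i) then show ?case using per[of "x + of_int (i - 1)"] by (simp add: algebra_simps)
  qed simp
  define b where "b = frac a"
  have b: "0 \<le> b" "b < 1" by (auto simp: b_def frac_lt_1)
  have fa: "f (y + a) = f (y + b)" for y
    using per'[of "y + b" "\<lfloor>a\<rfloor>"] by (simp add: b_def frac_def)
  have int: "integrable lborel (\<lambda>x. indicator {u..<v} x *\<^sub>R f x)" for u v
    by (rule integrableI_bounded_set_indicator[of _ _ _ B])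
      (use B emeasure_Ico_finite in auto)
  have "(\<integral>y. f (y + b) \<partial>unit_interval) = (\<integral>x. indicator {0..<1} x *\<^sub>R f (b + 1 * x) \<partial>lborel)"
    unfolding integral_unit_interval by (simp add: add.commute)
  also have "\<dots> = (\<integral>x. (\<lambda>z. indicator {b..<b+1} z *\<^sub>R f z) (b + 1 * x) \<partial>lborel)"
    by (intro Bochner_Integration.integral_cong refl) (auto simp: indicator_def)
  also have "\<dots> = (\<integral>z. indicator {b..<b+1} z *\<^sub>R f z \<partial>lborel)"
    using lborel_integral_real_affine[of 1 "\<lambda>z. indicator {b..<b+1} z *\<^sub>R f z" b] by simp
  also have "\<dots> = (\<integral>z. indicator {b..<1} z *\<^sub>R f z + indicator {1..<b+1} z *\<^sub>R f z \<partial>lborel)"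
    using b by (intro Bochner_Integration.integral_cong refl) (auto simp: indicator_def)
  also have "\<dots> = (\<integral>z. indicator {b..<1} z *\<^sub>R f z \<partial>lborel) + (\<integral>z. indicator {1..<b+1} z *\<^sub>R f z \<partial>lborel)"
    by (intro Bochner_Integration.integral_add int)
  also have "(\<integral>z. indicator {1..<b+1} z *\<^sub>R f z \<partial>lborel) = (\<integral>x. indicator {1..<b+1} (1 + 1 * x) *\<^sub>R f (1 + 1 * x) \<partial>lborel)"
    using lborel_integral_real_affine[of 1 "\<lambda>z. indicator {1..<b+1} z *\<^sub>R f z" 1] by simp
  also have "\<dots> = (\<integral>x. indicator {0..<b} x *\<^sub>R f x \<partial>lborel)"
    using per by (intro Bochner_Integration.integral_cong refl) (auto simp: indicator_def add.commute)
  also have "(\<integral>z. indicator {b..<1} z *\<^sub>R f z \<partial>lborel) + (\<integral>z. indicator {0..<b} z *\<^sub>R f z \<partial>lborel)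
      = (\<integral>z. indicator {b..<1} z *\<^sub>R f z + indicator {0..<b} z *\<^sub>R f z \<partial>lborel)"
    by (intro Bochner_Integration.integral_add[symmetric] int)
  also have "\<dots> = (\<integral>z. indicator {0..<1} z *\<^sub>R f z \<partial>lborel)"
    using b by (intro Bochner_Integration.integral_cong refl) (auto simp: indicator_def)
  finally show ?thesis by (simp add: fa integral_unit_interval)
qed

lemma bessel:
  fixes f :: "real \<Rightarrow> real"
  assumes f [measurable]: "f \<in> borel_measurable borel" and B: "\<And>x. \<bar>f x\<bar> \<le> B" and I: "finite I"
  shows "(\<Sum>n\<in>I. (norm (\<integral>y. of_real (f y) * circle_char n y \<partial>unit_interval))\<^sup>2) \<le> (\<integral>y. (f y)\<^sup>2 \<partial>unit_interval)"
proof -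
  define c where "c n = (\<integral>y. of_real (f y) * circle_char n y \<partial>unit_interval)" for n
  \<comment> \<open>\<open>c n\<close> pairs \<open>f\<close> with the character itself and not with
    its conjugate, so it is the Fourier coefficient at - n; hence the sign. \<open>P\<close> is the
    orthogonal projection of \<open>f\<close> to these characters.\<close>
  define P where "P y = (\<Sum>n\<in>I. c n * circle_char (- n) y)" for y
  have Pm [measurable]: "P \<in> borel_measurable borel" unfolding P_def by measurable
  define PB where "PB = (\<Sum>n\<in>I. norm (c n))"
  have PB: "norm (P y) \<le> PB" for y
    unfolding P_def PB_def by (rule sum_norm_le) (simp add: norm_mult)
  have B0: "B \<ge> 0" and PB0: "PB \<ge> 0" using B[of 0] PB[of 0] norm_ge_zero order_trans by (fastforce, blast)
  have i1: "integrable unit_interval (\<lambda>y. of_real (f y) * circle_char n y)" for n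
    by (rule integrable_unit_interval[of _ B]) (use B in \<open>auto simp: norm_mult\<close>)
  have i2: "integrable unit_interval (\<lambda>y. circle_char n y)" for n
    by (rule integrable_unit_interval[of _ 1]) auto
  have i3: "integrable unit_interval (\<lambda>y. of_real (f y) * cnj (P y))"
    by (rule integrable_unit_interval[of _ "B * PB"]) (use B PB B0 PB0 in \<open>auto simp: norm_mult intro!: mult_mono\<close>)
  have i4: "integrable unit_interval (\<lambda>y. of_real (f y) * P y)"
    by (rule integrable_unit_interval[of _ "B * PB"]) (use B PB B0 PB0 in \<open>auto simp: norm_mult intro!: mult_mono\<close>)
  have i5: "integrable unit_interval (\<lambda>y. P y * cnj (P y))"
    by (rule integrable_unit_interval[of _ "PB * PB"]) (use B PB B0 PB0 in \<open>auto simp: norm_mult intro!: mult_mono\<close>)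
  have i6: "integrable unit_interval (\<lambda>y. complex_of_real ((f y)\<^sup>2))"
  proof (rule integrable_unit_interval[of _ "B\<^sup>2"])
    show "norm (complex_of_real ((f x)\<^sup>2)) \<le> B\<^sup>2" for x
      using power_mono[OF B abs_ge_zero, of x 2] by (simp only: norm_of_real abs_power2 power2_abs)
  qed measurable
  have "(\<integral>y. of_real (f y) * cnj (P y) \<partial>unit_interval) = (\<integral>y. (\<Sum>n\<in>I. cnj (c n) * (of_real (f y) * circle_char n y)) \<partial>unit_interval)"
    by (simp add: P_def cnj_circle_char sum_distrib_left algebra_simps)
  also have "\<dots> = (\<Sum>n\<in>I. cnj (c n) * c n)"
    using i1 by (subst Bochner_Integration.integral_sum) (auto simp: c_def)
  finally have e1: "(\<integral>y. of_real (f y) * cnj (P y) \<partial>unit_interval) = of_real (\<Sum>n\<in>I. (norm (c n))\<^sup>2)"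
    by (simp only: of_real_sum complex_norm_square mult.commute[of _ "cnj _"])
  have "(\<integral>y. of_real (f y) * P y \<partial>unit_interval) = cnj (\<integral>y. of_real (f y) * cnj (P y) \<partial>unit_interval)"
    by (simp only: Bochner_Integration.integral_cnj[symmetric] complex_cnj_mult complex_cnj_complex_of_real complex_cnj_cnj)
  then have e2: "(\<integral>y. of_real (f y) * P y \<partial>unit_interval) = of_real (\<Sum>n\<in>I. (norm (c n))\<^sup>2)"
    by (simp add: e1)
  have "(\<integral>y. P y * cnj (P y) \<partial>unit_interval) = (\<integral>y. (\<Sum>n\<in>I. \<Sum>m\<in>I. c n * cnj (c m) * circle_char (m - n) y) \<partial>unit_interval)"
    by (intro Bochner_Integration.integral_cong refl)
      (simp add: P_def cnj_circle_char sum_product circle_char_mult_cnj[of _ _ "_", symmetric] algebra_simps)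
  also have "\<dots> = (\<Sum>n\<in>I. \<Sum>m\<in>I. c n * cnj (c m) * (if m - n = 0 then 1 else 0))"
    using i2 by (simp add: Bochner_Integration.integral_sum integral_circle_char)
  also have "\<dots> = (\<Sum>n\<in>I. c n * cnj (c n))"
    using I by (intro sum.cong refl) (simp add: if_distrib cong: if_cong)
  finally have e3: "(\<integral>y. P y * cnj (P y) \<partial>unit_interval) = of_real (\<Sum>n\<in>I. (norm (c n))\<^sup>2)"
    by (simp only: of_real_sum complex_norm_square)
  have sq: "complex_of_real ((norm (of_real a - p))\<^sup>2) = of_real (a\<^sup>2) - of_real a * cnj p - of_real a * p + p * cnj p" for a p
    unfolding complex_norm_square by (simp add: algebra_simps power2_eq_square)
  have "of_real (\<integral>y. (norm (of_real (f y) - P y))\<^sup>2 \<partial>unit_interval)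
      = (\<integral>y. of_real ((f y)\<^sup>2) - of_real (f y) * cnj (P y) - of_real (f y) * P y + P y * cnj (P y) \<partial>unit_interval)"
    unfolding integral_complex_of_real[symmetric] sq ..
  also have "\<dots> = of_real ((\<integral>y. (f y)\<^sup>2 \<partial>unit_interval) - (\<Sum>n\<in>I. (norm (c n))\<^sup>2))"
    using i3 i4 i5 i6 by (simp add: e1 e2 e3 del: of_real_power)
  finally have "(\<integral>y. (f y)\<^sup>2 \<partial>unit_interval) - (\<Sum>n\<in>I. (norm (c n))\<^sup>2) = (\<integral>y. (norm (of_real (f y) - P y))\<^sup>2 \<partial>unit_interval)"
    by (simp only: of_real_eq_iff)
  also have "\<dots> \<ge> 0" by simp
  finally show ?thesis unfolding c_def by simp
qed


section \<open>Step functions on the circle and their Birkhoff sums\<close>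

definition arc_weight :: "real \<Rightarrow> real \<Rightarrow> real \<Rightarrow> real \<Rightarrow> real" where
  "arc_weight c A B y = (if frac y < c then A else B)"

lemma arc_weight_measurable [measurable]: "arc_weight c A B \<in> borel_measurable borel"
  unfolding arc_weight_def frac_def by measurable

lemma arc_weight_periodic: "arc_weight c A B (y + 1) = arc_weight c A B y"
  by (simp add: arc_weight_def frac_def)

lemma arc_weight_bound: "\<bar>arc_weight c A B y\<bar> \<le> \<bar>A\<bar> + \<bar>B\<bar>"
  by (simp add: arc_weight_def)

lemma arc_weight_coeff:
  assumes "0 \<le> c" "c \<le> 1" "n \<noteq> 0"
  shows "(\<integral>y. of_real (arc_weight c A B y) * circle_char n y \<partial>unit_interval)
    = of_real (A - B) * (circle_char n c - 1) / (2 * pi * \<i> * of_int n)"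
proof -
  have int: "integrable lborel (\<lambda>x. indicator {u..<v} x *\<^sub>R circle_char n x)" for u v :: real
    by (rule integrableI_bounded_set_indicator[of _ _ _ 1])
      (use emeasure_Ico_finite in auto)
  have "(\<integral>y. of_real (arc_weight c A B y) * circle_char n y \<partial>unit_interval)
     = (\<integral>y. of_real (A - B) * (indicator {0..<c} y *\<^sub>R circle_char n y) + of_real B * (indicator {0..<1} y *\<^sub>R circle_char n y) \<partial>lborel)"
    unfolding integral_unit_interval using assms
    by (intro Bochner_Integration.integral_cong refl)
      (auto simp: arc_weight_def indicator_def frac_eq[THEN iffD2] algebra_simps)
  also have "\<dots> = (\<integral>y. of_real (A - B) * (indicator {0..<c} y *\<^sub>R circle_char n y) \<partial>lborel)
      + (\<integral>y. of_real B * (indicator {0..<1} y *\<^sub>R circle_char n y) \<partial>lborel)"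
    by (intro Bochner_Integration.integral_add integrable_mult_right int)
  also have "\<dots> = of_real (A - B) * ((circle_char n c - 1) / (2 * pi * \<i> * of_int n)) + of_real B * ((circle_char n 1 - 1) / (2 * pi * \<i> * of_int n))"
    by (simp only: integral_mult_right_zero integral_circle_char_initial[OF assms(3,1)] integral_circle_char_initial[OF assms(3) zero_le_one])
  also have "circle_char n 1 = 1" using circle_char_of_int[of n 1] by simp
  finally show ?thesis by simp
qed

lemma arc_weight_mean:
  assumes "0 \<le> c" "c \<le> 1"
  shows "(\<integral>y. arc_weight c A B y \<partial>unit_interval) = c * A + (1 - c) * B"
proof -
  have "(\<integral>y. arc_weight c A B y \<partial>unit_interval)
     = (\<integral>y. (A - B) * indicator {0..<c} y + B * indicator {0..<1} y \<partial>lborel)"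
    unfolding integral_unit_interval using assms
    by (intro Bochner_Integration.integral_cong refl)
      (auto simp: arc_weight_def indicator_def frac_eq[THEN iffD2] algebra_simps)
  also have "\<dots> = (A - B) * c + B" using assms
    by (subst Bochner_Integration.integral_add) auto
  finally show ?thesis by (simp add: algebra_simps)
qed

definition rotation_sum :: "(real \<Rightarrow> real) \<Rightarrow> real \<Rightarrow> nat \<Rightarrow> real \<Rightarrow> real" where
  "rotation_sum g \<theta> k y = (\<Sum>i<k. g (y + real i * \<theta>))"

lemma rotation_sum_measurable [measurable]:
  assumes [measurable]: "g \<in> borel_measurable borel"
  shows "rotation_sum g \<theta> k \<in> borel_measurable borel"
  unfolding rotation_sum_def by measurable

lemma rotation_sum_bound:
  assumes "\<And>x. \<bar>g x\<bar> \<le> B" shows "\<bar>rotation_sum g \<theta> k y\<bar> \<le> real k * B"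
  unfolding rotation_sum_def using sum_norm_bound[of "{..<k}" "\<lambda>i. g (y + real i * \<theta>)" B] assms by simp

lemma rotation_sum_coeff:
  fixes g :: "real \<Rightarrow> real"
  assumes g [measurable]: "g \<in> borel_measurable borel" and B: "\<And>x. \<bar>g x\<bar> \<le> B" and per: "\<And>x. g (x + 1) = g x"
  shows "(\<integral>y. of_real (rotation_sum g \<theta> k y) * circle_char n y \<partial>unit_interval)
    = (\<Sum>i<k. circle_char (- n) \<theta> ^ i) * (\<integral>y. of_real (g y) * circle_char n y \<partial>unit_interval)"
proof -
  have shift: "(\<integral>y. of_real (g (y + a)) * circle_char n y \<partial>unit_interval) = circle_char (- n) a * (\<integral>y. of_real (g y) * circle_char n y \<partial>unit_interval)" for a
  proof -
    have *: "circle_char n y = circle_char (- n) a * circle_char n (y + a)" for y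
    proof -
      have "circle_char (- n) a * circle_char n a = 1"
        using circle_char_mult_cnj[of n a n] by (simp add: cnj_circle_char mult.commute)
      then show ?thesis by (simp add: circle_char_add algebra_simps)
    qed
    have "(\<integral>y. of_real (g (y + a)) * circle_char n y \<partial>unit_interval) = (\<integral>y. circle_char (- n) a * (of_real (g (y + a)) * circle_char n (y + a)) \<partial>unit_interval)"
      by (intro Bochner_Integration.integral_cong refl) (subst *, simp)
    also have "\<dots> = circle_char (- n) a * (\<integral>y. of_real (g (y + a)) * circle_char n (y + a) \<partial>unit_interval)"
      by simp
    also have "(\<integral>y. of_real (g (y + a)) * circle_char n (y + a) \<partial>unit_interval) = (\<integral>y. of_real (g y) * circle_char n y \<partial>unit_interval)"
      by (rule integral_periodic_shift[of "\<lambda>y. of_real (g y) * circle_char n y" B])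
        (use B per circle_char_of_int[of n 1] in \<open>auto simp: norm_mult circle_char_add\<close>)
    finally show ?thesis .
  qed
  have "(\<integral>y. of_real (rotation_sum g \<theta> k y) * circle_char n y \<partial>unit_interval)
      = (\<integral>y. (\<Sum>i<k. of_real (g (y + real i * \<theta>)) * circle_char n y) \<partial>unit_interval)"
    by (simp add: rotation_sum_def sum_distrib_right)
  also have "\<dots> = (\<Sum>i<k. \<integral>y. of_real (g (y + real i * \<theta>)) * circle_char n y \<partial>unit_interval)"
    by (rule Bochner_Integration.integral_sum, rule integrable_unit_interval[of _ B]) (use B in \<open>auto simp: norm_mult\<close>)
  also have "\<dots> = (\<Sum>i<k. circle_char (- n) \<theta> ^ i) * (\<integral>y. of_real (g y) * circle_char n y \<partial>unit_interval)"
    by (simp add: shift circle_char_of_nat_mult sum_distrib_right)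
  finally show ?thesis .
qed

text \<open>Expanding the squares gives twice r squared minus twice the squared modulus of the
  geometric sum. That sum is at most 2 / |z - 1| <= r / 2, which is where the threshold 4 comes
  from.\<close>

lemma sum_sum_unit_power_diff:
  fixes z :: complex
  assumes "norm z = 1" "z \<noteq> 1" "real r * norm (z - 1) \<ge> 4"
  shows "(\<Sum>k<r. \<Sum>l<r. (norm (z ^ k - z ^ l))\<^sup>2) \<ge> (real r)\<^sup>2"
proof -
  let ?s = "\<Sum>k<r. z ^ k"
  have n: "norm (z ^ k) = 1" for k using assms by (simp add: norm_power)
  have e: "(norm (z ^ k - z ^ l))\<^sup>2 = 2 - 2 * Re (z ^ k * cnj (z ^ l))" for k l
  proof -
    have "(norm (u - v))\<^sup>2 = (norm u)\<^sup>2 + (norm v)\<^sup>2 - 2 * Re (u * cnj v)" for u v :: complex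
      unfolding cmod_power2 by (simp add: power2_eq_square algebra_simps)
    then show ?thesis by (simp only: n) simp
  qed
  have "(\<Sum>k<r. \<Sum>l<r. 2 - 2 * w k l) = 2 * (real r)\<^sup>2 - 2 * (\<Sum>k<r. \<Sum>l<r. w k l)" for w :: "nat \<Rightarrow> nat \<Rightarrow> real"
    by (simp add: sum_subtractf sum_distrib_left power2_eq_square)
  then have "(\<Sum>k<r. \<Sum>l<r. (norm (z ^ k - z ^ l))\<^sup>2) = 2 * (real r)\<^sup>2 - 2 * (\<Sum>k<r. \<Sum>l<r. Re (z ^ k * cnj (z ^ l)))"
    unfolding e .
  also have "(\<Sum>k<r. \<Sum>l<r. Re (z ^ k * cnj (z ^ l))) = Re (?s * cnj ?s)"
    by (simp only: sum_product cnj_sum Re_sum)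
  also have "Re (?s * cnj ?s) = (norm ?s)\<^sup>2" by (simp only: complex_norm_square[symmetric] Re_complex_of_real)
  finally have 1: "(\<Sum>k<r. \<Sum>l<r. (norm (z ^ k - z ^ l))\<^sup>2) = 2 * (real r)\<^sup>2 - 2 * (norm ?s)\<^sup>2" .
  have "norm ?s = norm (z ^ r - 1) / norm (z - 1)"
    using geometric_sum[OF assms(2), of r] by (simp add: norm_divide)
  also have "\<dots> \<le> 2 / norm (z - 1)"
    using norm_triangle_ineq4[of "z ^ r" 1] n by (intro divide_right_mono) auto
  also have "\<dots> \<le> real r / 2" using assms by (simp add: field_simps)
  finally have "(norm ?s)\<^sup>2 \<le> (real r / 2)\<^sup>2" by (intro power_mono) auto
  then have "4 * (norm ?s)\<^sup>2 \<le> (real r)\<^sup>2" by (simp add: power_divide)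
  then show ?thesis unfolding 1 using zero_le_power2[of "norm ?s"] by linarith
qed

lemma sum_sum_square_diff:
  "(\<Sum>k<r. \<Sum>l<r. (real k - real l)\<^sup>2) = (real r)\<^sup>2 * ((real r)\<^sup>2 - 1) / 6"
proof -
  have s1: "(\<Sum>k<r. real k) = real r * (real r - 1) / 2" by (induction r) (auto simp: field_simps)
  have s2: "(\<Sum>k<r. (real k)\<^sup>2) = (real r - 1) * real r * (2 * real r - 1) / 6"
    by (induction r) (auto simp: field_simps power2_eq_square)
  have "(\<Sum>k<r. \<Sum>l<r. (real k - real l)\<^sup>2) = 2 * real r * (\<Sum>k<r. (real k)\<^sup>2) - 2 * (\<Sum>k<r. real k)\<^sup>2"
    by (simp add: power2_diff sum_subtractf sum.distrib sum_distrib_left[symmetric] sum_distrib_right[symmetric] power2_eq_square[of "sum _ _"] algebra_simps)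
  then show ?thesis unfolding s1 s2 by (simp add: field_simps power2_eq_square)
qed

text \<open>The product is the double sum of exp (S k - S l). Symmetrising in k and l replaces exp
  by cosh, which is bounded below by a quadratic.\<close>

lemma exp_sum_product_lower:
  fixes S :: "nat \<Rightarrow> real"
  shows "(\<Sum>k<r. \<Sum>l<r. (S k - S l)\<^sup>2) / 4 \<le> (\<Sum>k<r. exp (S k)) * (\<Sum>k<r. exp (- S k))"
proof -
  have cosh: "x\<^sup>2 / 2 \<le> exp x + exp (- x)" for x :: real
  proof (cases "x \<ge> 0")
    case True then show ?thesis using exp_lower_Taylor_quadratic[of x] exp_gt_zero[of "-x"] by linarith
  next
    case False
    then have "1 + - x + (- x)\<^sup>2 / 2 \<le> exp (- x)" by (intro exp_lower_Taylor_quadratic) auto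
    then show ?thesis using False exp_gt_zero[of x] unfolding power2_minus by linarith
  qed
  let ?p = "(\<Sum>k<r. exp (S k)) * (\<Sum>k<r. exp (- S k))"
  have 1: "?p = (\<Sum>k<r. \<Sum>l<r. exp (S k - S l))" by (simp add: sum_product exp_diff exp_minus field_simps)
  have 2: "(\<Sum>k<r. \<Sum>l<r. exp (S k - S l)) = (\<Sum>k<r. \<Sum>l<r. exp (- (S k - S l)))"
    by (subst sum.swap) simp
  have "(\<Sum>k<r. \<Sum>l<r. (S k - S l)\<^sup>2 / 2) \<le> (\<Sum>k<r. \<Sum>l<r. exp (S k - S l) + exp (- (S k - S l)))"
    by (intro sum_mono cosh)
  also have "\<dots> = 2 * ?p" using 1 2 by (simp add: sum.distrib)
  finally have "(\<Sum>k<r. \<Sum>l<r. (S k - S l)\<^sup>2 / 2) \<le> 2 * ?p" .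
  moreover have "(\<Sum>k<r. \<Sum>l<r. (S k - S l)\<^sup>2 / 2) = (\<Sum>k<r. \<Sum>l<r. (S k - S l)\<^sup>2) / 2"
    by (simp add: sum_divide_distrib)
  ultimately show ?thesis by linarith
qed


section \<open>Variance of Birkhoff sums along a rotation\<close>

locale rotation_cocycle =
  fixes g :: "real \<Rightarrow> real" and B :: real and \<theta> :: real
  assumes g [measurable]: "g \<in> borel_measurable borel" and bound: "\<And>x. \<bar>g x\<bar> \<le> B"
    and periodic: "\<And>x. g (x + 1) = g x"
begin

definition coeff :: "int \<Rightarrow> complex" where
  "coeff n = (\<integral>y. of_real (g y) * circle_char n y \<partial>unit_interval)"

abbreviation "S \<equiv> rotation_sum g \<theta>"

text \<open>For each y the double sum of squared differences is 2 r^2 times the variance of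
  \<open>S k y\<close> over k < r. Growth of \<open>spread r\<close> faster than r^2 therefore means
  unbounded mean variance.\<close>

definition spread :: "nat \<Rightarrow> real" where
  "spread r = (\<Sum>k<r. \<Sum>l<r. \<integral>y. (S k y - S l y)\<^sup>2 \<partial>unit_interval)"

lemma S_diff_bound: "\<bar>S k y - S l y\<bar> \<le> (real k + real l) * B"
  using rotation_sum_bound[of g B \<theta> k y] rotation_sum_bound[of g B \<theta> l y] bound
  by (simp add: algebra_simps)

lemma S_measurable [measurable]: "S k \<in> borel_measurable borel"
  by measurable

lemma S_diff_coeff:
  "(\<integral>y. of_real (S k y - S l y) * circle_char n y \<partial>unit_interval)
     = ((\<Sum>i<k. circle_char (- n) \<theta> ^ i) - (\<Sum>i<l. circle_char (- n) \<theta> ^ i)) * coeff n"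
proof -
  have i: "integrable unit_interval (\<lambda>y. of_real (S k y) * circle_char n y)" for k
    by (rule integrable_unit_interval[of _ "real k * B"])
      (use rotation_sum_bound[of g B \<theta>] bound in \<open>auto simp: norm_mult\<close>)
  have "(\<integral>y. of_real (S k y - S l y) * circle_char n y \<partial>unit_interval)
    = (\<integral>y. of_real (S k y) * circle_char n y - of_real (S l y) * circle_char n y \<partial>unit_interval)"
    by (simp add: algebra_simps)
  also have "\<dots> = (\<integral>y. of_real (S k y) * circle_char n y \<partial>unit_interval) - (\<integral>y. of_real (S l y) * circle_char n y \<partial>unit_interval)"
    by (intro Bochner_Integration.integral_diff i)
  finally show ?thesis
    by (simp only: rotation_sum_coeff[OF g bound periodic] coeff_def left_diff_distrib)
qed

lemma S_diff_bessel:
  assumes "finite I"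
  shows "(\<Sum>n\<in>I. (norm ((\<Sum>i<k. circle_char (- n) \<theta> ^ i) - (\<Sum>i<l. circle_char (- n) \<theta> ^ i)))\<^sup>2 * (norm (coeff n))\<^sup>2)
    \<le> (\<integral>y. (S k y - S l y)\<^sup>2 \<partial>unit_interval)"
  using bessel[of "\<lambda>y. S k y - S l y" "(real k + real l) * B", OF _ S_diff_bound assms]
  by (simp add: S_diff_coeff norm_mult power_mult_distrib del: of_real_diff)

text \<open>Bessel's inequality at frequency 0 alone bounds the mean square of S k - S l below by a
  multiple of (k - l)^2, so the spread grows like r^4.\<close>

lemma spread_of_nonzero_mean:
  assumes "coeff 0 \<noteq> 0"
  shows "\<exists>r0. \<forall>r\<ge>r0. M * (real r)\<^sup>2 < spread r"
proof -
  define a where "a = (norm (coeff 0))\<^sup>2"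
  have a: "a > 0" using assms by (simp add: a_def)
  have *: "a * (real k - real l)\<^sup>2 \<le> (\<integral>y. (S k y - S l y)\<^sup>2 \<partial>unit_interval)" for k l
  proof -
    have "norm (of_nat k - of_nat l :: complex) = \<bar>real k - real l\<bar>"
      by (metis norm_of_real of_real_diff of_real_of_nat_eq)
    then show ?thesis using S_diff_bessel[of "{0}" k l] by (simp add: a_def mult.commute)
  qed
  obtain r0 :: nat where r0: "real r0 > 6 * \<bar>M\<bar> / a + 2" using reals_Archimedean2 by blast
  show ?thesis
  proof (intro exI allI impI)
    fix r assume "r \<ge> r0"
    then have r: "real r > 6 * \<bar>M\<bar> / a + 2" using r0 by linarith
    have "6 * \<bar>M\<bar> / a \<ge> 0" using a by simp
    then have r2: "real r > 2" using r by linarith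
    have "(real r)\<^sup>2 \<ge> 2 * real r" using r2 unfolding power2_eq_square by (intro mult_right_mono) auto
    then have "(real r)\<^sup>2 - 1 > 6 * \<bar>M\<bar> / a" using r r2 by linarith
    then have "M < a * (((real r)\<^sup>2 - 1) / 6)" using a by (simp add: field_simps abs_less_iff)
    then have "M * (real r)\<^sup>2 < a * (((real r)\<^sup>2 - 1) / 6) * (real r)\<^sup>2"
      using r2 by (intro mult_strict_right_mono) auto
    also have "\<dots> = (\<Sum>k<r. \<Sum>l<r. a * (real k - real l)\<^sup>2)"
      by (simp add: sum_distrib_left[symmetric] sum_sum_square_diff)
    also have "\<dots> \<le> spread r"
      unfolding spread_def by (intro sum_mono *)
    finally show "M * (real r)\<^sup>2 < spread r" .
  qed
qed

text \<open>At frequency n, with z the character value at \<theta>, the coefficient of S k - S l is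
  \<open>coeff n\<close> times (z^k - z^l) / (z - 1). Averaged over k, l < r the squared numerator
  is at least 1 by \<open>sum_sum_unit_power_diff\<close> once r |z - 1| >= 4, which holds for all n
  in the finite set \<open>I\<close> when r is large.\<close>

lemma spread_of_divergence:
  assumes irr: "\<theta> \<notin> \<rat>" and I: "finite I" "0 \<notin> I"
    and M: "M < (\<Sum>n\<in>I. (norm (coeff n))\<^sup>2 / (norm (circle_char (- n) \<theta> - 1))\<^sup>2)"
  shows "\<exists>r0. \<forall>r\<ge>r0. M * (real r)\<^sup>2 < spread r"
proof -
  let ?z = "\<lambda>n. circle_char (- n) \<theta>"
  have z1: "?z n \<noteq> 1" if "n \<in> I" for n using circle_char_eq_1_iff[of "-n" \<theta>] irr I that by auto
  have "\<exists>r0. real r0 > (\<Sum>n\<in>I. 4 / norm (?z n - 1))" by (rule reals_Archimedean2)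
  then obtain r0 where r0: "real r0 > (\<Sum>n\<in>I. 4 / norm (?z n - 1))" by blast
  show ?thesis
  proof (intro exI allI impI)
    fix r assume r: "r \<ge> r0 + 1"
    have big: "real r * norm (?z n - 1) \<ge> 4" if "n \<in> I" for n
    proof -
      have "4 / norm (?z n - 1) \<le> (\<Sum>n\<in>I. 4 / norm (?z n - 1))"
        using I that by (intro member_le_sum) auto
      then have "4 / norm (?z n - 1) \<le> real r" using r r0 by linarith
      then show ?thesis using z1[OF that] by (simp add: field_simps)
    qed
    have w: "norm ((\<Sum>i<k. ?z n ^ i) - (\<Sum>i<l. ?z n ^ i)) = norm (?z n ^ k - ?z n ^ l) / norm (?z n - 1)" if "n \<in> I" for n k l
    proof -
      have "(\<Sum>i<k. ?z n ^ i) - (\<Sum>i<l. ?z n ^ i) = (?z n ^ k - ?z n ^ l) / (?z n - 1)"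
        using z1[OF that] by (simp add: geometric_sum diff_divide_distrib[symmetric])
      then show ?thesis by (simp add: norm_divide)
    qed
    have "M * (real r)\<^sup>2 < (\<Sum>n\<in>I. (norm (coeff n))\<^sup>2 / (norm (?z n - 1))\<^sup>2) * (real r)\<^sup>2"
      using M r by (intro mult_strict_right_mono) auto
    also have "\<dots> = (\<Sum>n\<in>I. (norm (coeff n))\<^sup>2 / (norm (?z n - 1))\<^sup>2 * (real r)\<^sup>2)" by (rule sum_distrib_right)
    also have "\<dots> \<le> (\<Sum>n\<in>I. (norm (coeff n))\<^sup>2 / (norm (?z n - 1))\<^sup>2 * (\<Sum>k<r. \<Sum>l<r. (norm (?z n ^ k - ?z n ^ l))\<^sup>2))"
      by (intro sum_mono mult_left_mono sum_sum_unit_power_diff big z1) auto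
    also have "\<dots> = (\<Sum>n\<in>I. \<Sum>k<r. \<Sum>l<r. (norm ((\<Sum>i<k. ?z n ^ i) - (\<Sum>i<l. ?z n ^ i)))\<^sup>2 * (norm (coeff n))\<^sup>2)"
      by (intro sum.cong refl) (simp add: w sum_distrib_left power_divide mult.commute)
    also have "\<dots> = (\<Sum>k<r. \<Sum>l<r. \<Sum>n\<in>I. (norm ((\<Sum>i<k. ?z n ^ i) - (\<Sum>i<l. ?z n ^ i)))\<^sup>2 * (norm (coeff n))\<^sup>2)"
      by (subst sum.swap, rule sum.cong[OF refl], rule sum.swap)
    also have "\<dots> \<le> spread r"
      unfolding spread_def by (intro sum_mono S_diff_bessel I)
    finally show "M * (real r)\<^sup>2 < spread r" .
  qed
qed

text \<open>Otherwise \<open>exp_sum_product_lower\<close> would bound the integrand of the spread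
  by 4 * M almost everywhere. The predicate \<open>G\<close> makes room for avoiding a null set of
  starting points.\<close>

lemma spread_point:
  assumes big: "4 * M < spread r"
    and G: "AE y in lborel. G y"
  obtains y where "G y" "M \<le> (\<Sum>k<r. exp (S k y)) * (\<Sum>k<r. exp (- S k y))"
proof -
  have i: "integrable unit_interval (\<lambda>y. (S k y - S l y)\<^sup>2)" for k l
  proof (rule integrable_unit_interval[of _ "((real k + real l) * B)\<^sup>2"])
    show "norm ((S k x - S l x)\<^sup>2) \<le> ((real k + real l) * B)\<^sup>2" for x
      using power_mono[OF S_diff_bound[of k x l] abs_ge_zero, of 2] by simp
  qed measurable
  have "\<exists>y. G y \<and> M \<le> (\<Sum>k<r. exp (S k y)) * (\<Sum>k<r. exp (- S k y))"
  proof (rule ccontr)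
    assume no: "\<not> ?thesis"
    have "AE y in unit_interval. G y" using G by (auto simp: AE_restrict_space_iff)
    then have "AE y in unit_interval. (\<Sum>k<r. \<Sum>l<r. (S k y - S l y)\<^sup>2) \<le> 4 * M"
    proof eventually_elim
      case (elim y)
      then show ?case using no exp_sum_product_lower[of "\<lambda>k. S k y" r] by fastforce
    qed
    then have "(\<integral>y. (\<Sum>k<r. \<Sum>l<r. (S k y - S l y)\<^sup>2) \<partial>unit_interval) \<le> (\<integral>y. 4 * M \<partial>unit_interval)"
      using i by (intro integral_mono_AE) auto
    also have "(\<integral>y. (\<Sum>k<r. \<Sum>l<r. (S k y - S l y)\<^sup>2) \<partial>unit_interval) = spread r"
      unfolding spread_def using i by (simp add: Bochner_Integration.integral_sum)
    finally show False using big by simp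
  qed
  then show thesis using that by blast
qed

end


section \<open>Piecewise affine families\<close>

text \<open>The indicators of the periodised arcs sum to at most 1 everywhere, and each has integral
  v k - u k over a period because an arc shorter than 1 does not overlap its own translates.\<close>

lemma sum_lengths_disjoint_mod_1:
  fixes u v :: "nat \<Rightarrow> real"
  assumes uv: "\<And>k. k < r \<Longrightarrow> u k \<le> v k \<and> v k - u k < 1"
    and disj: "\<And>k k' w m. k < r \<Longrightarrow> k' < r \<Longrightarrow> u k \<le> w \<Longrightarrow> w \<le> v k \<Longrightarrow>
       u k' \<le> w + of_int m \<Longrightarrow> w + of_int m \<le> v k' \<Longrightarrow> k = k'"
  shows "(\<Sum>k<r. v k - u k) \<le> 1"
proof -
  define U where "U k = (\<Union>m::int. {u k + of_int m<..<v k + of_int m})" for k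
  define f where "f k = (indicator (U k) :: real \<Rightarrow> real)" for k
  have [measurable]: "U k \<in> sets borel" for k unfolding U_def by (intro borel_open) auto
  have fm [measurable]: "f k \<in> borel_measurable borel" for k unfolding f_def by measurable
  have fb: "norm (f k x) \<le> 1" for k x by (simp add: f_def indicator_def)
  have Uiff: "x \<in> U k \<longleftrightarrow> (\<exists>m::int. u k < x + of_int m \<and> x + of_int m < v k)" for x k
  proof
    assume "x \<in> U k"
    then obtain m :: int where "u k + of_int m < x" "x < v k + of_int m" by (auto simp: U_def)
    then show "\<exists>m::int. u k < x + of_int m \<and> x + of_int m < v k" by (intro exI[of _ "-m"]) auto
  next
    assume "\<exists>m::int. u k < x + of_int m \<and> x + of_int m < v k"
    then obtain m :: int where "u k < x + of_int m" "x + of_int m < v k" by blast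
    then show "x \<in> U k" unfolding U_def by (intro UN_I[of "-m"]) auto
  qed
  have fp: "f k (x + 1) = f k x" for k x
  proof -
    have "x + 1 \<in> U k \<longleftrightarrow> x \<in> U k" unfolding Uiff
    proof
      assume "\<exists>m::int. u k < x + 1 + of_int m \<and> x + 1 + of_int m < v k"
      then obtain m :: int where "u k < x + 1 + of_int m \<and> x + 1 + of_int m < v k" by blast
      then show "\<exists>m::int. u k < x + of_int m \<and> x + of_int m < v k" by (intro exI[of _ "m+1"]) (simp add: algebra_simps)
    next
      assume "\<exists>m::int. u k < x + of_int m \<and> x + of_int m < v k"
      then obtain m :: int where "u k < x + of_int m \<and> x + of_int m < v k" by blast
      then show "\<exists>m::int. u k < x + 1 + of_int m \<and> x + 1 + of_int m < v k" by (intro exI[of _ "m-1"]) (simp add: algebra_simps)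
    qed
    then show ?thesis by (simp add: f_def indicator_def)
  qed
  have int: "integrable unit_interval (f k)" for k
    by (rule integrable_unit_interval[of _ 1]) (use fb in auto)
  have len: "(\<integral>y. f k y \<partial>unit_interval) = v k - u k" if kr: "k < r" for k
  proof -
    have "(\<integral>y. f k y \<partial>unit_interval) = (\<integral>y. f k (y + u k) \<partial>unit_interval)"
      by (rule integral_periodic_shift[symmetric, of _ 1]) (use fb fp in auto)
    also have "\<dots> = (\<integral>y. indicator {0<..<v k - u k} y \<partial>lborel)"
      unfolding integral_unit_interval
    proof (intro Bochner_Integration.integral_cong refl)
      fix y
      have "y + u k \<in> U k \<longleftrightarrow> y \<in> {0<..<v k - u k}" if y: "0 \<le> y" "y < 1"
      proof
        assume "y + u k \<in> U k"
        then obtain m :: int where m: "u k < y + u k + of_int m" "y + u k + of_int m < v k" unfolding Uiff by blast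
        then have "of_int m > (-1::real)" "of_int m < (1::real)" using y uv[OF kr] by linarith+
        then have "m = 0" by linarith
        then show "y \<in> {0<..<v k - u k}" using m by auto
      next
        assume "y \<in> {0<..<v k - u k}"
        then show "y + u k \<in> U k" unfolding Uiff by (intro exI[of _ 0]) auto
      qed
      then show "indicator {0..<1} y *\<^sub>R f k (y + u k) = indicator {0<..<v k - u k} y"
        using uv[OF kr] by (auto simp: f_def indicator_def)
    qed
    also have "\<dots> = v k - u k" using uv[OF kr] by simp
    finally show ?thesis .
  qed
  have "(\<Sum>k<r. v k - u k) = (\<Sum>k<r. \<integral>y. f k y \<partial>unit_interval)" by (simp add: len)
  also have "\<dots> = (\<integral>y. (\<Sum>k<r. f k y) \<partial>unit_interval)"
    by (rule Bochner_Integration.integral_sum[symmetric]) (rule int)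
  also have "\<dots> \<le> (\<integral>y. 1 \<partial>unit_interval)"
  proof (rule integral_mono)
    show "integrable unit_interval (\<lambda>y. \<Sum>k<r. f k y)" by (intro Bochner_Integration.integrable_sum int)
    show "integrable unit_interval (\<lambda>y. 1::real)" by simp
    fix y :: real
    show "(\<Sum>k<r. f k y) \<le> 1"
    proof (cases "\<exists>k<r. y \<in> U k")
      case True
      then obtain k where k: "k < r" "y \<in> U k" by blast
      have "y \<notin> U k'" if k': "k' < r" "k' \<noteq> k" for k'
      proof
        assume "y \<in> U k'"
        then obtain m where m: "u k' < y + of_int m" "y + of_int m < v k'" unfolding Uiff by blast
        obtain n where n: "u k < y + of_int n" "y + of_int n < v k" using k unfolding Uiff by blast
        have "k = k'" by (rule disj[of k k' "y + of_int n" "m - n"]) (use k k' m n in auto)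
        then show False using k' by simp
      qed
      then have "(\<Sum>j<r. f j y) = (\<Sum>j<r. if j = k then f k y else 0)"
        by (intro sum.cong refl) (auto simp: f_def indicator_def)
      also have "\<dots> \<le> 1" using k fb[of k y] by simp
      finally show ?thesis .
    next
      case False
      then have "(\<Sum>j<r. f j y) = 0" by (intro sum.neutral) (auto simp: f_def indicator_def)
      then show ?thesis by simp
    qed
  qed
  finally show ?thesis by simp
qed

section \<open>The family with fixed arc lengths and varying translation\<close>

locale pl_family =
  fixes l L :: real
  assumes l: "0 < l" "l < 1" and L: "0 < L" "L < 1"
begin

definition lam where "lam = L / l"
definition mu where "mu = (1 - L) / (1 - l)"

lemma lam_pos: "lam > 0" and mu_pos: "mu > 0"
  using l L by (auto simp: lam_def mu_def)

text \<open>The signed length of the part of [0, x] that lies in l-arcs. Written through it,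
  \<open>H\<close> needs no case distinction, and chord estimates reduce to splitting a length into
  two nonnegative parts.\<close>

definition A :: "real \<Rightarrow> real" where "A x = l * of_int \<lfloor>x\<rfloor> + min (frac x) l"
definition H :: "real \<Rightarrow> real" where "H x = lam * A x + mu * (x - A x)"
definition slope :: "real \<Rightarrow> real" where "slope x = (if frac x < l then lam else mu)"
definition break_pt :: "real \<Rightarrow> bool" where "break_pt x \<longleftrightarrow> (\<exists>m::int. x = of_int m \<or> x = l + of_int m)"

lemma A_add_1: "A (x + 1) = A x + l" by (simp add: A_def frac_def algebra_simps)

lemma A_mono: assumes "u \<le> v" shows "0 \<le> A v - A u \<and> A v - A u \<le> v - u"
proof (cases "\<lfloor>u\<rfloor> = \<lfloor>v\<rfloor>")
  case True
  then show ?thesis using assms by (auto simp: A_def frac_def min_def)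
next
  case False
  then have "\<lfloor>u\<rfloor> + 1 \<le> \<lfloor>v\<rfloor>" using assms floor_mono[of u v] by linarith
  then have f: "real_of_int \<lfloor>u\<rfloor> + 1 \<le> of_int \<lfloor>v\<rfloor>" by linarith
  define d where "d = real_of_int \<lfloor>v\<rfloor> - (of_int \<lfloor>u\<rfloor> + 1)"
  have d: "d \<ge> 0" using f by (simp add: d_def)
  have fu: "0 \<le> frac u" "frac u < 1" "0 \<le> frac v" "frac v < 1" by (auto simp: frac_lt_1)
  have 1: "A v - A u = l * d + (l - min (frac u) l) + min (frac v) l"
    by (simp add: A_def d_def algebra_simps)
  have 2: "(v - u) - (A v - A u) = (1 - l) * d + (1 - l - (frac u - min (frac u) l)) + (frac v - min (frac v) l)"
    by (simp add: A_def d_def frac_def algebra_simps)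
  have "0 \<le> l * d" "0 \<le> (1 - l) * d" using d l by auto
  moreover have "0 \<le> l - min (frac u) l" "0 \<le> min (frac v) l" "0 \<le> 1 - l - (frac u - min (frac u) l)" "0 \<le> frac v - min (frac v) l"
    using fu l by (auto simp: min_def)
  ultimately show ?thesis using 1 2 by linarith
qed

lemma H_diff: "H v - H u = lam * (A v - A u) + mu * ((v - u) - (A v - A u))"
  by (simp add: H_def algebra_simps)

lemma H_chord:
  assumes "u \<le> v"
  shows "min lam mu * (v - u) \<le> H v - H u" "H v - H u \<le> max lam mu * (v - u)"
proof -
  let ?a = "A v - A u" and ?b = "(v - u) - (A v - A u)"
  have ab: "?a \<ge> 0" "?b \<ge> 0" using A_mono[OF assms] by auto
  have "min lam mu * ?a \<le> lam * ?a" "min lam mu * ?b \<le> mu * ?b" "lam * ?a \<le> max lam mu * ?a" "mu * ?b \<le> max lam mu * ?b"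
    using ab by (auto intro!: mult_right_mono)
  then have "min lam mu * (?a + ?b) \<le> H v - H u" "H v - H u \<le> max lam mu * (?a + ?b)"
    unfolding H_diff distrib_left by linarith+
  then show "min lam mu * (v - u) \<le> H v - H u" "H v - H u \<le> max lam mu * (v - u)" by simp_all
qed

lemma H_affine:
  assumes "u \<le> v" and nb: "\<And>w. u \<le> w \<Longrightarrow> w \<le> v \<Longrightarrow> \<not> break_pt w"
  shows "H v - H u = slope u * (v - u)" "slope v = slope u"
proof -
  have fl: "\<lfloor>u\<rfloor> = \<lfloor>v\<rfloor>"
  proof (rule ccontr)
    assume "\<lfloor>u\<rfloor> \<noteq> \<lfloor>v\<rfloor>"
    then have "\<lfloor>u\<rfloor> < \<lfloor>v\<rfloor>" using floor_mono[OF assms(1)] by simp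
    then have "u \<le> of_int \<lfloor>v\<rfloor>" by linarith
    moreover have "of_int \<lfloor>v\<rfloor> \<le> v" by simp
    ultimately show False using nb[of "of_int \<lfloor>v\<rfloor>"] by (auto simp: break_pt_def)
  qed
  have nl: "\<not> (frac u \<le> l \<and> l \<le> frac v)"
  proof
    assume "frac u \<le> l \<and> l \<le> frac v"
    then have "u \<le> l + of_int \<lfloor>u\<rfloor>" "l + of_int \<lfloor>u\<rfloor> \<le> v" using fl by (auto simp: frac_def)
    then show False using nb[of "l + of_int \<lfloor>u\<rfloor>"] by (auto simp: break_pt_def)
  qed
  have "frac u \<le> frac v" using fl assms(1) by (simp add: frac_def)
  then consider "frac u < l" "frac v < l" | "frac u > l" "frac v > l" using nl by linarith
  then have "H v - H u = slope u * (v - u) \<and> slope v = slope u"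
  proof cases
    case 1 then show ?thesis by (simp add: H_diff slope_def A_def fl) (simp add: frac_def fl)
  next
    case 2 then show ?thesis by (simp add: H_diff slope_def A_def fl min_def)
  qed
  then show "H v - H u = slope u * (v - u)" "slope v = slope u" by auto
qed

lemma lift_map_H: "lift_map (\<lambda>x. H x + t)"
proof
  have "\<bar>H x - H y\<bar> \<le> max lam mu * \<bar>x - y\<bar>" for x y
    using H_chord[of x y] H_chord[of y x] lam_pos mu_pos
    by (smt (verit) mult_nonneg_nonneg)
  then have "(max lam mu)-lipschitz_on UNIV H"
    using lam_pos by (intro lipschitz_onI) (auto simp: dist_real_def)
  then have "continuous_on UNIV H" by (rule lipschitz_on_continuous_on)
  then show "continuous_on UNIV (\<lambda>x. H x + t)" by (intro continuous_intros)
  show "strict_mono (\<lambda>x. H x + t)"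
  proof (rule strict_monoI)
    fix x y :: real assume "x < y"
    then have "0 < min lam mu * (y - x)" using lam_pos mu_pos by auto
    then show "H x + t < H y + t" using H_chord(1)[of x y] \<open>x < y\<close> by linarith
  qed
  have "lam * l = L" "mu * (1 - l) = 1 - L" using l by (auto simp: lam_def mu_def)
  then show "H (x + 1) + t = H x + t + 1" for x
    using A_add_1[of x] by (simp add: H_def algebra_simps)
qed

definition F :: "real \<Rightarrow> real \<Rightarrow> real" where "F t x = H x + t"

sublocale F: lift_map "F t" for t
  unfolding F_def by (rule lift_map_H)

lemma F_Suc: "(F t ^^ Suc n) x = H ((F t ^^ n) x) + t"
  using F_def[of t "(F t ^^ n) x"] by simp

text \<open>The last of the n steps alone contributes t - s, and by monotonicity the earlier ones
  cannot take anything away.\<close>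

lemma F_iterate_diff:
  assumes "s \<le> t" shows "n > 0 \<Longrightarrow> (F t ^^ n) x - (F s ^^ n) x \<ge> t - s"
proof (induction n)
  case (Suc n)
  have "(F t ^^ n) x \<ge> (F s ^^ n) x" using Suc assms by (cases n) auto
  then have "H ((F t ^^ n) x) \<ge> H ((F s ^^ n) x)" using F.le_iff[of 0] by (simp add: F_def)
  then show ?case using assms by (simp add: F_Suc del: funpow.simps)
qed simp

lemma F_iterate_mono: "s \<le> t \<Longrightarrow> x \<le> y \<Longrightarrow> (F s ^^ n) x \<le> (F t ^^ n) y"
proof -
  assume a: "s \<le> t" "x \<le> y"
  have "(F s ^^ n) x \<le> (F t ^^ n) x" using F_iterate_diff[OF a(1), of n x] a by (cases "n = 0") auto
  also have "\<dots> \<le> (F t ^^ n) y" using a by (simp add: F.funpow_le_iff)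
  finally show ?thesis .
qed

lemma F_iterate_cont: "continuous_on UNIV (\<lambda>t. (F t ^^ n) x)"
proof (induction n)
  case (Suc n)
  have "continuous_on UNIV H" using F.cont[of 0] by (simp add: F_def)
  then have "continuous_on UNIV (\<lambda>t. H ((F t ^^ n) x))"
    by (rule continuous_on_compose2[OF _ Suc]) auto
  then show ?case unfolding F_Suc by (intro continuous_intros)
qed simp

lemma rho_mono: "mono (\<lambda>t. F.rho t)"
proof (rule monoI)
  fix s t :: real assume "s \<le> t"
  show "F.rho s \<le> F.rho t"
    unfolding F.rho_def[of t]
  proof (rule cInf_greatest[OF F.rho_set_props(1)], clarify)
    fix p q x assume "q > 0" "(F t ^^ q) x \<le> x + of_int p"
    then have "(F s ^^ q) x \<le> x + of_int p" using F_iterate_mono[OF \<open>s \<le> t\<close> order_refl, of q x] by linarith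
    then show "F.rho s \<le> of_int p / real q" by (rule F.rho_le[OF \<open>q > 0\<close>])
  qed
qed

lemma solve_iterate:
  assumes "n > 0" shows "\<exists>t. (F t ^^ n) x = y"
proof -
  define d where "d = \<bar>y - (F 0 ^^ n) x\<bar>"
  have "(F (-d) ^^ n) x \<le> y" "y \<le> (F d ^^ n) x"
    using F_iterate_diff[of "-d" 0 n x] F_iterate_diff[of 0 d n x] assms by (auto simp: d_def)
  then show ?thesis
    using IVT'[of "\<lambda>t. (F t ^^ n) x" "-d" y d] continuous_on_subset[OF F_iterate_cont] by (auto simp: d_def)
qed


text \<open>Bounds the ratio of any chord slope of \<open>H\<close> to the slope at any point: the
  price of an arc that contains a break point.\<close>

definition sig :: real where "sig = max lam mu / min lam mu"

lemma sig_ge_1: "sig \<ge> 1"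
  using lam_pos mu_pos by (auto simp: sig_def field_simps)

lemma slope_pos: "slope x > 0" and slope_le: "slope x \<le> max lam mu" and slope_ge: "min lam mu \<le> slope x"
  using lam_pos mu_pos by (auto simp: slope_def)

lemma slope_sig: "max lam mu \<le> sig * slope x" "slope x / sig \<le> min lam mu"
proof -
  have m: "min lam mu > 0" using lam_pos mu_pos by auto
  have "sig * min lam mu \<le> sig * slope x" using slope_ge sig_ge_1 by (intro mult_left_mono) auto
  then show "max lam mu \<le> sig * slope x" using m by (simp add: sig_def)
  have "slope x / sig \<le> max lam mu / sig" using slope_le sig_ge_1 by (intro divide_right_mono) auto
  also have "\<dots> = min lam mu" using m lam_pos mu_pos by (simp add: sig_def)
  finally show "slope x / sig \<le> min lam mu" .
qed

lemma H_abs_chord: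
  "\<bar>H v - H u\<bar> \<le> sig * slope x * \<bar>v - u\<bar>" "slope x / sig * \<bar>v - u\<bar> \<le> \<bar>H v - H u\<bar>"
proof -
  have *: "\<bar>H v - H u\<bar> \<le> max lam mu * \<bar>v - u\<bar> \<and> min lam mu * \<bar>v - u\<bar> \<le> \<bar>H v - H u\<bar>"
  proof (cases "u \<le> v")
    case True
    then have "H u \<le> H v" using F.le_iff[of 0] by (simp add: F_def)
    then show ?thesis using H_chord[OF True] True by auto
  next
    case False
    then have "v \<le> u" by simp
    then have "H v \<le> H u" using F.le_iff[of 0] by (simp add: F_def)
    then show ?thesis using H_chord[OF \<open>v \<le> u\<close>] \<open>v \<le> u\<close> by (simp add: abs_if)
  qed
  have "max lam mu * \<bar>v - u\<bar> \<le> sig * slope x * \<bar>v - u\<bar>" by (intro mult_right_mono slope_sig) auto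
  then show "\<bar>H v - H u\<bar> \<le> sig * slope x * \<bar>v - u\<bar>" using * by linarith
  have "slope x / sig * \<bar>v - u\<bar> \<le> min lam mu * \<bar>v - u\<bar>" by (intro mult_right_mono slope_sig) auto
  then show "slope x / sig * \<bar>v - u\<bar> \<le> \<bar>H v - H u\<bar>" using * by linarith
qed

definition orbit_slope :: "real \<Rightarrow> real \<Rightarrow> nat \<Rightarrow> real" where
  "orbit_slope t x k = (\<Prod>i<k. slope ((F t ^^ i) x))"

lemma orbit_slope_pos: "orbit_slope t x k > 0"
  unfolding orbit_slope_def by (intro prod_pos) (auto simp: slope_pos)

end

text \<open>Since \<open>x'\<close> is the \<open>(- Q)\<close>-th iterate of \<open>x + P\<close>, the arc \<open>I k\<close> below is spanned by the iterates of
  \<open>x\<close> of orders \<open>k\<close> and \<open>k - Q\<close>. By \<open>gap\<close> and the semiconjugacy \<open>h\<close> to the rotation, any \<open>r\<close>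
  consecutive such arcs are disjoint modulo 1, so at most four of the first \<open>Q \<le> 2 * r\<close> arcs contain a
  break point.\<close>

locale near_return = pl_family +
  fixes t :: real and h :: "real \<Rightarrow> real" and \<theta> :: real and Q r :: nat and P :: int and x x' :: real
  assumes h_mono: "mono h" and h_add_1: "\<And>z. h (z + 1) = h z + 1" and h_F: "\<And>z. h (F t z) = h z + \<theta>"
    and gap: "\<And>j m. j \<noteq> 0 \<Longrightarrow> \<bar>j\<bar> < int r \<Longrightarrow> \<bar>of_int P - real Q * \<theta>\<bar> < \<bar>of_int j * \<theta> - of_int m\<bar>"
    and small: "\<bar>of_int P - real Q * \<theta>\<bar> < 1"
    and rQ: "0 < r" "r \<le> Q" "Q \<le> 2 * r"
    and x': "(F t ^^ Q) x' = x + of_int P"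
begin

definition z where "z k = (F t ^^ k) x"
definition z' where "z' k = (F t ^^ k) x'"
definition I where "I k = closed_segment (z k) (z' k)"

lemma h_add_int: "h (w + of_int m) = h w + of_int m"
  by (rule add_of_int) (rule h_add_1)

lemma h_iterate: "h ((F t ^^ k) w) = h w + real k * \<theta>"
  by (induction k) (auto simp: h_F algebra_simps)

text \<open>Seen through the monotone map \<open>h\<close>, every \<open>I k\<close> lies in an arc
  of the same signed length P - Q \<theta> starting at the k-th point of a rotation orbit.\<close>

lemma h_I:
  assumes "w \<in> I k"
  shows "h w - (h x + real k * \<theta>) \<in> closed_segment 0 (of_int P - real Q * \<theta>)"
proof -
  have "h x' = h x + of_int P - real Q * \<theta>"
    using h_iterate[of Q x'] by (simp add: x' h_add_int)
  then have z: "h (z k) = h x + real k * \<theta>" "h (z' k) = h x + real k * \<theta> + (of_int P - real Q * \<theta>)"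
    by (simp_all add: z_def z'_def h_iterate)
  have "z k \<le> w \<and> w \<le> z' k \<or> z' k \<le> w \<and> w \<le> z k"
    using assms by (auto simp: I_def closed_segment_eq_real_ivl split: if_splits)
  then have "h (z k) \<le> h w \<and> h w \<le> h (z' k) \<or> h (z' k) \<le> h w \<and> h w \<le> h (z k)"
    using h_mono by (auto simp: mono_def)
  then show ?thesis unfolding z by (auto simp: closed_segment_eq_real_ivl)
qed

text \<open>By \<open>h_I\<close> both arcs have length |P - Q \<theta>| in the coordinate
  \<open>h\<close>, and \<open>gap\<close> says that their starting points are further apart than
  that modulo 1.\<close>

lemma I_disjoint:
  assumes "w \<in> I k" "w + of_int m \<in> I k'" "\<bar>int k' - int k\<bar> < int r"
  shows "k = k'"
proof (rule ccontr)
  assume "k \<noteq> k'"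
  then have "\<bar>of_int P - real Q * \<theta>\<bar> < \<bar>of_int (int k' - int k) * \<theta> - of_int m\<bar>"
    using assms(3) by (intro gap) auto
  moreover have "\<bar>u - v\<bar> \<le> \<bar>d\<bar>" if "u \<in> closed_segment 0 d" "v \<in> closed_segment 0 d" for u v d :: real
    using that by (auto simp: closed_segment_eq_real_ivl split: if_splits)
  note this[OF h_I[OF assms(1)] h_I[OF assms(2)]]
  moreover have "h w - (h x + real k * \<theta>) - (h (w + of_int m) - (h x + real k' * \<theta>)) = of_int (int k' - int k) * \<theta> - of_int m"
    by (simp add: h_add_int algebra_simps)
  ultimately show False by simp
qed

lemma z_in_I [simp]: "z k \<in> I k" "z' k \<in> I k" by (auto simp: I_def)

lemma z_Suc: "z (Suc k) = H (z k) + t" "z' (Suc k) = H (z' k) + t"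
  by (simp_all add: z_def z'_def F_Suc del: funpow.simps)

lemma I_length_sum: "(\<Sum>k<r. \<bar>z' k - z k\<bar>) \<le> 1"
proof -
  have "(\<Sum>k<r. max (z k) (z' k) - min (z k) (z' k)) \<le> 1"
  proof (rule sum_lengths_disjoint_mod_1)
    fix k assume "k < r"
    \<comment> \<open>As \<open>h\<close> has degree 1, an arc of length at least 1 would have an
      image of length at least 1, against \<open>small\<close>.\<close>
    have False if "\<bar>z' k - z k\<bar> \<ge> 1"
    proof -
      have hz: "\<bar>h (z' k) - h (z k)\<bar> = \<bar>of_int P - real Q * \<theta>\<bar>"
        using h_iterate[of Q x'] by (simp add: x' h_add_int z_def z'_def h_iterate)
      have "z k + 1 \<le> z' k \<or> z' k + 1 \<le> z k" using that by linarith
      then have "h (z k) + 1 \<le> h (z' k) \<or> h (z' k) + 1 \<le> h (z k)"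
        using h_mono h_add_1 by (metis monoD)
      then show False using small hz by linarith
    qed
    then have "\<bar>z' k - z k\<bar> < 1" by (meson not_le)
    then show "min (z k) (z' k) \<le> max (z k) (z' k) \<and> max (z k) (z' k) - min (z k) (z' k) < 1"
      by (auto simp: min_def max_def)
  next
    fix k k' w m assume k: "k < r" "k' < r" and "min (z k) (z' k) \<le> w" "w \<le> max (z k) (z' k)"
      "min (z k') (z' k') \<le> w + of_int m" "w + of_int m \<le> max (z k') (z' k')"
    then have "w \<in> I k" "w + of_int m \<in> I k'"
      by (auto simp: I_def closed_segment_eq_real_ivl min_def max_def split: if_splits)
    then show "k = k'" by (rule I_disjoint) (use k in auto)
  qed
  moreover have "max (z k) (z' k) - min (z k) (z' k) = \<bar>z' k - z k\<bar>" for k by auto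
  ultimately show ?thesis by simp
qed

definition bad where "bad = {k. k < Q \<and> (\<exists>w\<in>I k. break_pt w)}"

lemma card_bad: "card bad \<le> 4"
proof -
  define B where "B b s = {k. k < Q \<and> s \<le> k \<and> k < s + r \<and> (\<exists>m::int. b + of_int m \<in> I k)}" for b and s :: nat
  have B1: "card (B b s) \<le> 1" for b s
  proof -
    have "k = k'" if kk: "k \<in> B b s" "k' \<in> B b s" for k k'
    proof -
      obtain m m' :: int where "b + of_int m \<in> I k" "b + of_int m' \<in> I k'" using kk by (auto simp: B_def)
      then have "b + of_int m \<in> I k" "b + of_int m + of_int (m' - m) \<in> I k'" by auto
      then show ?thesis by (rule I_disjoint) (use kk in \<open>auto simp: B_def\<close>)
    qed
    then show ?thesis using card_le_Suc0_iff_eq[of "B b s"] by (auto simp: B_def)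
  qed
  have "bad \<subseteq> (B 0 0 \<union> B 0 r) \<union> (B l 0 \<union> B l r)"
  proof
    fix k assume "k \<in> bad"
    then obtain w where k: "k < Q" "w \<in> I k" "break_pt w" by (auto simp: bad_def)
    then obtain m :: int where m: "0 + of_int m \<in> I k \<or> l + of_int m \<in> I k"
      unfolding break_pt_def by auto
    have "k < r \<or> r \<le> k \<and> k < r + r" using k rQ by linarith
    then show "k \<in> (B 0 0 \<union> B 0 r) \<union> (B l 0 \<union> B l r)" using m k unfolding B_def by auto
  qed
  then have "card bad \<le> card ((B 0 0 \<union> B 0 r) \<union> (B l 0 \<union> B l r))"
    by (intro card_mono) (auto simp: B_def)
  also have "\<dots> \<le> (card (B 0 0) + card (B 0 r)) + (card (B l 0) + card (B l r))"
    by (intro order_trans[OF card_Un_le] add_mono card_Un_le)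
  also have "\<dots> \<le> 4" using B1[of 0 0] B1[of 0 r] B1[of l 0] B1[of l r] by linarith
  finally show ?thesis .
qed

text \<open>The factor by which the slope of a chord over \<open>I k\<close> may differ from the slope at \<open>z k\<close>.\<close>

definition e where "e k = (if k \<in> bad then sig else 1)"

lemma e_ge_1: "e k \<ge> 1" using sig_ge_1 by (auto simp: e_def)

definition R where "R k = (\<Prod>i<k. e i)"

lemma R_Suc: "R (Suc k) = e k * R k" by (simp add: R_def mult.commute)

lemma R_ge_1: "R k \<ge> 1" unfolding R_def by (intro prod_ge_1) (auto simp: e_ge_1)

lemma R_le: "R k \<le> sig ^ 4"
proof -
  have "R k = (\<Prod>i\<in>{..<k} \<inter> bad. sig)" unfolding R_def e_def
    by (simp add: prod.inter_restrict[symmetric])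
  also have "\<dots> = sig ^ card ({..<k} \<inter> bad)" by simp
  also have "\<dots> \<le> sig ^ 4"
  proof (rule power_increasing[OF _ sig_ge_1])
    have "finite bad" by (auto simp: bad_def)
    then have "card ({..<k} \<inter> bad) \<le> card bad" by (intro card_mono) auto
    then show "card ({..<k} \<inter> bad) \<le> 4" using card_bad by linarith
  qed
  finally show ?thesis .
qed

lemma chord_I:
  assumes "k < Q" "u \<in> I k" "v \<in> I k"
  shows "\<bar>H v - H u\<bar> \<le> e k * slope (z k) * \<bar>v - u\<bar>" "slope (z k) / e k * \<bar>v - u\<bar> \<le> \<bar>H v - H u\<bar>"
proof -
  have *: "\<bar>H v - H u\<bar> = slope (z k) * \<bar>v - u\<bar>" if "k \<notin> bad"
  proof -
    have nb: "\<not> break_pt w" if "w \<in> I k" for w using \<open>k \<notin> bad\<close> assms(1) that by (auto simp: bad_def)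
    have conv: "w \<in> I k" if "a \<in> I k" "b \<in> I k" "a \<le> w" "w \<le> b" for a b w
      using that by (auto simp: I_def closed_segment_eq_real_ivl split: if_splits)
    have sl: "H b - H a = slope (z k) * (b - a)" if "a \<in> I k" "b \<in> I k" "a \<le> b" for a b
    proof -
      have aff: "slope d = slope c" if "c \<in> I k" "d \<in> I k" "c \<le> d" for c d
        by (rule H_affine(2)[OF that(3)]) (rule nb, rule conv[OF that(1,2)])
      have "slope a = slope (z k)"
        using aff[OF z_in_I(1) that(1)] aff[OF that(1) z_in_I(1)] by linarith
      then show ?thesis using H_affine(1)[OF that(3)] nb conv[OF that(1,2)] by metis
    qed
    show ?thesis
    proof (cases "u \<le> v")
      case True then show ?thesis using sl[OF assms(2,3)] slope_pos[of "z k"] by (simp add: abs_mult)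
    next
      case False
      then have "\<bar>H u - H v\<bar> = slope (z k) * \<bar>u - v\<bar>" using sl[OF assms(3,2)] slope_pos[of "z k"] by (simp add: abs_mult)
      then show ?thesis by (simp add: abs_minus_commute)
    qed
  qed
  show "\<bar>H v - H u\<bar> \<le> e k * slope (z k) * \<bar>v - u\<bar>" "slope (z k) / e k * \<bar>v - u\<bar> \<le> \<bar>H v - H u\<bar>"
    using * H_abs_chord(1)[of v u "z k"] H_abs_chord(2)[of "z k" v u] by (auto simp: e_def)
qed

abbreviation "p k \<equiv> orbit_slope t x k"

lemma p_Suc: "p (Suc k) = slope (z k) * p k"
  by (simp add: orbit_slope_def z_def mult.commute)

lemma I_length_lower: "k \<le> Q \<Longrightarrow> p k / R k * \<bar>z' 0 - z 0\<bar> \<le> \<bar>z' k - z k\<bar>"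
proof (induction k)
  case (Suc k)
  have "p (Suc k) / R (Suc k) * \<bar>z' 0 - z 0\<bar> = slope (z k) / e k * (p k / R k * \<bar>z' 0 - z 0\<bar>)"
    by (simp add: p_Suc R_Suc)
  also have "\<dots> \<le> slope (z k) / e k * \<bar>z' k - z k\<bar>"
    using Suc slope_pos[of "z k"] e_ge_1[of k] by (intro mult_left_mono) auto
  also have "\<dots> \<le> \<bar>H (z' k) - H (z k)\<bar>" using Suc by (intro chord_I) auto
  finally show ?case by (simp add: z_Suc)
qed (simp add: orbit_slope_def R_def)

lemma I_length_upper: "k \<le> Q \<Longrightarrow> \<bar>z' k - z k\<bar> \<le> p k * R k * \<bar>z' 0 - z 0\<bar>"
proof (induction k)
  case (Suc k)
  have "\<bar>H (z' k) - H (z k)\<bar> \<le> e k * slope (z k) * \<bar>z' k - z k\<bar>" using Suc by (intro chord_I) auto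
  also have "\<dots> \<le> e k * slope (z k) * (p k * R k * \<bar>z' 0 - z 0\<bar>)"
    using Suc slope_pos[of "z k"] e_ge_1[of k] by (intro mult_left_mono) auto
  finally show ?case by (simp add: p_Suc R_def z_Suc algebra_simps)
qed (simp add: orbit_slope_def R_def)

text \<open>While the parameter moves from \<open>t\<close> to \<open>s\<close>, the \<open>k\<close>-th iterate of \<open>x\<close> stays in \<open>I k\<close>, so the
  distortion bounds apply to all intermediate orbits.\<close>

lemma parameter_in_I:
  assumes s: "(F s ^^ Q) x = x + of_int P" and "k \<le> Q"
  shows "t \<le> s \<and> z k \<le> (F s ^^ k) x \<and> (F s ^^ k) x \<le> z' k \<or> s \<le> t \<and> z' k \<le> (F s ^^ k) x \<and> (F s ^^ k) x \<le> z k"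
proof -
  have Q: "(F u ^^ (Q - k)) ((F u ^^ k) y) = (F u ^^ Q) y" for u y
    using assms(2) by (metis comp_apply funpow_add le_add_diff_inverse2)
  have z'Q: "(F t ^^ (Q - k)) (z' k) = x + of_int P" unfolding z'_def Q x' ..
  show ?thesis
  proof (cases "t \<le> s")
    case True
    \<comment> \<open>Finishing the remaining Q - k steps with the smaller parameter t leads at most
      to x + P, which is exactly where \<open>z' k\<close> arrives; so the point cannot lie beyond
      \<open>z' k\<close>. The other case is the mirror image.\<close>
    have "(F t ^^ (Q - k)) ((F s ^^ k) x) \<le> (F s ^^ (Q - k)) ((F s ^^ k) x)"
      using True by (intro F_iterate_mono) auto
    then have "(F s ^^ k) x \<le> z' k" unfolding Q s using z'Q F.funpow_le_iff[of "Q - k" t "(F s ^^ k) x" "z' k"] by simp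
    then show ?thesis using True F_iterate_mono[OF True order_refl, of k x] by (auto simp: z_def)
  next
    case False
    then have st: "s \<le> t" by simp
    have "(F s ^^ (Q - k)) ((F s ^^ k) x) \<le> (F t ^^ (Q - k)) ((F s ^^ k) x)"
      using st by (intro F_iterate_mono) auto
    then have "z' k \<le> (F s ^^ k) x" unfolding Q s using z'Q F.funpow_le_iff[of "Q - k" t "z' k" "(F s ^^ k) x"] by simp
    then show ?thesis using st F_iterate_mono[OF st order_refl, of k x] by (auto simp: z_def)
  qed
qed

text \<open>Variation of constants: the change |s - t| made in step k + 1 is magnified by about p n
  / p (k + 1) until time n, with an error of at most the accumulated distortion \<open>R n\<close>.
  All contributions have the same sign, so they add up without cancellation.\<close>

lemma parameter_displacement:
  assumes s: "(F s ^^ Q) x = x + of_int P"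
  shows "n \<le> Q \<Longrightarrow> p n / R n * (\<bar>s - t\<bar> * (\<Sum>k<n. 1 / p (Suc k))) \<le> \<bar>(F s ^^ n) x - z n\<bar>"
proof (induction n)
  case (Suc n)
  let ?w = "\<lambda>n. (F s ^^ n) x"
  have par: "t \<le> s \<and> z k \<le> ?w k \<and> ?w k \<le> z' k \<or> s \<le> t \<and> z' k \<le> ?w k \<and> ?w k \<le> z k" if "k \<le> Q" for k
    by (rule parameter_in_I[OF s that])
  have wI: "?w n \<in> I n" using par[of n] Suc by (auto simp: I_def closed_segment_eq_real_ivl)
  have sp: "slope (z n) > 0" "e n \<ge> 1" "R n \<ge> 1" "p n > 0" using slope_pos e_ge_1 R_ge_1 orbit_slope_pos by auto
  have "p (Suc n) / R (Suc n) * (\<bar>s - t\<bar> * (\<Sum>k<Suc n. 1 / p (Suc k)))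
     = slope (z n) / e n * (p n / R n * (\<bar>s - t\<bar> * (\<Sum>k<n. 1 / p (Suc k)))) + \<bar>s - t\<bar> / R (Suc n)"
  proof -
    have "a * q / (b * c) * (\<tau> * (S + 1 / (a * q))) = a / b * (q / c * (\<tau> * S)) + \<tau> / (b * c)"
      if "a > 0" "q > 0" "b > 0" "c > 0" for a b c q \<tau> S :: real
      using that by (simp add: field_simps)
    from this[of "slope (z n)" "p n" "e n" "R n" "\<bar>s - t\<bar>" "\<Sum>k<n. 1 / p (Suc k)"] show ?thesis
      using sp by (simp add: p_Suc R_Suc)
  qed
  also have "\<dots> \<le> slope (z n) / e n * \<bar>?w n - z n\<bar> + \<bar>s - t\<bar>"
    using Suc sp R_ge_1[of "Suc n"] by (intro add_mono mult_left_mono) (auto simp: divide_le_eq mult_le_cancel_left1)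
  also have "\<dots> \<le> \<bar>H (?w n) - H (z n)\<bar> + \<bar>s - t\<bar>" using Suc wI by (intro add_mono chord_I) auto
  also have "\<dots> = \<bar>?w (Suc n) - z (Suc n)\<bar>"
  proof -
    have "H (?w n) \<ge> H (z n)" if "z n \<le> ?w n" using F.le_iff[of 0] that by (simp add: F_def)
    moreover have "H (?w n) \<le> H (z n)" if "?w n \<le> z n" using F.le_iff[of 0] that by (simp add: F_def)
    ultimately show ?thesis using par[of n] Suc unfolding F_Suc z_Suc by (auto simp: abs_if)
  qed
  finally show ?case .
qed (simp add: orbit_slope_def R_def z_def)

text \<open>Let d be the length of \<open>I 0\<close> and E = \<open>sig ^ 4\<close> the bound on
  the distortion. The arcs have total length at most 1, so d times the sum of the p k is at most E.
  At time Q the orbits of s and t differ by the length of \<open>I Q\<close>, so |s - t| times the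
  sum of the 1 / p (k + 1) is at most E^2 d. Multiplying eliminates d; the factor
  \<open>max lam mu\<close> pays for the index shift.\<close>

lemma parameter_bound:
  assumes s: "(F s ^^ Q) x = x + of_int P"
  shows "\<bar>s - t\<bar> * ((\<Sum>k<r. p k) * (\<Sum>k<r. 1 / p k)) \<le> sig ^ 12 * max lam mu"
proof -
  define d where "d = \<bar>z' 0 - z 0\<bar>"
  define E where "E = sig ^ 4"
  have E: "E \<ge> 1" unfolding E_def using sig_ge_1 by simp
  have RE: "R k \<le> E" for k unfolding E_def by (rule R_le)
  have d0: "d \<ge> 0" by (simp add: d_def)
  have pp: "p k > 0" for k by (rule orbit_slope_pos)
  have Rp: "R k > 0" for k using R_ge_1[of k] by linarith
  have "(\<Sum>k<r. p k) * d = (\<Sum>k<r. p k * d)" by (rule sum_distrib_right)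
  also have "\<dots> \<le> (\<Sum>k<r. E * \<bar>z' k - z k\<bar>)"
  proof (rule sum_mono)
    fix k assume "k \<in> {..<r}"
    then have "p k / R k * d \<le> \<bar>z' k - z k\<bar>" using I_length_lower[of k] rQ by (simp add: d_def)
    then have "p k * d \<le> R k * \<bar>z' k - z k\<bar>" using Rp[of k] by (simp add: field_simps)
    also have "\<dots> \<le> E * \<bar>z' k - z k\<bar>" by (intro mult_right_mono RE) auto
    finally show "p k * d \<le> E * \<bar>z' k - z k\<bar>" .
  qed
  also have "\<dots> \<le> E" using I_length_sum E by (simp add: sum_distrib_left[symmetric])
  finally have 1: "(\<Sum>k<r. p k) * d \<le> E" .
  define \<Sigma> where "\<Sigma> = (\<Sum>k<Q. 1 / p (Suc k))"
  have "p Q / R Q * (\<bar>s - t\<bar> * \<Sigma>) \<le> \<bar>x + of_int P - z Q\<bar>"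
    using parameter_displacement[OF s, of Q] by (simp add: \<Sigma>_def s)
  \<comment> \<open>At time Q the orbit of x under \<open>F s\<close> is at x + P, that is, at the
    end point \<open>z' Q\<close>.\<close>
  also have "\<dots> = \<bar>z' Q - z Q\<bar>" by (simp add: z'_def x')
  also have "\<dots> \<le> p Q * R Q * d" using I_length_upper[of Q] by (simp add: d_def)
  finally have "\<bar>s - t\<bar> * \<Sigma> \<le> R Q * R Q * d" using pp[of Q] Rp[of Q] by (simp add: field_simps)
  also have "\<dots> \<le> E * E * d" using RE Rp[of Q] d0 E by (intro mult_right_mono mult_mono) auto
  finally have 2: "\<bar>s - t\<bar> * \<Sigma> \<le> E * E * d" .
  have 3: "(\<Sum>k<r. 1 / p k) \<le> max lam mu * \<Sigma>"
  proof -
    have "(\<Sum>k<r. 1 / p k) \<le> (\<Sum>k<Q. 1 / p k)" using rQ pp by (intro sum_mono2) (auto simp: less_imp_le)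
    also have "\<dots> \<le> (\<Sum>k<Q. max lam mu * (1 / p (Suc k)))"
    proof (rule sum_mono)
      fix k
      have "1 / p k = slope (z k) * (1 / p (Suc k))" using slope_pos[of "z k"] by (simp add: p_Suc)
      also have "\<dots> \<le> max lam mu * (1 / p (Suc k))" using slope_le pp[of "Suc k"] by (intro mult_right_mono) auto
      finally show "1 / p k \<le> max lam mu * (1 / p (Suc k))" .
    qed
    finally show ?thesis by (simp add: \<Sigma>_def sum_distrib_left)
  qed
  have S0: "(\<Sum>k<r. p k) \<ge> 0" using pp by (intro sum_nonneg) (simp add: less_imp_le)
  have "\<bar>s - t\<bar> * ((\<Sum>k<r. p k) * (\<Sum>k<r. 1 / p k)) \<le> \<bar>s - t\<bar> * ((\<Sum>k<r. p k) * (max lam mu * \<Sigma>))"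
    using 3 S0 by (intro mult_left_mono) auto
  also have "\<dots> = max lam mu * (\<Sum>k<r. p k) * (\<bar>s - t\<bar> * \<Sigma>)" by (simp add: algebra_simps)
  also have "\<dots> \<le> max lam mu * (\<Sum>k<r. p k) * (E * E * d)"
    using 2 S0 lam_pos by (intro mult_left_mono) auto
  also have "\<dots> = max lam mu * E * E * ((\<Sum>k<r. p k) * d)" by (simp add: algebra_simps)
  also have "\<dots> \<le> max lam mu * E * E * E" using 1 lam_pos E by (intro mult_left_mono) auto
  also have "\<dots> = sig ^ 12 * max lam mu" by (simp add: E_def power_add[symmetric])
  finally show ?thesis .
qed

end


section \<open>Aperiodic parameters\<close>

lemma negligible_outer_open:
  fixes Z :: "'a::euclidean_space set"
  assumes "negligible Z" "e > 0"
  obtains U where "open U" "Z \<subseteq> U" "U \<in> lmeasurable" "measure lebesgue U < e"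
proof -
  have Z: "Z \<in> lmeasurable" "measure lebesgue Z = 0" using assms(1) by (auto simp: negligible_iff_measure)
  then obtain U where U: "open U" "Z \<subseteq> U" "U - Z \<in> lmeasurable" "emeasure lebesgue (U - Z) < ennreal e"
    using sets_lebesgue_outer_open[of Z e] assms(2) by blast
  have UZ: "(U - Z) \<union> Z = U" using U by blast
  have "U \<in> lmeasurable" using fmeasurable.Un[OF U(3) Z(1)] unfolding UZ .
  moreover have "measure lebesgue (U - Z) < e"
    using U(3,4) assms(2) by (simp add: emeasure_eq_measure2 ennreal_less_iff)
  then have "measure lebesgue U < e"
    using measure_Un_le[of "U - Z" lebesgue Z] fmeasurableD[OF U(3)] fmeasurableD[OF Z(1)] Z(2)
    unfolding UZ by linarith
  ultimately show thesis using that U by blast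
qed

lemma sum_exp_product_ge_square: "(real r)\<^sup>2 \<le> (\<Sum>k<r. exp (S k)) * (\<Sum>k<r. exp (- S k :: real))"
proof -
  have "(\<Sum>k<r. exp (S k / 2) * exp (- S k / 2))\<^sup>2 \<le> (\<Sum>k<r. (exp (S k / 2))\<^sup>2) * (\<Sum>k<r. (exp (- S k / 2))\<^sup>2)"
    by (rule Cauchy_Schwarz_ineq_sum)
  moreover have "(exp (a / 2))\<^sup>2 = exp a" for a :: real
    by (simp add: power2_eq_square flip: exp_add)
  moreover from this have "(exp (- a / 2))\<^sup>2 = exp (- a)" for a :: real .
  ultimately show ?thesis by (simp add: exp_minus_inverse flip: exp_add del: minus_divide_left)
qed

text \<open>This says that \<open>indicator {0..<\<kappa>} - \<kappa>\<close> is not an \<open>L\<^sup>2\<close> coboundary over the rotation by \<open>\<theta>\<close>.\<close>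

definition generic_pair :: "real \<Rightarrow> real \<Rightarrow> bool" where
  "generic_pair \<theta> \<kappa> \<longleftrightarrow> (\<forall>M. \<exists>N. M < (\<Sum>n=1..N.
     (norm (circle_char (int n) \<kappa> - 1))\<^sup>2 / ((real n)\<^sup>2 * (norm (circle_char (int n) \<theta> - 1))\<^sup>2)))"

context pl_family
begin

definition kappa :: real where "kappa = - ln mu / (ln lam - ln mu)"

definition exp_sums :: "real \<Rightarrow> real \<Rightarrow> nat \<Rightarrow> real \<Rightarrow> real" where
  "exp_sums c \<theta> r y = (\<Sum>k<r. exp (rotation_sum (arc_weight c (ln lam) (ln mu)) \<theta> k y)) *
     (\<Sum>k<r. exp (- rotation_sum (arc_weight c (ln lam) (ln mu)) \<theta> k y))"

text \<open>The quantifier over c is there because the step length \<open>h l\<close> depends on t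
  in an uncontrolled way; \<open>r0\<close> may depend on it. \<open>G\<close> will exclude starting
  points whose rotation orbit meets a break point.\<close>

definition spreads :: "real \<Rightarrow> real \<Rightarrow> bool" where
  "spreads \<theta> M \<longleftrightarrow> (\<forall>c G. 0 \<le> c \<longrightarrow> c \<le> 1 \<longrightarrow> (AE y in lborel. G y) \<longrightarrow>
     (\<exists>r0. \<forall>r\<ge>r0. \<exists>y. G y \<and> M * (real r)\<^sup>2 \<le>
       exp_sums c \<theta> r y))"

lemma spreads_1: "spreads \<theta> 1"
  unfolding spreads_def
proof (intro allI impI, rule exI[of _ 0], intro allI impI)
  fix c :: real and G :: "real \<Rightarrow> bool" and r :: nat
  assume "AE y in lborel. G y"
  then have "\<exists>y. G y"
  proof (rule contrapos_pp)
    assume "\<not> (\<exists>y. G y)"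
    then have "{y. \<not> G y} = UNIV" by auto
    then show "\<not> (AE y in lborel. G y)" by (simp add: AE_iff_measurable[OF _ refl])
  qed
  then show "\<exists>y. G y \<and> 1 * (real r)\<^sup>2 \<le>
       exp_sums c \<theta> r y"
    unfolding exp_sums_def using sum_exp_product_ge_square by auto
qed

text \<open>The step function has mean zero only for c = \<open>kappa\<close>; for other c the
  frequency 0 suffices. For c = \<open>kappa\<close> its squared coefficients are proportional to
  |e(n \<kappa>) - 1|^2 / n^2, where e(x) = exp (2 pi i x), so \<open>generic_pair\<close> is
  precisely the divergence that \<open>spread_of_divergence\<close> asks for.\<close>

lemma spreads_generic:
  assumes irr: "\<theta> \<notin> \<rat>" and ne: "lam \<noteq> mu" and gen: "generic_pair \<theta> kappa"
  shows "spreads \<theta> M"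
  unfolding spreads_def
proof (intro allI impI)
  fix c :: real and G :: "real \<Rightarrow> bool"
  assume c: "0 \<le> c" "c \<le> 1" and G: "AE y in lborel. G y"
  let ?g = "arc_weight c (ln lam) (ln mu)"
  have d: "ln lam - ln mu \<noteq> 0" using ne lam_pos mu_pos by simp
  interpret rotation_cocycle ?g "\<bar>ln lam\<bar> + \<bar>ln mu\<bar>" \<theta>
    by unfold_locales (auto simp: arc_weight_bound arc_weight_periodic)
  have "\<exists>r0. \<forall>r\<ge>r0. 4 * M * (real r)\<^sup>2 < spread r"
  proof (cases "c = kappa")
    case False
    have "coeff 0 = of_real (c * ln lam + (1 - c) * ln mu)"
      unfolding coeff_def using arc_weight_mean[OF c, of "ln lam" "ln mu"] by simp
    moreover have "c * ln lam + (1 - c) * ln mu \<noteq> 0"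
    proof
      assume "c * ln lam + (1 - c) * ln mu = 0"
      then have "c * (ln lam - ln mu) = - ln mu" by (simp add: algebra_simps)
      then show False using False d by (simp add: kappa_def field_simps)
    qed
    ultimately have "coeff 0 \<noteq> 0" by (simp only: of_real_eq_0_iff not_False_eq_True)
    then show ?thesis by (rule spread_of_nonzero_mean)
  next
    case True
    define K where "K = (ln lam - ln mu)\<^sup>2 / (2 * pi)\<^sup>2"
    have K: "K > 0" using d by (simp add: K_def)
    have nrm: "(norm (coeff (int n)))\<^sup>2 / (norm (circle_char (- int n) \<theta> - 1))\<^sup>2
       = K * ((norm (circle_char (int n) kappa - 1))\<^sup>2 / ((real n)\<^sup>2 * (norm (circle_char (int n) \<theta> - 1))\<^sup>2))" if "n \<ge> 1" for n
    proof -
      have "norm (circle_char (- int n) \<theta> - 1) = norm (cnj (circle_char (int n) \<theta> - 1))" by (simp add: cnj_circle_char)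
      then have 1: "norm (circle_char (- int n) \<theta> - 1) = norm (circle_char (int n) \<theta> - 1)" by (simp only: complex_mod_cnj)
      have "coeff (int n) = of_real (ln lam - ln mu) * (circle_char (int n) c - 1) / (2 * pi * \<i> * of_int (int n))"
        unfolding coeff_def using that by (intro arc_weight_coeff c) auto
      then have "norm (coeff (int n)) = \<bar>ln lam - ln mu\<bar> * norm (circle_char (int n) c - 1) / (2 * pi * real n)"
        by (simp add: norm_mult norm_divide del: of_real_diff)
      then show ?thesis unfolding 1 by (simp add: K_def True power_divide power_mult_distrib)
    qed
    obtain N where "4 * M / K < (\<Sum>n=1..N. (norm (circle_char (int n) kappa - 1))\<^sup>2 / ((real n)\<^sup>2 * (norm (circle_char (int n) \<theta> - 1))\<^sup>2))"
      using gen unfolding generic_pair_def by blast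
    then have "4 * M < K * (\<Sum>n=1..N. (norm (circle_char (int n) kappa - 1))\<^sup>2 / ((real n)\<^sup>2 * (norm (circle_char (int n) \<theta> - 1))\<^sup>2))"
      using K by (simp add: field_simps)
    also have "\<dots> = (\<Sum>n=1..N. (norm (coeff (int n)))\<^sup>2 / (norm (circle_char (- int n) \<theta> - 1))\<^sup>2)"
      unfolding sum_distrib_left by (intro sum.cong refl) (simp add: nrm)
    also have "\<dots> = (\<Sum>n\<in>int ` {1..N}. (norm (coeff n))\<^sup>2 / (norm (circle_char (- n) \<theta> - 1))\<^sup>2)"
      by (subst sum.reindex) (auto simp: inj_on_def)
    finally show ?thesis by (intro spread_of_divergence[OF irr, of "int ` {1..N}"]) auto
  qed
  then obtain r0 where r0: "\<And>r. r \<ge> r0 \<Longrightarrow> 4 * M * (real r)\<^sup>2 < spread r"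
    by blast
  show "\<exists>r0. \<forall>r\<ge>r0. \<exists>y. G y \<and> M * (real r)\<^sup>2 \<le> exp_sums c \<theta> r y"
  proof (rule exI[of _ r0], intro allI impI)
    fix r assume "r \<ge> r0"
    then have "4 * (M * (real r)\<^sup>2) < spread r"
      using r0 by (simp add: mult.assoc)
    from spread_point[OF this G, folded exp_sums_def] show "\<exists>y. G y \<and> M * (real r)\<^sup>2 \<le> exp_sums c \<theta> r y"
      by blast
  qed
qed

definition aperiodic :: "real \<Rightarrow> bool" where
  "aperiodic t \<longleftrightarrow> (\<forall>q>0. \<forall>p x. (F t ^^ q) x \<noteq> x + of_int p)"

text \<open>A semiconjugacy may collapse intervals, so h w = h l would not tell on which side of l
  the point w lies. Away from the values of h at break points, the order of h w and h l modulo 1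
  reflects that of w and l.\<close>

lemma ln_slope_semiconj:
  assumes "mono h" and h1: "\<And>w m. h (w + of_int m) = h w + of_int m" and h0: "h 0 = 0"
    and nb: "\<And>m. h w \<noteq> of_int m" "\<And>m. h w \<noteq> h l + of_int m"
  shows "\<not> break_pt w" "ln (slope w) = arc_weight (h l) (ln lam) (ln mu) (h w)"
proof -
  show "\<not> break_pt w"
    unfolding break_pt_def using nb h1[of 0] h1[of l] h0 by auto
  define f where "f = frac w"
  have w: "w = f + of_int \<lfloor>w\<rfloor>" by (simp add: f_def frac_def)
  have f: "0 \<le> f" "f < 1" by (auto simp: f_def frac_lt_1)
  have hw: "h w = h f + of_int \<lfloor>w\<rfloor>" by (metis h1 w)
  have "h 0 \<le> h f" "h f \<le> h 1" using f \<open>mono h\<close> by (auto simp: mono_def)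
  moreover have "h 1 = 1" using h1[of 0 1] h0 by simp
  ultimately have "0 \<le> h f" "h f \<le> 1" using h0 by auto
  moreover have "h f \<noteq> 0" "h f \<noteq> 1" using nb(1)[of "\<lfloor>w\<rfloor>"] nb(1)[of "\<lfloor>w\<rfloor> + 1"] hw by auto
  ultimately have fr: "frac (h w) = h f" unfolding hw by (simp add: frac_unique_iff)
  have "h f \<noteq> h l" using nb(2)[of "\<lfloor>w\<rfloor>"] hw by auto
  moreover have "h f \<le> h l" if "f < l" using that \<open>mono h\<close> by (auto simp: mono_def)
  moreover have "h l \<le> h f" if "\<not> f < l" using that \<open>mono h\<close> by (auto simp: mono_def)
  ultimately have "h f < h l \<longleftrightarrow> f < l" by fastforce
  then show "ln (slope w) = arc_weight (h l) (ln lam) (ln mu) (h w)"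
    by (simp add: slope_def arc_weight_def fr f_def)
qed

text \<open>The local form of the argument: s makes x periodic of type P / Q.
  \<open>parameter_bound\<close> limits |s - t| by the exponential sums, which
  \<open>spreads\<close> makes large, while P / Q differs from the rotation number of t by at least
  1 / (4 Q^2).\<close>

lemma parameter_approach:
  assumes ap: "aperiodic t" and M: "M > 0" and spr: "spreads (F.rho t) M" and d: "d > 0"
  shows "\<exists>s. s \<noteq> t \<and> \<bar>s - t\<bar> < d \<and> \<bar>F.rho s - F.rho t\<bar> < d \<and>
    M / (16 * (sig ^ 12 * max lam mu)) * \<bar>s - t\<bar> \<le> \<bar>F.rho s - F.rho t\<bar>"
proof -
  define C where "C = sig ^ 12 * max lam mu"
  have C: "C > 0" unfolding C_def using sig_ge_1 lam_pos by (intro mult_pos_pos) auto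
  let ?\<theta> = "F.rho t"
  have irr: "?\<theta> \<notin> \<rat>" by (rule F.rho_irrational) (use ap in \<open>auto simp: aperiodic_def\<close>)
  obtain h' where h': "continuous_on UNIV h'" "mono h'" "\<And>x. h' (x + 1) = h' x + 1" "\<And>x. h' (F t x) = h' x + ?\<theta>"
    using F.rotation_semiconjugacy[OF irr] by blast
  define h where "h x = h' x - h' 0" for x
  have h: "continuous_on UNIV h" "mono h" "\<And>x. h (x + 1) = h x + 1" "\<And>x. h (F t x) = h x + ?\<theta>" "h 0 = 0"
    using h' by (auto simp: h_def mono_def intro!: continuous_intros)
  note hm = add_of_int[of h, OF h(3)]
  have h_iter: "h ((F t ^^ k) w) = h w + real k * ?\<theta>" for k w
    by (induction k) (auto simp: h algebra_simps)
  have h_surj: "\<exists>x. h x = y" for y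
  proof -
    have "h (0 + of_int \<lfloor>y\<rfloor>) \<le> y" "y \<le> h (0 + of_int (\<lfloor>y\<rfloor> + 1))"
      unfolding hm h(5) by linarith+
    then show ?thesis using IVT'[of h "0 + of_int \<lfloor>y\<rfloor>" y "0 + of_int (\<lfloor>y\<rfloor> + 1)"] continuous_on_subset[OF h(1)] by auto
  qed
  have "0 \<le> l" "l \<le> 1" using l by simp_all
  then have "h 0 \<le> h l" "h l \<le> h 1" using monoD[OF h(2)] by blast+
  moreover have "h 1 = 1" using h(3)[of 0] h(5) by simp
  ultimately have c: "0 \<le> h l" "h l \<le> 1" by (simp_all only: h(5))
  \<comment> \<open>The starting points whose rotation orbit hits 0 or \<open>h l\<close>; for all
    others the slopes along the orbit are read off the rotation.\<close>
  define Z where "Z = (\<Union>k::nat. \<Union>m::int. {of_int m - real k * ?\<theta>, h l + of_int m - real k * ?\<theta>})"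
  have "countable Z" unfolding Z_def by (intro countable_UN countableI_type countable_insert countable_empty)
  then have AE_Z: "AE y in lborel. y \<notin> Z" by (intro AE_not_in countable_imp_null_set_lborel)
  obtain r0 where r0: "\<And>r. r \<ge> r0 \<Longrightarrow> \<exists>y. y \<notin> Z \<and> M * (real r)\<^sup>2 \<le>
       exp_sums (h l) ?\<theta> r y"
    using spr[unfolded spreads_def, rule_format, OF c AE_Z] by blast
  obtain N1 :: nat where N1: "real N1 > C / (M * d)" using reals_Archimedean2 by blast
  obtain N2 :: nat where N2: "real N2 > 1 / d" using reals_Archimedean2 by blast
  \<comment> \<open>N1 will make s close to t, N2 will make the rotation numbers close, and N >= 2
    keeps the return arcs shorter than 1.\<close>
  define N where "N = Suc (Suc (max r0 (max N1 N2)))"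
  have N: "N \<ge> r0" "N \<ge> 2" "real N > C / (M * d)" "real N > 1 / d"
    using N1 N2 by (auto simp: N_def)
  obtain p q p' q' where fa: "farey_around ?\<theta> p q p' q'" "q \<le> 2 * q'" "q' \<le> 2 * q" "int N \<le> q" "int N \<le> q'"
    using balanced_farey_around[OF irr, of N] by blast
  \<comment> \<open>\<open>farey_gap\<close> needs |j| below both denominators; balance then gives Q
    <= 2 r for either choice of Q.\<close>
  define r where "r = nat (min q q')"
  have r: "int r = min q q'" "N \<le> r" using fa by (auto simp: r_def)
  have pos: "of_int q * ?\<theta> - of_int p > 0" "of_int p' - of_int q' * ?\<theta> > 0" using fa(1) by (auto simp: farey_around_def)
  have gapA: "of_int q * ?\<theta> - of_int p < \<bar>of_int j * ?\<theta> - of_int m\<bar> \<and> of_int p' - of_int q' * ?\<theta> < \<bar>of_int j * ?\<theta> - of_int m\<bar>"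
    if "j \<noteq> 0" "\<bar>j\<bar> < int r" for j m
    using farey_gap[OF fa(1) that(1), of m] that(2) pos r by auto
  have sm: "of_int q * ?\<theta> - of_int p < 1 / real N" "of_int p' - of_int q' * ?\<theta> < 1 / real N"
  proof -
    have "1 / of_int q' \<le> 1 / real N" "1 / of_int q \<le> 1 / real N" using fa(4,5) N(2) by (auto intro!: divide_left_mono)
    then show "of_int q * ?\<theta> - of_int p < 1 / real N" "of_int p' - of_int q' * ?\<theta> < 1 / real N"
      using farey_small[OF fa(1)] by linarith+
  qed
  \<comment> \<open>Of the two Farey neighbours the one further from \<theta> is taken: the lower
    bound on its error separates the rotation numbers, while the upper gap estimate holds for
    both.\<close>
  obtain P Q where PQ: "r \<le> Q" "Q \<le> 2 * r" "\<bar>of_int P - real Q * ?\<theta>\<bar> < 1 / real N" "1 / (4 * real Q) \<le> \<bar>of_int P - real Q * ?\<theta>\<bar>"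
    and gap: "\<And>j m. j \<noteq> 0 \<Longrightarrow> \<bar>j\<bar> < int r \<Longrightarrow> \<bar>of_int P - real Q * ?\<theta>\<bar> < \<bar>of_int j * ?\<theta> - of_int m\<bar>"
  proof (cases "of_int q * ?\<theta> - of_int p \<ge> 1 / (4 * of_int q)")
    case True
    have q: "real (nat q) = of_int q" using fa by simp
    have ab: "\<bar>of_int p - real (nat q) * ?\<theta>\<bar> = of_int q * ?\<theta> - of_int p" unfolding q using pos by simp
    show ?thesis by (rule that[of "nat q" p]) (use True sm gapA fa r in \<open>auto simp: ab q[symmetric] simp del: of_nat_nat\<close>)
  next
    case False
    then have F: "of_int p' - of_int q' * ?\<theta> \<ge> 1 / (4 * of_int q')" using farey_far_endpoint[OF fa(1-3)] by blast
    have q: "real (nat q') = of_int q'" using fa by simp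
    have ab: "\<bar>of_int p' - real (nat q') * ?\<theta>\<bar> = of_int p' - of_int q' * ?\<theta>" unfolding q using pos by simp
    show ?thesis by (rule that[of "nat q'" p']) (use F sm gapA fa r in \<open>auto simp: ab q[symmetric] simp del: of_nat_nat\<close>)
  qed
  have r2: "r \<ge> 2" using r N by linarith
  obtain y where y: "y \<notin> Z" "M * (real r)\<^sup>2 \<le>
       exp_sums (h l) ?\<theta> r y"
    using r0[of r] r N by auto
  obtain x where x: "h x = y" using h_surj by blast
  obtain x' where x': "(F t ^^ Q) x' = x + of_int P" using F.funpow_surj by blast
  interpret near_return l L t h ?\<theta> Q r P x x'
  proof unfold_locales
    have "1 / real N \<le> 1 / 2" using N by (intro divide_left_mono) auto
    then show "\<bar>of_int P - real Q * ?\<theta>\<bar> < 1" using PQ by linarith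
  qed (use h gap PQ r2 x' in auto)
  have ln_s: "ln (slope ((F t ^^ i) x)) = arc_weight (h l) (ln lam) (ln mu) (y + real i * ?\<theta>)" for i
  proof -
    have hi: "h ((F t ^^ i) x) = y + real i * ?\<theta>" by (simp add: h_iter x)
    have "y + real i * ?\<theta> \<noteq> of_int m" "y + real i * ?\<theta> \<noteq> h l + of_int m" for m
      using y(1) unfolding Z_def by (auto simp: algebra_simps)
    then show ?thesis using ln_slope_semiconj(2)[OF h(2) hm h(5), of "(F t ^^ i) x"] by (simp add: hi)
  qed
  have os: "orbit_slope t x k = exp (rotation_sum (arc_weight (h l) (ln lam) (ln mu)) ?\<theta> k y)" for k
  proof -
    have "orbit_slope t x k = (\<Prod>i<k. exp (ln (slope ((F t ^^ i) x))))"
      unfolding orbit_slope_def by (simp add: slope_pos)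
    then show ?thesis by (simp add: ln_s exp_sum rotation_sum_def)
  qed
  obtain s where s: "(F s ^^ Q) x = x + of_int P" using solve_iterate[of Q x "x + of_int P"] r2 PQ by auto
  have pb: "\<bar>s - t\<bar> * ((\<Sum>k<r. orbit_slope t x k) * (\<Sum>k<r. 1 / orbit_slope t x k)) \<le> C"
    using parameter_bound[OF s] unfolding C_def .
  have e1: "1 / exp u = exp (- u)" for u :: real by (simp add: exp_minus field_simps)
  have "\<bar>s - t\<bar> * (M * (real r)\<^sup>2) \<le> C"
    using order_trans[OF mult_left_mono[OF y(2)[unfolded exp_sums_def]] pb[unfolded os e1]] by simp
  then have st: "\<bar>s - t\<bar> * M \<le> C / (real r)\<^sup>2" using r2 by (simp add: field_simps)
  have rs: "F.rho s = of_int P / real Q" by (rule F.rho_periodic[OF _ s]) (use r2 PQ in auto)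
  have Q0: "real Q > 0" using r2 PQ by auto
  have diff: "\<bar>F.rho s - ?\<theta>\<bar> = \<bar>of_int P - real Q * ?\<theta>\<bar> / real Q"
  proof -
    have "F.rho s - ?\<theta> = (of_int P - real Q * ?\<theta>) / real Q" unfolding rs using Q0 by (simp add: field_simps)
    then show ?thesis using Q0 by (simp add: abs_divide)
  qed
  \<comment> \<open>The constant 16 is 4 from \<open>farey_far_endpoint\<close> times 4 from Q <= 2
    r squared.\<close>
  have "1 / (16 * (real r)\<^sup>2) \<le> 1 / (4 * (real Q)\<^sup>2)"
  proof -
    have "(real Q)\<^sup>2 \<le> (2 * real r)\<^sup>2" using PQ(2) by (intro power_mono) auto
    then show ?thesis using Q0 r2 by (intro divide_left_mono) (auto simp: power_mult_distrib)
  qed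
  also have "\<dots> = 1 / (4 * real Q) / real Q" by (simp add: power2_eq_square)
  also have "\<dots> \<le> \<bar>F.rho s - ?\<theta>\<bar>" unfolding diff using PQ Q0 by (intro divide_right_mono) auto
  finally have low: "1 / (16 * (real r)\<^sup>2) \<le> \<bar>F.rho s - ?\<theta>\<bar>" .
  have "M / (16 * C) * \<bar>s - t\<bar> = (\<bar>s - t\<bar> * M) / (16 * C)" by simp
  also have "\<dots> \<le> (C / (real r)\<^sup>2) / (16 * C)" using st C by (intro divide_right_mono) auto
  also have "\<dots> = 1 / (16 * (real r)\<^sup>2)" using C by simp
  also note low
  finally have fin: "M / (16 * C) * \<bar>s - t\<bar> \<le> \<bar>F.rho s - ?\<theta>\<bar>" .
  have "F.rho s \<in> \<rat>" unfolding rs by auto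
  then have "s \<noteq> t" using irr by auto
  moreover have "\<bar>s - t\<bar> < d"
  proof -
    have "real r \<ge> real N" "real N \<ge> 2" using r N by auto
    then have "(real r)\<^sup>2 \<ge> real N" unfolding power2_eq_square by (smt (verit) mult_le_cancel_left1)
    then have "C / (real r)\<^sup>2 \<le> C / real N" using C N r2 by (intro divide_left_mono) auto
    then have "\<bar>s - t\<bar> * M \<le> C / real N" using st by linarith
    also have "\<dots> < M * d" using N M d by (simp add: field_simps)
    finally show ?thesis using M by (simp add: mult.commute)
  qed
  moreover have "\<bar>F.rho s - ?\<theta>\<bar> < d"
  proof -
    have "\<bar>F.rho s - ?\<theta>\<bar> \<le> \<bar>of_int P - real Q * ?\<theta>\<bar>" unfolding diff using PQ r2 by (simp add: divide_le_eq mult_le_cancel_left1)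
    also have "\<dots> < 1 / real N" by (rule PQ)
    also have "\<dots> < d" using N d by (simp add: field_simps)
    finally show ?thesis .
  qed
  ultimately show ?thesis using fin unfolding C_def by blast
qed

lemma aperiodic_cover:
  assumes ap: "aperiodic t" and M: "M > 0" and spr: "spreads (F.rho t) M" and d: "d > 0"
    and U: "open U" "F.rho t \<in> U"
  shows "\<exists>a b. a \<in> UNIV \<and> b \<in> UNIV \<and> a < b \<and> b - a < d \<and> a \<le> t \<and> t \<le> b \<and>
    M / (16 * (sig ^ 12 * max lam mu)) * (b - a) \<le> F.rho b - F.rho a \<and> {F.rho a..F.rho b} \<subseteq> U"
proof -
  obtain e where e: "e > 0" "ball (F.rho t) e \<subseteq> U" using U openE by blast
  obtain s where s: "s \<noteq> t" "\<bar>s - t\<bar> < min d e" "\<bar>F.rho s - F.rho t\<bar> < min d e"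
     "M / (16 * (sig ^ 12 * max lam mu)) * \<bar>s - t\<bar> \<le> \<bar>F.rho s - F.rho t\<bar>"
    using parameter_approach[OF ap M spr, of "min d e"] d e by auto
  have sub: "{F.rho a..F.rho b} \<subseteq> U" if "{a, b} = {s, t}" for a b
  proof
    fix z assume "z \<in> {F.rho a..F.rho b}"
    then have "\<bar>z - F.rho t\<bar> < e" using s(3) that by (auto simp: doubleton_eq_iff)
    then show "z \<in> U" using e by (auto simp: ball_def dist_real_def abs_minus_commute)
  qed
  show ?thesis
  proof (cases "s < t")
    case True
    then have "F.rho s \<le> F.rho t" using rho_mono by (auto simp: mono_def)
    then show ?thesis using s True sub[of s t] by (intro exI[of _ s] exI[of _ t]) auto
  next
    case False
    then have "t < s" using s by auto
    then have "F.rho t \<le> F.rho s" using rho_mono by (auto simp: mono_def)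
    then show ?thesis using s \<open>t < s\<close> sub[of t s] by (intro exI[of _ t] exI[of _ s]) auto
  qed
qed

text \<open>Parameters are split by their rotation number. Outside the exceptional set
  \<open>Z\<close> the factor M is as large as desired while the images stay in a bounded interval.
  Inside \<open>Z\<close> the factor 1 from \<open>spreads_1\<close> is enough, because the images
  can be kept in an open neighbourhood of \<open>Z\<close> of small measure.\<close>

theorem aperiodic_negligible:
  assumes ne: "lam \<noteq> mu" and gen: "negligible {\<theta>. \<theta> \<notin> \<rat> \<and> \<not> generic_pair \<theta> kappa}"
  shows "negligible {t. aperiodic t}"
proof -
  define C where "C = 16 * (sig ^ 12 * max lam mu)"
  have C: "C > 0" unfolding C_def using sig_ge_1 lam_pos by (intro mult_pos_pos) auto
  define Z where "Z = {\<theta>. \<theta> \<notin> \<rat> \<and> \<not> generic_pair \<theta> kappa}"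
  have irr: "F.rho t \<notin> \<rat>" if "aperiodic t" for t by (rule F.rho_irrational) (use that in \<open>auto simp: aperiodic_def\<close>)
  have n1: "negligible {t. aperiodic t \<and> F.rho t \<notin> Z \<and> \<bar>F.rho t\<bar> < real n}" (is "negligible ?E") for n
    unfolding negligible_outer_le
  proof (intro allI impI)
    fix e :: real assume e: "e > 0"
    define U where "U = {- real n - 1<..<real n + 1}"
    \<comment> \<open>\<open>U\<close> has length 2 n + 2, so this factor makes the covering bound
      equal to e.\<close>
    define M where "M = C * (2 * real n + 2) / e"
    have M: "M > 0" using C e by (simp add: M_def)
    have K: "M / C > 0" using M C by simp
    obtain T where T: "?E \<subseteq> T" "T \<in> lmeasurable" "measure lebesgue T \<le> measure lebesgue U / (M / C)"
    proof (rule expanding_cover[of UNIV F.rho "M / C" U ?E])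
      show "mono_on UNIV F.rho" using rho_mono by (simp add: mono_on_def mono_def)
      show "U \<in> lmeasurable" by (simp add: U_def)
      fix t d :: real assume t: "t \<in> ?E" "d > 0"
      have "spreads (F.rho t) M" using t irr[of t] ne by (intro spreads_generic) (auto simp: Z_def)
      then show "\<exists>a b. a \<in> UNIV \<and> b \<in> UNIV \<and> a < b \<and> b - a < d \<and> a \<le> t \<and> t \<le> b \<and>
         M / C * (b - a) \<le> F.rho b - F.rho a \<and> {F.rho a..F.rho b} \<subseteq> U"
        unfolding C_def using t M by (intro aperiodic_cover) (auto simp: U_def)
    qed (use K in auto)
    have "a / (C * a / e / C) = e" if "a > 0" for a :: real using that e C by (simp add: field_simps)
    from this[of "2 * real n + 2"] have "measure lebesgue U / (M / C) = e" by (simp add: U_def M_def)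
    then show "\<exists>T. ?E \<subseteq> T \<and> T \<in> lmeasurable \<and> measure lebesgue T \<le> e" using T by auto
  qed
  have n2: "negligible {t. aperiodic t \<and> F.rho t \<in> Z}" (is "negligible ?E")
    unfolding negligible_outer_le
  proof (intro allI impI)
    fix e :: real assume e: "e > 0"
    obtain U where U: "open U" "Z \<subseteq> U" "U \<in> lmeasurable" "measure lebesgue U < e / C"
      using negligible_outer_open[of Z "e / C"] gen e C unfolding Z_def[symmetric] by auto
    have K: "1 / C > 0" using C by simp
    obtain T where T: "?E \<subseteq> T" "T \<in> lmeasurable" "measure lebesgue T \<le> measure lebesgue U / (1 / C)"
    proof (rule expanding_cover[of UNIV F.rho "1 / C" U ?E])
      show "mono_on UNIV F.rho" using rho_mono by (simp add: mono_on_def mono_def)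
      show "U \<in> lmeasurable" by (rule U)
      fix t d :: real assume t: "t \<in> ?E" "d > 0"
      show "\<exists>a b. a \<in> UNIV \<and> b \<in> UNIV \<and> a < b \<and> b - a < d \<and> a \<le> t \<and> t \<le> b \<and>
         1 / C * (b - a) \<le> F.rho b - F.rho a \<and> {F.rho a..F.rho b} \<subseteq> U"
        unfolding C_def using t U spreads_1 by (intro aperiodic_cover) auto
    qed (use K in auto)
    have "measure lebesgue U / (1 / C) \<le> e" using U C by (simp add: field_simps)
    then show "\<exists>T. ?E \<subseteq> T \<and> T \<in> lmeasurable \<and> measure lebesgue T \<le> e" using T by auto
  qed
  have "{t. aperiodic t} \<subseteq> (\<Union>n. {t. aperiodic t \<and> F.rho t \<notin> Z \<and> \<bar>F.rho t\<bar> < real n}) \<union> {t. aperiodic t \<and> F.rho t \<in> Z}"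
    using reals_Archimedean2 by auto
  moreover have "negligible \<dots>"
    using n1 n2 by (intro negligible_Un negligible_countable_Union) auto
  ultimately show ?thesis by (rule negligible_subset[rotated])
qed

end


section \<open>Generic rotation data\<close>

lemma AE_lborel_iff_negligible:
  fixes P :: "'a::euclidean_space \<Rightarrow> bool"
  shows "(AE x in lborel. P x) \<longleftrightarrow> negligible {x. \<not> P x}"
proof -
  have "(AE x in lborel. P x) \<longleftrightarrow> (AE x in lebesgue. P x)" by (simp add: AE_completion_iff)
  also have "\<dots> \<longleftrightarrow> (\<exists>N\<in>null_sets lebesgue. {x. \<not> P x} \<subseteq> N)" by (simp add: eventually_ae_filter)
  also have "\<dots> \<longleftrightarrow> negligible {x. \<not> P x}"
    unfolding negligible_iff_null_sets[symmetric]
    using negligible_subset negligible_iff_null_sets by blast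
  finally show ?thesis .
qed

text \<open>On the set \<open>A m\<close> the real part of the character is at least 1 / 2 for
  infinitely many frequencies, so the indicator of \<open>A m\<close> has infinitely many Fourier
  coefficients of modulus at least half its measure. Bessel's inequality forces that measure to be
  0.\<close>

lemma lacunary_negligible:
  fixes X :: "nat set"
  assumes X: "infinite X"
  shows "negligible {\<kappa>\<in>{0..<1}. \<exists>m. \<forall>n\<in>X. n \<ge> m \<longrightarrow> 1 / 2 \<le> Re (circle_char (int n) \<kappa>)}"
proof -
  define A where "A m = {\<kappa>\<in>{0..<1}. \<forall>n\<in>X. n \<ge> m \<longrightarrow> 1 / 2 \<le> Re (circle_char (int n) \<kappa>)}" for m
  have Am [measurable]: "A m \<in> sets borel" for m
  proof -
    have *: "(\<lambda>\<kappa>. Re (circle_char n \<kappa>)) \<in> borel_measurable borel" for n by measurable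
    have "A m = {0..<1} \<inter> (\<Inter>n\<in>X \<inter> {m..}. {\<kappa>. 1 / 2 \<le> Re (circle_char (int n) \<kappa>)})" by (auto simp: A_def)
    moreover have "{\<kappa>. 1 / 2 \<le> Re (circle_char (int n) \<kappa>)} \<in> sets borel" for n
      using borel_measurable_le[OF borel_measurable_const *, of "1/2" "int n"] by simp
    moreover have "X \<inter> {m..} \<noteq> {}" using X by (metis disjoint_iff atLeast_iff finite_nat_set_iff_bounded not_le)
    ultimately show ?thesis by (auto intro!: sets.Int sets.countable_INT'')
  qed
  have "negligible (A m)" for m
  proof -
    define f where "f = (indicator (A m) :: real \<Rightarrow> real)"
    have fm [measurable]: "f \<in> borel_measurable borel" unfolding f_def by measurable
    have fb: "\<bar>f x\<bar> \<le> 1" for x by (simp add: f_def indicator_def)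
    define a where "a = (\<integral>y. f y \<partial>unit_interval)"
    have a0: "a \<ge> 0" unfolding a_def f_def by simp
    have f2: "(\<integral>y. (f y)\<^sup>2 \<partial>unit_interval) = a" unfolding a_def
      by (intro Bochner_Integration.integral_cong refl) (simp add: f_def indicator_def)
    have low: "a / 2 \<le> norm (\<integral>y. of_real (f y) * circle_char (int n) y \<partial>unit_interval)" if n: "n \<in> X" "n \<ge> m" for n
    proof -
      have i: "integrable unit_interval (\<lambda>y. of_real (f y) * circle_char (int n) y)"
        by (rule integrable_unit_interval[of _ 1]) (use fb in \<open>auto simp: norm_mult\<close>)
      have i2: "integrable unit_interval f" by (rule integrable_unit_interval[of _ 1]) (use fb in auto)
      have "a / 2 = (\<integral>y. f y / 2 \<partial>unit_interval)" by (simp add: a_def)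
      also have "\<dots> \<le> (\<integral>y. Re (of_real (f y) * circle_char (int n) y) \<partial>unit_interval)"
      proof (rule integral_mono)
        show "f y / 2 \<le> Re (of_real (f y) * circle_char (int n) y)" for y
          using n by (auto simp: f_def indicator_def A_def)
      qed (use integrable_Re[OF i] i2 in auto)
      also have "\<dots> = Re (\<integral>y. of_real (f y) * circle_char (int n) y \<partial>unit_interval)" using i by (rule integral_Re)
      also have "\<dots> \<le> norm (\<integral>y. of_real (f y) * circle_char (int n) y \<partial>unit_interval)" by (rule complex_Re_le_cmod)
      finally show ?thesis .
    qed
    have "a = 0"
    proof (rule ccontr)
      assume "a \<noteq> 0"
      then have a: "a > 0" using a0 by simp
      obtain K :: nat where K: "real K > 4 / a" using reals_Archimedean2 by blast
      have "infinite (X \<inter> {m..})"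
      proof
        assume "finite (X \<inter> {m..})"
        moreover have "X \<subseteq> (X \<inter> {m..}) \<union> {..<m}" by auto
        ultimately show False using X finite_subset by blast
      qed
      then obtain I where I: "finite I" "card I = K" "I \<subseteq> X \<inter> {m..}" using infinite_arbitrarily_large by blast
      have "(\<Sum>n\<in>I. (a / 2)\<^sup>2) \<le> (\<Sum>n\<in>I. (norm (\<integral>y. of_real (f y) * circle_char (int n) y \<partial>unit_interval))\<^sup>2)"
        using I low a0 by (intro sum_mono power_mono) auto
      also have "\<dots> = (\<Sum>n\<in>int ` I. (norm (\<integral>y. of_real (f y) * circle_char n y \<partial>unit_interval))\<^sup>2)"
        by (subst sum.reindex) (auto simp: inj_on_def)
      also have "\<dots> \<le> a" using bessel[OF fm fb, of "int ` I"] I f2 by simp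
      finally have "real K * (a / 2)\<^sup>2 \<le> a" using I by simp
      then have "real K * a \<le> 4" using a by (simp add: power2_eq_square field_simps)
      then show False using K a by (simp add: field_simps)
    qed
    moreover have "a = measure lborel (A m)"
    proof -
      have "indicator {0..<1} y *\<^sub>R f y = indicator (A m) y" for y
        by (auto simp: f_def indicator_def A_def)
      then show ?thesis unfolding a_def integral_unit_interval by simp
    qed
    moreover have "emeasure lborel (A m) \<le> emeasure lborel {0..<1::real}"
      by (rule emeasure_mono) (auto simp: A_def)
    then have "emeasure lborel (A m) < \<infinity>" using emeasure_Ico_finite[of 0 1] by (rule le_less_trans)
    ultimately have "emeasure lborel (A m) = 0" by (simp add: emeasure_eq_ennreal_measure)
    then have "A m \<in> null_sets lborel" by (simp add: null_sets_def)
    then show ?thesis unfolding negligible_iff_null_sets by (rule null_sets_completionI)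
  qed
  then have "negligible (\<Union>m. A m)" by (intro negligible_countable_Union) auto
  then show ?thesis by (rule negligible_subset) (auto simp: A_def)
qed

text \<open>Dirichlet's theorem gives infinitely many k with |k \<theta> - h| < 1 / k, and |exp (2
  pi i x) - 1| <= 2 pi |x| with 2 pi < 7.\<close>

lemma irrational_good_frequencies:
  assumes irr: "\<theta> \<notin> \<rat>"
  shows "infinite {n. n \<ge> 1 \<and> norm (circle_char (int n) \<theta> - 1) \<le> 7 / real n}" (is "infinite ?X")
  unfolding infinite_nat_iff_unbounded_le
proof
  fix K :: nat
  have "infinite (approx_set \<theta>)" using irr rational_iff_finite_approx_set[of \<theta>] by simp
  then obtain h k where hk: "(h, k) \<in> approx_set \<theta>" "k > int K" using infinite_approx_set[of \<theta> "int K"] by blast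
  have k0: "k > 0" using hk by simp
  have "\<bar>\<theta> - of_int h / of_int k\<bar> < 1 / (of_int k)\<^sup>2" using hk by (simp add: approx_set_def)
  moreover have "of_int k * \<theta> - of_int h = of_int k * (\<theta> - of_int h / of_int k)" using k0 by (simp add: field_simps)
  ultimately have d: "\<bar>of_int k * \<theta> - of_int h\<bar> < 1 / of_int k"
    using k0 by (simp add: abs_mult power2_eq_square field_simps)
  have "circle_char k \<theta> = circle_char 1 (of_int k * \<theta> - of_int h + of_int h)" by (simp add: circle_char_def)
  also have "\<dots> = cis (2 * pi * (of_int k * \<theta> - of_int h))"
    unfolding circle_char_add by (simp add: circle_char_def[of 1 "_ - _"])
  finally have "norm (circle_char k \<theta> - 1) = 2 * \<bar>sin (pi * (of_int k * \<theta> - of_int h))\<bar>"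
    using dist_exp_i_1[of "2 * pi * (of_int k * \<theta> - of_int h)"] by (simp add: cis_conv_exp mult.assoc)
  also have "\<dots> \<le> 2 * \<bar>pi * (of_int k * \<theta> - of_int h)\<bar>" using abs_sin_x_le_abs_x by simp
  also have "\<dots> = 2 * pi * \<bar>of_int k * \<theta> - of_int h\<bar>" by (simp add: abs_mult)
  also have "\<dots> \<le> 7 * (1 / of_int k)" using d pi_less_4 pi_approx by (intro mult_mono) auto
  finally have "nat k \<in> ?X" using k0 by auto
  moreover have "nat k \<ge> K" using hk by linarith
  ultimately show "\<exists>n\<ge>K. n \<in> ?X" by blast
qed

text \<open>At a good frequency n of \<theta> with
  \<open>Re (circle_char (int n) \<kappa>) < 1 / 2\<close>, the term of the series is at least (1 /
  4) / 49 = 1 / 196. By \<open>lacunary_negligible\<close> there are infinitely many such n for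
  almost every \<kappa>.\<close>

lemma generic_pair_AE:
  assumes irr: "\<theta> \<notin> \<rat>"
  shows "AE \<kappa> in lborel. \<kappa> \<in> {0..<1} \<longrightarrow> generic_pair \<theta> \<kappa>"
proof -
  let ?X = "{n. n \<ge> 1 \<and> norm (circle_char (int n) \<theta> - 1) \<le> 7 / real n}"
  let ?B = "{\<kappa>\<in>{0..<1}. \<exists>m. \<forall>n\<in>?X. n \<ge> m \<longrightarrow> 1 / 2 \<le> Re (circle_char (int n) \<kappa>)}"
  have gen: "generic_pair \<theta> \<kappa>" if \<kappa>: "\<kappa> \<in> {0..<1}" "\<kappa> \<notin> ?B" for \<kappa>
    unfolding generic_pair_def
  proof
    fix M :: real
    let ?t = "\<lambda>n. (norm (circle_char (int n) \<kappa> - 1))\<^sup>2 / ((real n)\<^sup>2 * (norm (circle_char (int n) \<theta> - 1))\<^sup>2)"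
    have inf: "infinite {n\<in>?X. Re (circle_char (int n) \<kappa>) < 1 / 2}"
      unfolding infinite_nat_iff_unbounded_le
    proof
      fix m
      have "\<not> (\<forall>n\<in>?X. n \<ge> m \<longrightarrow> 1 / 2 \<le> Re (circle_char (int n) \<kappa>))" using \<kappa> by blast
      then show "\<exists>n\<ge>m. n \<in> {n\<in>?X. Re (circle_char (int n) \<kappa>) < 1 / 2}" by (auto simp: not_le)
    qed
    have ge: "?t n \<ge> 1 / 196" if n: "n \<in> ?X" "Re (circle_char (int n) \<kappa>) < 1 / 2" for n
    proof -
      have n1: "real n \<ge> 1" using n by auto
      have "1 / 2 \<le> Re (1 - circle_char (int n) \<kappa>)" using n by simp
      also have "\<dots> \<le> norm (1 - circle_char (int n) \<kappa>)" by (rule complex_Re_le_cmod)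
      finally have "1 / 2 \<le> norm (circle_char (int n) \<kappa> - 1)" by (simp add: norm_minus_commute)
      then have 1: "(1 / 2)\<^sup>2 \<le> (norm (circle_char (int n) \<kappa> - 1))\<^sup>2" by (intro power_mono) auto
      have "real n * norm (circle_char (int n) \<theta> - 1) \<le> 7" using n n1 by (simp add: field_simps)
      then have 2: "(real n * norm (circle_char (int n) \<theta> - 1))\<^sup>2 \<le> 7\<^sup>2" by (intro power_mono) auto
      have 3: "real n * norm (circle_char (int n) \<theta> - 1) > 0" using circle_char_eq_1_iff[OF _ irr, of "int n"] n1 n by auto
      have "1 / 196 = (1 / 2)\<^sup>2 / (7::real)\<^sup>2" by (simp add: power2_eq_square)
      also have "\<dots> \<le> (norm (circle_char (int n) \<kappa> - 1))\<^sup>2 / (real n * norm (circle_char (int n) \<theta> - 1))\<^sup>2"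
        by (rule frac_le[OF _ 1 zero_less_power[OF 3] 2]) simp
      finally show ?thesis by (simp add: power_mult_distrib)
    qed
    obtain K :: nat where K: "real K > 196 * M" using reals_Archimedean2 by blast
    obtain I where I: "finite I" "card I = K" "I \<subseteq> {n\<in>?X. Re (circle_char (int n) \<kappa>) < 1 / 2}"
      using infinite_arbitrarily_large[OF inf] by blast
    obtain N where N: "\<And>n. n \<in> I \<Longrightarrow> n \<le> N" using I(1) unfolding finite_nat_set_iff_bounded_le by blast
    have "M < real K / 196" using K by simp
    also have "\<dots> = (\<Sum>n\<in>I. 1 / 196)" using I by simp
    also have "\<dots> \<le> (\<Sum>n\<in>I. ?t n)" using I by (intro sum_mono ge) auto
    also have "\<dots> \<le> (\<Sum>n=1..N. ?t n)" using I N by (intro sum_mono2) auto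
    finally show "\<exists>N. M < (\<Sum>n=1..N. ?t n)" by blast
  qed
  show ?thesis unfolding AE_lborel_iff_negligible
    by (rule negligible_subset[OF lacunary_negligible[OF irrational_good_frequencies[OF irr]]]) (use gen in blast)
qed

lemma generic_pair_nat:
  "generic_pair \<theta> \<kappa> \<longleftrightarrow> (\<forall>M::nat. \<exists>N. real M < (\<Sum>n=1..N.
     (norm (circle_char (int n) \<kappa> - 1))\<^sup>2 / ((real n)\<^sup>2 * (norm (circle_char (int n) \<theta> - 1))\<^sup>2)))"
  unfolding generic_pair_def by (meson less_trans reals_Archimedean2)

lemma countable_in_borel: "countable (A :: real set) \<Longrightarrow> A \<in> sets borel"
  by (metis sets_lborel null_setsD2 countable_imp_null_set_lborel)

text \<open>Fubini exchanges the roles: \<open>generic_pair_AE\<close> fixes \<theta>, but in the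
  family \<open>kappa\<close> is fixed by l and L while the rotation number runs with t.\<close>

lemma generic_kappa_AE:
  "AE \<kappa> in lborel. \<kappa> \<in> {0..<1} \<longrightarrow> negligible {\<theta>. \<theta> \<notin> \<rat> \<and> \<not> generic_pair \<theta> \<kappa>}"
proof -
  let ?P = "\<lambda>\<theta> \<kappa>. \<theta> \<notin> \<rat> \<longrightarrow> \<kappa> \<in> {0..<1} \<longrightarrow> generic_pair \<theta> \<kappa>"
  have [measurable]: "(\<rat> :: real set) \<in> sets borel" by (rule countable_in_borel) (rule countable_rat)
  have "{x \<in> space (lborel \<Otimes>\<^sub>M lborel). ?P (fst x) (snd x)} \<in> sets (lborel \<Otimes>\<^sub>M lborel)"
    unfolding generic_pair_nat by measurable
  moreover have "AE \<theta> in lborel. AE \<kappa> in lborel. ?P \<theta> \<kappa>"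
  proof (rule AE_I2)
    fix \<theta> :: real
    show "AE \<kappa> in lborel. ?P \<theta> \<kappa>"
    proof (cases "\<theta> \<in> \<rat>")
      case False then show ?thesis using generic_pair_AE[OF False] by eventually_elim auto
    qed simp
  qed
  ultimately have "AE \<kappa> in lborel. AE \<theta> in lborel. ?P \<theta> \<kappa>"
    by (subst lborel_pair.AE_commute[symmetric]) auto
  then show ?thesis
    by eventually_elim (auto simp: AE_lborel_iff_negligible)
qed

section \<open>Pulling null sets back through functions of positive derivative\<close>

lemma negligible_preimage_pos_deriv:
  fixes f :: "real \<Rightarrow> real"
  assumes der: "\<And>x. u < x \<Longrightarrow> x < v \<Longrightarrow> (f has_real_derivative f' x) (at x)"
    and pos: "\<And>x. u < x \<Longrightarrow> x < v \<Longrightarrow> f' x > 0" and N: "negligible N"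
  shows "negligible {x. u < x \<and> x < v \<and> f x \<in> N}"
proof -
  have mono: "mono_on {u<..<v} f"
  proof (rule mono_onI)
    fix x y assume xy: "x \<in> {u<..<v}" "y \<in> {u<..<v}" "x \<le> y"
    show "f x \<le> f y"
    proof (rule DERIV_nonneg_imp_nondecreasing[OF xy(3)])
      fix z assume "x \<le> z" "z \<le> y"
      then show "\<exists>d. (f has_real_derivative d) (at z) \<and> d \<ge> 0" using der[of z] pos[of z] xy by force
    qed
  qed
  \<comment> \<open>Where the derivative exceeds 1 / (j + 1), short intervals to the right of x are
    expanded by that factor, so \<open>expanding_cover\<close> applies with neighbourhoods of
    \<open>N\<close> of small measure.\<close>
  have n: "negligible {x. u < x \<and> x < v \<and> f x \<in> N \<and> f' x > 1 / real (Suc j)}" (is "negligible ?E") for j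
    unfolding negligible_outer_le
  proof (intro allI impI)
    fix e :: real assume e: "e > 0"
    define K where "K = 1 / real (Suc j)"
    have K: "K > 0" by (simp add: K_def)
    obtain U where U: "open U" "N \<subseteq> U" "U \<in> lmeasurable" "measure lebesgue U < e * K"
      using negligible_outer_open[OF N, of "e * K"] e K by auto
    obtain T where T: "?E \<subseteq> T" "T \<in> lmeasurable" "measure lebesgue T \<le> measure lebesgue U / K"
    proof (rule expanding_cover[OF mono K U(3), of ?E])
      fix x d :: real assume x: "x \<in> ?E" and d: "d > 0"
      have xuv: "u < x" "x < v" "f x \<in> U" "f' x > K" using x U by (auto simp: K_def)
      have lim: "((\<lambda>y. (f y - f x) / (y - x)) \<longlongrightarrow> f' x) (at x)"
        using der[OF xuv(1,2)] by (simp add: has_field_derivative_iff)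
      then have ev1: "\<forall>\<^sub>F y in at_right x. K < (f y - f x) / (y - x)"
        using order_tendstoD(1)[OF lim xuv(4)] by (simp add: eventually_at_split)
      have "isCont f x" using der[OF xuv(1,2)] by (rule DERIV_isCont)
      then have "(f \<longlongrightarrow> f x) (at x)" by (simp add: isCont_def)
      obtain r where r: "r > 0" "ball (f x) r \<subseteq> U" using U(1) xuv(3) openE by blast
      have "\<forall>\<^sub>F y in at x. dist (f y) (f x) < r" using \<open>(f \<longlongrightarrow> f x) (at x)\<close> r(1) by (rule tendstoD)
      then have ev2: "\<forall>\<^sub>F y in at_right x. dist (f y) (f x) < r" by (simp add: eventually_at_split)
      have "\<forall>\<^sub>F y in at_right x. y \<in> {x<..<min v (x + d)}"
        using xuv d by (intro eventually_at_right_real) auto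
      then have "\<forall>\<^sub>F y in at_right x. y \<in> {x<..<min v (x + d)} \<and> dist (f y) (f x) < r \<and> K < (f y - f x) / (y - x)"
        using ev1 ev2 by eventually_elim auto
      then obtain y where y: "y \<in> {x<..<min v (x + d)}" "dist (f y) (f x) < r" "K < (f y - f x) / (y - x)"
        using eventually_happens'[OF trivial_limit_at_right_real] by blast
      have "K * (y - x) \<le> f y - f x" using y by (simp add: field_simps)
      moreover have "{f x..f y} \<subseteq> U"
      proof
        fix z assume "z \<in> {f x..f y}"
        then have "z \<in> ball (f x) r" using y(2) by (auto simp: dist_real_def)
        then show "z \<in> U" using r by blast
      qed
      ultimately show "\<exists>a b. a \<in> {u<..<v} \<and> b \<in> {u<..<v} \<and> a < b \<and> b - a < d \<and> a \<le> x \<and> x \<le> b \<and>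
          K * (b - a) \<le> f b - f a \<and> {f a..f b} \<subseteq> U"
        using y xuv by (intro exI[of _ x] exI[of _ y]) auto
    qed
    have "measure lebesgue U / K \<le> e" using U K by (simp add: field_simps)
    then show "\<exists>T. ?E \<subseteq> T \<and> T \<in> lmeasurable \<and> measure lebesgue T \<le> e" using T by auto
  qed
  have "{x. u < x \<and> x < v \<and> f x \<in> N} \<subseteq> (\<Union>j. {x. u < x \<and> x < v \<and> f x \<in> N \<and> f' x > 1 / real (Suc j)})"
    using pos reals_Archimedean by (fastforce simp: inverse_eq_divide)
  moreover have "negligible \<dots>" by (intro negligible_countable_Union) (use n in auto)
  ultimately show ?thesis by (rule negligible_subset[rotated])
qed


section \<open>Generic parameters\<close>

context pl_family
begin

lemma lam_mu_balance: "lam * l + mu * (1 - l) = 1"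
  using l by (simp add: lam_def mu_def)

text \<open>The slopes have weighted mean 1, so if they differ they lie on opposite sides of 1 and
  their logarithms have opposite signs.\<close>

lemma kappa_range:
  assumes "lam \<noteq> mu" shows "0 < kappa" "kappa < 1"
proof -
  have b: "(lam - 1) * l = (1 - mu) * (1 - l)" using lam_mu_balance by (simp add: algebra_simps)
  have "lam > 1 \<and> mu < 1 \<or> lam < 1 \<and> mu > 1"
  proof (cases "lam > 1")
    case True
    then have "0 < (1 - mu) * (1 - l)" using l by (simp add: b[symmetric])
    then show ?thesis using True l by (simp add: zero_less_mult_iff)
  next
    case False
    show ?thesis
    proof (cases "lam = 1")
      case True
      then have "mu = 1" using b l by simp
      then show ?thesis using True assms by simp
    next
      case False
      then have "0 > (1 - mu) * (1 - l)" using l \<open>\<not> lam > 1\<close> by (simp add: b[symmetric] mult_less_0_iff)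
      then show ?thesis using False l \<open>\<not> lam > 1\<close> by (simp add: mult_less_0_iff)
    qed
  qed
  then have "ln lam > 0 \<and> ln mu < 0 \<or> ln lam < 0 \<and> ln mu > 0" using lam_pos mu_pos by auto
  then show "0 < kappa" "kappa < 1" unfolding kappa_def by (auto simp: divide_simps)
qed

lemma lam_eq_mu_iff: "lam = mu \<longleftrightarrow> L = l"
  using l L by (auto simp: lam_def mu_def divide_simps algebra_simps)

end

definition pl_kappa :: "real \<Rightarrow> real \<Rightarrow> real" where
  "pl_kappa l L = - ln ((1 - L) / (1 - l)) / (ln (L / l) - ln ((1 - L) / (1 - l)))"

lemma (in pl_family) kappa_eq: "kappa = pl_kappa l L"
  by (simp add: kappa_def pl_kappa_def lam_def mu_def)

text \<open>The relative entropy of two Bernoulli distributions, positive by ln x <= x - 1 with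
  equality only at x = 1. It appears as the numerator of the derivative of
  \<open>pl_kappa\<close>.\<close>

lemma relative_entropy_pos:
  fixes l L :: real
  assumes "0 < l" "l < 1" "0 < L" "L < 1" "L \<noteq> l"
  shows "L * ln (L / l) + (1 - L) * ln ((1 - L) / (1 - l)) > 0"
proof -
  have "ln (l / L) < l / L - 1"
    using assms ln_le_minus_one[of "l / L"] ln_eq_minus_one[of "l / L"] by fastforce
  then have "L * ln (l / L) < L * (l / L - 1)" using assms by (intro mult_strict_left_mono) auto
  also have "\<dots> = l - L" using assms by (simp add: algebra_simps)
  finally have 1: "L * ln (L / l) > L - l" using assms by (simp add: ln_div algebra_simps)
  have "ln ((1 - l) / (1 - L)) \<le> (1 - l) / (1 - L) - 1"
    using assms by (intro ln_le_minus_one) auto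
  then have "(1 - L) * ln ((1 - l) / (1 - L)) \<le> (1 - L) * ((1 - l) / (1 - L) - 1)" using assms by (intro mult_left_mono) auto
  also have "c * (X / c - 1) = X - c" if "c \<noteq> 0" for c X :: real using that by (simp add: right_diff_distrib)
  from this[of "1 - L" "1 - l"] have "(1 - L) * ((1 - l) / (1 - L) - 1) = L - l" using assms by simp
  finally have 2: "(1 - L) * ln ((1 - L) / (1 - l)) \<ge> l - L" using assms by (simp add: ln_div algebra_simps)
  show ?thesis using 1 2 by linarith
qed

text \<open>With a = ln lam and b = - ln mu, \<open>pl_kappa\<close> is b / (a + b). The quotient
  rule leaves (L a - (1 - L) b) / (L (1 - L)) over (a + b)^2, and L a - (1 - L) b is the relative
  entropy.\<close>

lemma pl_kappa_deriv_pos: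
  assumes "0 < l" "l < 1" "0 < L" "L < 1" "L \<noteq> l"
  shows "\<exists>d>0. (pl_kappa l has_real_derivative d) (at L)"
proof -
  interpret pl_family l L by unfold_locales (use assms in auto)
  define a where "a = ln (L / l)"
  define b where "b = - ln ((1 - L) / (1 - l))"
  have "ln lam \<noteq> ln mu" using lam_eq_mu_iff assms lam_pos mu_pos by simp
  then have ab: "a + b \<noteq> 0" unfolding a_def b_def lam_def mu_def by simp
  have da: "((\<lambda>L. ln (L / l)) has_real_derivative 1 / L) (at L)"
    using assms by (auto intro!: derivative_eq_intros simp: field_simps)
  have "((\<lambda>L. (1 - L) / (1 - l)) has_real_derivative - 1 / (1 - l)) (at L)"
    by (rule DERIV_cdivide) (auto intro!: derivative_eq_intros)
  from DERIV_minus[OF DERIV_chain2[OF DERIV_ln this]]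
  have A: "((\<lambda>L. - ln ((1 - L) / (1 - l))) has_real_derivative - (inverse ((1 - L) / (1 - l)) * (- 1 / (1 - l)))) (at L)"
    using assms by auto
  have inv: "- (inverse (c / d) * (- 1 / d)) = 1 / c" if "c \<noteq> 0" "d \<noteq> 0" for c d :: real
    using that by (simp add: field_simps)
  have B: "- (inverse ((1 - L) / (1 - l)) * (- 1 / (1 - l))) = 1 / (1 - L)" by (rule inv) (use assms in auto)
  have db: "((\<lambda>L. - ln ((1 - L) / (1 - l))) has_real_derivative 1 / (1 - L)) (at L)"
    using A unfolding B .
  have ab': "ln (L / l) - ln ((1 - L) / (1 - l)) \<noteq> 0" using ab by (simp add: a_def b_def)
  have fr: "1 / M * (a + b) - b * (1 / L + 1 / M) = (L * a - M * b) / (L * M)" if "M \<noteq> 0" "L \<noteq> 0" for M L :: real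
    using that by (simp add: field_simps)
  have "(pl_kappa l has_real_derivative (1 / (1 - L) * (a + b) - b * (1 / L + 1 / (1 - L))) / ((a + b) * (a + b))) (at L)"
    unfolding pl_kappa_def[abs_def]
    using DERIV_divide[OF db DERIV_add[OF da db]] ab' by (simp add: a_def b_def)
  moreover have "1 / (1 - L) * (a + b) - b * (1 / L + 1 / (1 - L)) = (L * a - (1 - L) * b) / (L * (1 - L))"
    by (rule fr) (use assms in auto)
  moreover have "L * a - (1 - L) * b > 0" using relative_entropy_pos[OF assms] by (simp add: a_def b_def)
  ultimately show ?thesis using assms ab
    by (intro exI conjI) (auto intro!: divide_pos_pos simp: zero_less_mult_iff linorder_neq_iff)
qed

lemma pl_kappa_preimage_negligible:
  assumes l: "0 < l" "l < 1" and N: "negligible N"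
  shows "negligible {L. 0 < L \<and> L < 1 \<and> L \<noteq> l \<and> pl_kappa l L \<in> N}"
proof -
  obtain d where d: "\<And>L. 0 < L \<Longrightarrow> L < 1 \<Longrightarrow> L \<noteq> l \<Longrightarrow> d L > 0 \<and> (pl_kappa l has_real_derivative d L) (at L)"
    using pl_kappa_deriv_pos[OF l] by metis
  have "negligible {L. 0 < L \<and> L < l \<and> pl_kappa l L \<in> N}" "negligible {L. l < L \<and> L < 1 \<and> pl_kappa l L \<in> N}"
    by (rule negligible_preimage_pos_deriv[of _ _ _ d, OF _ _ N]; use d l in force)+
  then have "negligible ({L. 0 < L \<and> L < l \<and> pl_kappa l L \<in> N} \<union> {L. l < L \<and> L < 1 \<and> pl_kappa l L \<in> N})"
    by (rule negligible_Un)
  then show ?thesis by (rule negligible_subset) auto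
qed

text \<open>The family \<open>F t\<close> as an explicit function of all parameters outside the
  locale, so that measurability in (l, L, t) can be stated.\<close>

definition pl_map :: "real \<Rightarrow> real \<Rightarrow> real \<Rightarrow> real \<Rightarrow> real" where
  "pl_map l L t x = L / l * (l * of_int \<lfloor>x\<rfloor> + min (frac x) l)
     + (1 - L) / (1 - l) * (x - (l * of_int \<lfloor>x\<rfloor> + min (frac x) l)) + t"

lemma (in pl_family) F_eq: "F t = pl_map l L t"
  by (rule ext) (simp add: F_def H_def A_def lam_def mu_def pl_map_def)

text \<open>The last clause says that there is a periodic point (see \<open>periodic_point_approx_iff\<close> below);
  quantifying over rational points only makes it visibly measurable.\<close>

definition generic_params :: "real \<Rightarrow> real \<Rightarrow> real \<Rightarrow> bool" where
  "generic_params l L t \<longleftrightarrow> (0 < l \<and> l < 1 \<and> 0 < L \<and> L < 1 \<longrightarrow>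
     L \<noteq> l \<and> pl_kappa l L \<notin> \<rat> \<and>
     (\<forall>q>0. \<forall>p. (pl_map l L t ^^ q) 0 \<noteq> of_int p \<and> (pl_map l L t ^^ q) l \<noteq> l + of_int p) \<and>
     (\<exists>q>0. \<exists>p. \<forall>k. \<exists>u\<in>\<rat>. \<bar>(pl_map l L t ^^ q) u - u - of_int p\<bar> < 1 / real (Suc k)))"

text \<open>Rational approximation is continuity; conversely, without a periodic point
  \<open>displacement_away\<close> keeps the displacement uniformly away from p.\<close>

lemma (in lift_map) periodic_point_approx_iff:
  "(\<exists>x. (F ^^ q) x = x + of_int p) \<longleftrightarrow> (\<forall>k. \<exists>u\<in>\<rat>. \<bar>(F ^^ q) u - u - of_int p\<bar> < 1 / real (Suc k))"
proof
  assume "\<exists>x. (F ^^ q) x = x + of_int p"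
  then obtain x where x: "(F ^^ q) x = x + of_int p" by blast
  show "\<forall>k. \<exists>u\<in>\<rat>. \<bar>(F ^^ q) u - u - of_int p\<bar> < 1 / real (Suc k)"
  proof
    fix k
    have "isCont (\<lambda>u. (F ^^ q) u - u - of_int p) x"
      using funpow_cont by (auto intro!: continuous_intros simp: continuous_on_eq_continuous_at)
    then have "((\<lambda>u. (F ^^ q) u - u - of_int p) \<longlongrightarrow> 0) (at x)" using x by (simp add: isCont_def)
    then have "\<forall>\<^sub>F u in at x. dist ((F ^^ q) u - u - of_int p) 0 < 1 / real (Suc k)"
      by (rule tendstoD) simp
    then obtain d where d: "d > 0" "\<And>u. u \<noteq> x \<Longrightarrow> dist u x < d \<Longrightarrow> dist ((F ^^ q) u - u - of_int p) 0 < 1 / real (Suc k)"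
      unfolding eventually_at by blast
    obtain u where u: "u \<in> \<rat>" "x < u" "u < x + d" using Rats_dense_in_real[of x "x + d"] d by auto
    then show "\<exists>u\<in>\<rat>. \<bar>(F ^^ q) u - u - of_int p\<bar> < 1 / real (Suc k)"
      using d(2)[of u] by (auto simp: dist_real_def)
  qed
next
  assume app: "\<forall>k. \<exists>u\<in>\<rat>. \<bar>(F ^^ q) u - u - of_int p\<bar> < 1 / real (Suc k)"
  show "\<exists>x. (F ^^ q) x = x + of_int p"
  proof (rule ccontr)
    assume "\<not> ?thesis"
    then have "(F ^^ q) x \<noteq> x + of_int p" for x by blast
    then obtain e where e: "e > 0" "\<And>x. \<bar>(F ^^ q) x - x - of_int p\<bar> \<ge> e"
      using lift_map.displacement_away[OF funpow_lift, of q "of_int p"] by blast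
    obtain k where "1 / real (Suc k) < e" using reals_Archimedean[OF e(1)] by (auto simp: inverse_eq_divide)
    then show False using app e(2) by (meson less_trans not_le)
  qed
qed

lemma countable_imp_negligible: "countable A \<Longrightarrow> negligible (A :: real set)"
  unfolding negligible_iff_null_sets by (intro null_sets_completionI countable_imp_null_set_lborel)

lemma generic_params_AE:
  assumes l: "0 < l" "l < 1"
  shows "AE L in lborel. AE t in lborel. generic_params l L t"
proof -
  \<comment> \<open>The first set makes \<open>aperiodic_negligible\<close> fail to apply; the
    rationals are the values for which the logarithms of the slopes are rationally related.\<close>
  define N where "N = {\<kappa>. \<not> (\<kappa> \<in> {0..<1} \<longrightarrow> negligible {\<theta>. \<theta> \<notin> \<rat> \<and> \<not> generic_pair \<theta> \<kappa>})} \<union> \<rat>"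
  have "negligible N" unfolding N_def
    using generic_kappa_AE countable_rat by (auto simp: AE_lborel_iff_negligible intro!: negligible_Un countable_imp_negligible)
  then have "negligible ({L. 0 < L \<and> L < 1 \<and> L \<noteq> l \<and> pl_kappa l L \<in> N} \<union> {l})"
    by (intro negligible_Un pl_kappa_preimage_negligible l) auto
  then have "AE L in lborel. L \<notin> {L. 0 < L \<and> L < 1 \<and> L \<noteq> l \<and> pl_kappa l L \<in> N} \<union> {l}"
    unfolding AE_lborel_iff_negligible by (simp only: not_not Collect_mem_eq)
  then show ?thesis
  proof eventually_elim
    case (elim L)
    show ?case
    proof (cases "0 < L \<and> L < 1")
      case False
      then have "generic_params l L t" for t by (auto simp: generic_params_def)
      then show ?thesis by simp
    next
      case True
      then interpret pl_family l L by unfold_locales (use l in auto)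
      have Ll: "L \<noteq> l" and kN: "kappa \<notin> N" using elim True by (auto simp: kappa_eq)
      have ne: "lam \<noteq> mu" using Ll lam_eq_mu_iff by simp
      have ap: "negligible {t. aperiodic t}"
        using kN kappa_range[OF ne] by (intro aperiodic_negligible ne) (auto simp: N_def)
      define Z where "Z = (\<Union>q\<in>{0<..}. \<Union>p::int. {t. (F t ^^ q) 0 = of_int p} \<union> {t. (F t ^^ q) l = l + of_int p})"
      \<comment> \<open>Iterates increase strictly with t, so each of the countably many ways in
        which a break point can be periodic occurs for at most one t.\<close>
      have inj: "finite {t. (F t ^^ q) x = y}" if "q > 0" for q x y
      proof -
        have "t = s" if "(F t ^^ q) x = y" "(F s ^^ q) x = y" for s t
          using F_iterate_diff[of s t q x] F_iterate_diff[of t s q x] that \<open>q > 0\<close> by linarith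
        then have "{t. (F t ^^ q) x = y} \<subseteq> {t} \<or> {t. (F t ^^ q) x = y} = {}" if "(F t ^^ q) x = y" for t using that by blast
        then show ?thesis by (metis (mono_tags, lifting) empty_Collect_eq finite.emptyI finite.insertI finite_subset)
      qed
      have "countable Z" unfolding Z_def
        by (intro countable_UN countable_Un countableI_type countable_finite[OF inj]) auto
      then have "negligible ({t. aperiodic t} \<union> Z)" by (intro negligible_Un[OF ap] countable_imp_negligible)
      then have "AE t in lborel. t \<notin> {t. aperiodic t} \<union> Z"
        unfolding AE_lborel_iff_negligible by (simp only: not_not Collect_mem_eq)
      then show ?thesis
      proof eventually_elim
        case (elim t)
        obtain q p x where q: "q > 0" "(F t ^^ q) x = x + of_int p" using elim by (auto simp: aperiodic_def)
        then have "\<forall>k. \<exists>u\<in>\<rat>. \<bar>(F t ^^ q) u - u - of_int p\<bar> < 1 / real (Suc k)"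
          using F.periodic_point_approx_iff by blast
        then have 1: "\<exists>q>0. \<exists>p. \<forall>k. \<exists>u\<in>\<rat>. \<bar>(F t ^^ q) u - u - of_int p\<bar> < 1 / real (Suc k)" using q by blast
        have 2: "\<forall>q>0. \<forall>p. (F t ^^ q) 0 \<noteq> of_int p \<and> (F t ^^ q) l \<noteq> l + of_int p" using elim by (auto simp: Z_def)
        have 3: "kappa \<notin> \<rat>" using kN by (auto simp: N_def)
        show ?case unfolding generic_params_def using 1 2 3 Ll unfolding F_eq kappa_eq by blast
      qed
    qed
  qed
qed

lemma pl_map_measurable [measurable (raw)]:
  assumes [measurable]: "l \<in> borel_measurable M" "L \<in> borel_measurable M" "t \<in> borel_measurable M" "x \<in> borel_measurable M"
  shows "(\<lambda>w. pl_map (l w) (L w) (t w) (x w)) \<in> borel_measurable M"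
  unfolding pl_map_def frac_def by measurable

lemma pl_map_funpow_measurable [measurable (raw)]:
  assumes [measurable]: "l \<in> borel_measurable M" "L \<in> borel_measurable M" "t \<in> borel_measurable M" "x \<in> borel_measurable M"
  shows "(\<lambda>w. (pl_map (l w) (L w) (t w) ^^ n) (x w)) \<in> borel_measurable M"
proof (induction n)
  case (Suc n)
  note [measurable] = Suc
  show ?case by simp
qed simp

lemma generic_params_measurable [measurable (raw)]:
  assumes [measurable]: "l \<in> borel_measurable M" "L \<in> borel_measurable M" "t \<in> borel_measurable M"
  shows "Measurable.pred M (\<lambda>w. generic_params (l w) (L w) (t w))"
proof -
  have [measurable]: "(\<rat> :: real set) \<in> sets borel" by (rule countable_in_borel) (rule countable_rat)
  have rat: "(\<exists>u\<in>\<rat>. P u) \<longleftrightarrow> (\<exists>r::rat. P (of_rat r))" for P :: "real \<Rightarrow> bool"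
    unfolding Rats_def by blast
  show ?thesis
    unfolding generic_params_def rat pl_kappa_def by measurable
qed

lemma generic_params_AE_4:
  "AE (x1, x2, y1, y2) in lborel. generic_params (frac (x2 - x1)) (frac (y2 - y1)) (y1 - x1)"
proof -
  \<comment> \<open>In the coordinates of the family y1 is fixed before y2, hence t before L;
    \<open>generic_params_AE\<close> has the opposite order of quantifiers.\<close>
  have AEt: "AE t in lborel. AE L in lborel. generic_params l L t" for l
  proof (cases "0 < l \<and> l < 1")
    case True
    then have "AE L in lborel. AE t in lborel. generic_params l L t" by (intro generic_params_AE) auto
    moreover have "Measurable.pred (lborel \<Otimes>\<^sub>M lborel) (\<lambda>z. generic_params l (snd z) (fst z))" by measurable
    ultimately show ?thesis
      using lborel_pair.AE_commute[of "\<lambda>t L. generic_params l L t", OF predE] by simp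
  next
    case False
    then have "generic_params l L t" for L t by (auto simp: generic_params_def)
    then show ?thesis by simp
  qed
  have sh: "AE y in lborel. P (y - a)" if "AE t in lborel. P t" for P and a :: real
  proof -
    have "negligible ((+) a ` {t. \<not> P t})" using that by (intro negligible_translation) (simp add: AE_lborel_iff_negligible)
    moreover have "(+) a ` {t. \<not> P t} = {y. \<not> P (y - a)}" by (force simp: image_iff)
    ultimately show ?thesis by (simp add: AE_lborel_iff_negligible)
  qed
  \<comment> \<open>\<open>frac\<close> is at each point a translation by some integer, and
    countably many null sets are excluded together.\<close>
  have fr: "AE y in lborel. P (frac y)" if "AE t in lborel. P t" for P :: "real \<Rightarrow> bool"
  proof -
    have "AE y in lborel. P (y - of_int m)" for m by (rule sh[OF that])
    then have "AE y in lborel. \<forall>m. P (y - of_int m)" by (simp add: AE_all_countable)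
    then show ?thesis by eventually_elim (simp add: frac_def)
  qed
  have *: "AE y1 in lborel. AE y2 in lborel. generic_params l (frac (y2 - y1)) (y1 - a)" for l a
    using sh[OF AEt[of l], of a]
  proof eventually_elim
    case (elim y1)
    show ?case by (rule sh[OF fr[OF elim]])
  qed
  let ?P = "\<lambda>x1 x2 y1 y2. generic_params (frac (x2 - x1)) (frac (y2 - y1)) (y1 - x1)"
  have [measurable]: "frac \<in> borel_measurable (borel :: real measure)" unfolding frac_def[abs_def] by measurable
  have 1: "AE z in lborel \<Otimes>\<^sub>M lborel. ?P x1 x2 (fst z) (snd z)" for x1 x2
  proof (rule lborel_pair.AE_pair_measure)
    show "{z \<in> space (lborel \<Otimes>\<^sub>M lborel). ?P x1 x2 (fst z) (snd z)} \<in> sets (lborel \<Otimes>\<^sub>M lborel)"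
      by (intro predE) measurable
  qed (use * in simp)
  have 2: "AE z in lborel \<Otimes>\<^sub>M lborel. ?P x1 (fst z) (fst (snd z)) (snd (snd z))" for x1
  proof -
    have "AE z in (lborel \<Otimes>\<^sub>M lborel). (\<lambda>z. ?P x1 (fst z) (fst (snd z)) (snd (snd z))) z"
    proof (rule lborel_pair.AE_pair_measure)
      show "{z \<in> space (lborel \<Otimes>\<^sub>M lborel). ?P x1 (fst z) (fst (snd z)) (snd (snd z))} \<in> sets (lborel \<Otimes>\<^sub>M lborel)"
      proof -
        have "Measurable.pred borel (\<lambda>z. ?P x1 (fst z) (fst (snd z)) (snd (snd z)))"
          unfolding borel_prod[symmetric] by measurable
        from predE[OF this] show ?thesis unfolding lborel_prod by simp
      qed
      show "AE x in lborel. AE y in lborel. ?P x1 (fst (x, y)) (fst (snd (x, y))) (snd (snd (x, y)))"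
        using 1[unfolded lborel_prod] by simp
    qed
    then show ?thesis .
  qed
  have "AE z in lborel \<Otimes>\<^sub>M lborel. ?P (fst z) (fst (snd z)) (fst (snd (snd z))) (snd (snd (snd z)))"
  proof (rule lborel_pair.AE_pair_measure)
    show "{z \<in> space (lborel \<Otimes>\<^sub>M lborel). ?P (fst z) (fst (snd z)) (fst (snd (snd z))) (snd (snd (snd z)))} \<in> sets (lborel \<Otimes>\<^sub>M lborel)"
    proof -
      have "Measurable.pred borel (\<lambda>z. ?P (fst z) (fst (snd z)) (fst (snd (snd z))) (snd (snd (snd z))))"
        unfolding borel_prod[symmetric] by measurable
      from predE[OF this] show ?thesis unfolding lborel_prod by simp
    qed
    show "AE x in lborel. AE y in lborel. ?P (fst (x, y)) (fst (snd (x, y))) (fst (snd (snd (x, y)))) (snd (snd (snd (x, y))))"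
      using 2[unfolded lborel_prod] by simp
  qed
  then show ?thesis unfolding lborel_prod by (simp add: case_prod_beta)
qed


section \<open>A criterion for Morse-Smale circle maps\<close>

lemma to_circle_add_int [simp]: "to_circle (x + of_int m) = to_circle x"
  by (simp add: to_circle_eq_iff)

lemma to_circle_frac [simp]: "to_circle (frac x) = to_circle x"
  by (simp add: to_circle_eq_iff frac_def)

lemma circle_cases: obtains x where "c = to_circle x" "0 \<le> x" "x < 1"
proof -
  obtain y where "c = to_circle y" by (metis Quotient3_circle Quotient3_abs_rep)
  then show thesis using that[of "frac y"] by (simp add: frac_lt_1)
qed

lemma continuous_to_circle: "continuous_on UNIV to_circle"
  by (simp add: continuous_on_open_vimage open_circle_def)

lemma open_to_circle_image:
  assumes "open U" shows "open (to_circle ` U)"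
proof -
  have "to_circle -` (to_circle ` U) = (\<Union>m::int. (+) (of_int m) ` U)"
  proof (intro equalityI subsetI)
    fix x assume "x \<in> to_circle -` (to_circle ` U)"
    then obtain u where u: "u \<in> U" "x - u \<in> \<int>" by (auto simp: to_circle_eq_iff)
    then obtain m where "x - u = of_int m" by (auto elim: Ints_cases)
    then have "x = of_int m + u" by simp
    then show "x \<in> (\<Union>m::int. (+) (of_int m) ` U)" using u by blast
  next
    fix x assume "x \<in> (\<Union>m::int. (+) (of_int m) ` U)"
    then obtain m u where "u \<in> U" "x = u + of_int m" by (auto simp: add.commute)
    then show "x \<in> to_circle -` (to_circle ` U)" by auto
  qed
  moreover have "open \<dots>" using assms by (intro open_UN ballI open_translation)
  ultimately show ?thesis by (simp add: open_circle_def)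
qed

instance circle :: t2_space
proof
  fix c d :: circle assume "c \<noteq> d"
  obtain x where x: "c = to_circle x" by (rule circle_cases)
  obtain y where y: "d = to_circle y" by (rule circle_cases)
  \<comment> \<open>Twice e is the distance of x - y from the integers.\<close>
  define e where "e = min (frac (x - y)) (1 - frac (x - y)) / 2"
  have "x - y \<notin> \<int>" using \<open>c \<noteq> d\<close> x y by (simp add: to_circle_eq_iff)
  then have "frac (x - y) > 0" by (simp add: frac_gt_0_iff)
  then have e: "e > 0" using frac_lt_1[of "x - y"] by (simp add: e_def)
  have "to_circle ` ball x e \<inter> to_circle ` ball y e = {}"
  proof (rule ccontr)
    assume "to_circle ` ball x e \<inter> to_circle ` ball y e \<noteq> {}"
    then obtain u v where uv: "u \<in> ball x e" "v \<in> ball y e" "u - v \<in> \<int>" by (auto simp: to_circle_eq_iff)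
    then obtain m where m: "u - v = of_int m" by (auto elim: Ints_cases)
    have "\<bar>x - u\<bar> < e" "\<bar>y - v\<bar> < e" using uv by (auto simp: dist_real_def)
    then have "\<bar>(x - y) - of_int m\<bar> < 2 * e" using m by linarith
    then have *: "\<bar>(x - y) - of_int m\<bar> < frac (x - y)" "\<bar>(x - y) - of_int m\<bar> < 1 - frac (x - y)" by (auto simp: e_def)
    then have "real_of_int \<lfloor>x - y\<rfloor> < of_int m" "real_of_int m < of_int (\<lfloor>x - y\<rfloor> + 1)" unfolding frac_def by linarith+
    then have "\<lfloor>x - y\<rfloor> < m" "m < \<lfloor>x - y\<rfloor> + 1" by (simp_all only: of_int_less_iff)
    then show False by simp
  qed
  then show "\<exists>U V. open U \<and> open V \<and> c \<in> U \<and> d \<in> V \<and> U \<inter> V = {}"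
    using e x y open_to_circle_image[OF open_ball] by (intro exI[of _ "to_circle ` ball x e"] exI[of _ "to_circle ` ball y e"]) auto
qed

lemma tendsto_to_circle: "(X \<longlongrightarrow> x) A \<Longrightarrow> ((\<lambda>n. to_circle (X n)) \<longlongrightarrow> to_circle x) A"
  using continuous_on_tendsto_compose[OF continuous_to_circle] by simp

section \<open>Orbits converging to periodic orbits\<close>

definition orbit :: "('a \<Rightarrow> 'a) \<Rightarrow> 'a \<Rightarrow> 'a set" where
  "orbit f e = {(f ^^ k) e |k. True}"

lemma funpow_mult_fixed: "(f ^^ q) e = e \<Longrightarrow> (f ^^ (q * k)) e = e"
proof (induction k)
  case (Suc k)
  have "(f ^^ (q * Suc k)) e = (f ^^ q) ((f ^^ (q * k)) e)" by (simp add: funpow_add)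
  then show ?case using Suc by simp
qed simp

lemma funpow_mod_fixed: "(f ^^ q) e = e \<Longrightarrow> (f ^^ k) e = (f ^^ (k mod q)) e"
proof -
  assume a: "(f ^^ q) e = e"
  have "(f ^^ k) e = (f ^^ (k mod q + q * (k div q))) e" by simp
  also have "\<dots> = (f ^^ (k mod q)) e" by (simp only: funpow_add comp_apply funpow_mult_fixed[OF a])
  finally show ?thesis .
qed

lemma orbit_eq_image: "(f ^^ q) e = e \<Longrightarrow> q > 0 \<Longrightarrow> orbit f e = (\<lambda>j. (f ^^ j) e) ` {..<q}"
proof (intro equalityI subsetI)
  fix x assume a: "(f ^^ q) e = e" "q > 0" and "x \<in> orbit f e"
  then obtain k where "x = (f ^^ k) e" by (auto simp: orbit_def)
  then have "x = (f ^^ (k mod q)) e" using funpow_mod_fixed[OF a(1)] by simp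
  then show "x \<in> (\<lambda>j. (f ^^ j) e) ` {..<q}" using a(2) by auto
qed (auto simp: orbit_def)

lemma orbit_shift: "(f ^^ q) e = e \<Longrightarrow> q > 0 \<Longrightarrow> orbit f ((f ^^ j) e) = orbit f e"
proof
  assume a: "(f ^^ q) e = e" "q > 0"
  show "orbit f ((f ^^ j) e) \<subseteq> orbit f e" by (auto simp: orbit_def) (metis comp_apply funpow_add)
  show "orbit f e \<subseteq> orbit f ((f ^^ j) e)"
  proof
    fix x assume "x \<in> orbit f e"
    then obtain k where x: "x = (f ^^ k) e" by (auto simp: orbit_def)
    \<comment> \<open>From the j-th iterate, q * j - j further steps complete j full periods and
      lead back to e.\<close>
    have "j \<le> q * j" using a by simp
    then have eq: "k + (q * j - j) + j = k + q * j" by linarith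
    have "(f ^^ (k + (q * j - j))) ((f ^^ j) e) = (f ^^ (k + (q * j - j) + j)) e" by (simp only: funpow_add comp_apply)
    also have "\<dots> = x" unfolding eq x by (simp only: funpow_add comp_apply funpow_mult_fixed[OF a(1)])
    finally show "x \<in> orbit f ((f ^^ j) e)" by (auto simp: orbit_def)
  qed
qed

lemma funpow_continuous:
  fixes f :: "'a::topological_space \<Rightarrow> 'a"
  assumes "continuous_on UNIV f" shows "continuous_on UNIV (f ^^ k)"
proof (induction k)
  case (Suc k) then show ?case using continuous_on_compose2[OF assms Suc] by (simp add: comp_def)
qed (simp add: id_def)

text \<open>Along each residue class j modulo q the iterates converge to the j-th point of the
  orbit. A limit point outside the orbit could be separated from these q points
  simultaneously.\<close>

lemma omega_limit_orbit:
  fixes f :: "'a::t2_space \<Rightarrow> 'a"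
  assumes f: "continuous_on UNIV f" and q: "q > 0" and e: "(f ^^ q) e = e"
    and lim: "(\<lambda>n. (f ^^ (q * n)) c) \<longlonglongrightarrow> e"
  shows "omega_limit f c = orbit f e"
proof
  have lim_j: "(\<lambda>n. (f ^^ (q * n + j)) c) \<longlonglongrightarrow> (f ^^ j) e" for j
  proof -
    have "(\<lambda>n. (f ^^ j) ((f ^^ (q * n)) c)) \<longlonglongrightarrow> (f ^^ j) e"
      using continuous_on_tendsto_compose[OF funpow_continuous[OF f] lim] by simp
    then show ?thesis by (simp add: add.commute funpow_add)
  qed
  show "orbit f e \<subseteq> omega_limit f c"
  proof
    fix y assume "y \<in> orbit f e"
    then obtain j where y: "y = (f ^^ j) e" by (auto simp: orbit_def)
    have "strict_mono (\<lambda>n. q * n + j)" using q by (simp add: strict_mono_def)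
    then show "y \<in> omega_limit f c" unfolding omega_limit_def using lim_j[of j] y by blast
  qed
  show "omega_limit f c \<subseteq> orbit f e"
  proof
    fix y assume "y \<in> omega_limit f c"
    then obtain r where r: "strict_mono r" "(\<lambda>k. (f ^^ r k) c) \<longlonglongrightarrow> y" by (auto simp: omega_limit_def)
    show "y \<in> orbit f e"
    proof (rule ccontr)
      assume "y \<notin> orbit f e"
      then have "\<forall>j. \<exists>U V. open U \<and> open V \<and> y \<in> U \<and> (f ^^ j) e \<in> V \<and> U \<inter> V = {}"
        using hausdorff[of y] by (metis (mono_tags, lifting) mem_Collect_eq orbit_def)
      then obtain U V where UV: "\<And>j. open (U j)" "\<And>j. open (V j)" "\<And>j. y \<in> U j" "\<And>j. (f ^^ j) e \<in> V j" "\<And>j. U j \<inter> V j = {}"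
        by metis
      have "\<forall>\<^sub>F n in sequentially. \<forall>j\<in>{..<q}. (f ^^ (q * n + j)) c \<in> V j"
        using topological_tendstoD[OF lim_j UV(2) UV(4)] by (intro eventually_ball_finite) auto
      then obtain N where N: "\<And>n j. n \<ge> N \<Longrightarrow> j < q \<Longrightarrow> (f ^^ (q * n + j)) c \<in> V j"
        unfolding eventually_sequentially by auto
      have "\<forall>\<^sub>F k in sequentially. (f ^^ r k) c \<in> (\<Inter>j<q. U j)"
        using r(2) UV q by (intro topological_tendstoD) auto
      moreover have "\<forall>\<^sub>F k in sequentially. r k \<ge> q * N"
        using filterlim_subseq[OF r(1)] by (simp add: filterlim_at_top)
      ultimately have "\<forall>\<^sub>F k in sequentially. (f ^^ r k) c \<in> (\<Inter>j<q. U j) \<and> r k \<ge> q * N"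
        by eventually_elim auto
      then obtain k where k: "(f ^^ r k) c \<in> (\<Inter>j<q. U j)" "r k \<ge> q * N"
        using eventually_happens'[OF sequentially_bot] by blast
      have "r k div q \<ge> N" using k(2) q by (metis div_le_mono nonzero_mult_div_cancel_left not_gr_zero)
      then have "(f ^^ (q * (r k div q) + r k mod q)) c \<in> V (r k mod q)" using q by (intro N) auto
      then have "(f ^^ r k) c \<in> V (r k mod q)" by simp
      moreover have "(f ^^ r k) c \<in> U (r k mod q)" using k q by auto
      ultimately show False using UV(5) by blast
    qed
  qed
qed

text \<open>An orbit of an increasing map is monotone, and it stays between two neighbouring integer
  translates of the given fixed point; its limit is fixed by continuity.\<close>

lemma (in lift_map) orbit_converges_to_fixed_point:
  assumes "F x0 = x0"
  obtains z where "F z = z" "(\<lambda>n. (F ^^ n) x) \<longlonglongrightarrow> z"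
proof -
  have fix_shift: "F (x0 + of_int m) = x0 + of_int m" for m using add_int[of x0 m] assms by simp
  have bnd: "x0 + of_int m \<le> x \<Longrightarrow> x0 + of_int m \<le> (F ^^ n) x" "x \<le> x0 + of_int m \<Longrightarrow> (F ^^ n) x \<le> x0 + of_int m" for m n
    by (induction n, auto) (metis fix_shift le_iff)+
  define a where "a = x0 + of_int \<lfloor>x - x0\<rfloor>"
  define b where "b = x0 + of_int (\<lfloor>x - x0\<rfloor> + 1)"
  have "a \<le> x" "x \<le> b" unfolding a_def b_def by linarith+
  then have ab: "a \<le> (F ^^ n) x" "(F ^^ n) x \<le> b" for n unfolding a_def b_def using bnd by blast+
  have "monoseq (\<lambda>n. (F ^^ n) x)"
  proof (cases "x \<le> F x")
    case True
    have "(F ^^ n) x \<le> (F ^^ Suc n) x" for n using True by (induction n) (auto simp: le_iff)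
    then show ?thesis by (intro mono_SucI1) blast
  next
    case False
    have "(F ^^ Suc n) x \<le> (F ^^ n) x" for n using False by (induction n) (auto simp: le_iff)
    then show ?thesis by (intro mono_SucI2) blast
  qed
  moreover have "Bseq (\<lambda>n. (F ^^ n) x)"
    by (intro BseqI'[of _ "\<bar>a\<bar> + \<bar>b\<bar>"]) (use ab in \<open>smt (verit) real_norm_def\<close>)
  ultimately have "convergent (\<lambda>n. (F ^^ n) x)" by (rule Bseq_monoseq_convergent[rotated])
  then obtain z where z: "(\<lambda>n. (F ^^ n) x) \<longlonglongrightarrow> z" by (auto simp: convergent_def)
  have "(\<lambda>n. F ((F ^^ n) x)) \<longlonglongrightarrow> F z" using continuous_on_tendsto_compose[OF cont z] by simp
  then have "(\<lambda>n. (F ^^ Suc n) x) \<longlonglongrightarrow> F z" by simp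
  moreover have "(\<lambda>n. (F ^^ Suc n) x) \<longlonglongrightarrow> z" using LIMSEQ_Suc[OF z] .
  ultimately have "F z = z" by (rule LIMSEQ_unique)
  then show thesis using z by (rule that)
qed

locale periodic_circle_map = lift_map F for F +
  fixes f :: "circle \<Rightarrow> circle" and q :: nat and p :: int
  assumes homeo: "circle_homeo f" and lift: "\<And>x. to_circle (F x) = f (to_circle x)"
    and q: "q > 0" and periodic: "\<exists>x. (F ^^ q) x = x + of_int p"
begin

text \<open>The lift of \<open>f ^^ q\<close> for which the periodic points of type p / q become
  fixed points.\<close>

definition G where "G x = (F ^^ q) x - of_int p"

sublocale G: lift_map G
proof
  show "continuous_on UNIV G" unfolding G_def using funpow_cont by (intro continuous_intros) (auto intro: continuous_on_subset)
  show "strict_mono G" unfolding G_def strict_mono_def by (simp add: funpow_less_iff)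
  show "G (x + 1) = G x + 1" for x unfolding G_def using funpow_add_int[of q x 1] by simp
qed

lemma f_bij: "bij f" and f_cont: "continuous_on UNIV f" and f_inv_homeo: "circle_homeo (inv f)"
  and f_open: "open U \<Longrightarrow> open (f ` U)"
proof -
  obtain g where g: "homeomorphism UNIV UNIV f g" using homeo by (auto simp: circle_homeo_def)
  then have gf: "g (f x) = x" "f (g x) = x" for x by (auto simp: homeomorphism_def)
  then show "bij f" by (metis bijI' )
  show "continuous_on UNIV f" using g by (simp add: homeomorphism_def)
  have "inv f = g" using gf by (intro inv_equality) auto
  then show "circle_homeo (inv f)" using g homeomorphism_sym unfolding circle_homeo_def by blast
  show "open (f ` U)" if "open U" using homeomorphism_imp_open_map[OF g, of U] that by simp
qed

lemma funpow_lift_eq: "(f ^^ n) (to_circle x) = to_circle ((F ^^ n) x)"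
  by (induction n) (auto simp: lift)

lemma G_iterate: "(f ^^ (q * n)) (to_circle x) = to_circle ((G ^^ n) x)"
proof (induction n)
  case (Suc n)
  have "(f ^^ (q * Suc n)) (to_circle x) = (f ^^ q) (to_circle ((G ^^ n) x))" using Suc by (simp add: funpow_add)
  also have "\<dots> = to_circle ((F ^^ q) ((G ^^ n) x))" by (rule funpow_lift_eq)
  also have "\<dots> = to_circle (G ((G ^^ n) x) + of_int p)" by (simp add: G_def)
  finally show ?case by (simp only: to_circle_add_int funpow.simps comp_apply)
qed simp

lemma G_fixed: assumes "G z = z" shows "(f ^^ q) (to_circle z) = to_circle z"
  using G_iterate[of 1 z] assms by simp

lemma open_iterate_image: "open U \<Longrightarrow> open ((f ^^ j) ` U)"
proof (induction j)
  case (Suc j)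
  have "(f ^^ Suc j) ` U = f ` ((f ^^ j) ` U)" by (simp add: image_comp)
  then show ?case using Suc f_open by metis
qed simp

lemma omega_limit_exists:
  obtains z where "G z = z" "omega_limit f c = orbit f (to_circle z)"
proof -
  obtain x where x: "c = to_circle x" by (rule circle_cases)
  obtain x0 where "(F ^^ q) x0 = x0 + of_int p" using periodic by blast
  then have "G x0 = x0" by (simp add: G_def)
  then obtain z where z: "G z = z" "(\<lambda>n. (G ^^ n) x) \<longlonglongrightarrow> z" using G.orbit_converges_to_fixed_point by blast
  have "(\<lambda>n. (f ^^ (q * n)) c) \<longlonglongrightarrow> to_circle z"
    unfolding x G_iterate by (rule tendsto_to_circle[OF z(2)])
  then have "omega_limit f c = orbit f (to_circle z)"
    by (rule omega_limit_orbit[OF f_cont q G_fixed[OF z(1)]])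
  then show thesis using z(1) that by blast
qed

text \<open>Near z the map \<open>G\<close> is multiplication by s, so balls about z shrink. Their
  first q images under \<open>f\<close> together form the neighbourhoods \<open>W d\<close> of the
  whole orbit.\<close>

lemma attracting_orbit:
  assumes z: "G z = z" and e: "e > 0" and s: "0 < s" "s < 1"
    and contr: "\<And>y. \<bar>y - z\<bar> < e \<Longrightarrow> G y - z = s * (y - z)"
  shows "attracting f (orbit f (to_circle z))"
proof -
  let ?c = "to_circle z"
  have fix_c: "(f ^^ q) ?c = ?c" by (rule G_fixed[OF z])
  have it: "(G ^^ n) y - z = s ^ n * (y - z) \<and> \<bar>(G ^^ n) y - z\<bar> \<le> \<bar>y - z\<bar>" if y: "\<bar>y - z\<bar> < e" for n y
  proof (induction n)
    case (Suc n)
    then have "\<bar>(G ^^ n) y - z\<bar> < e" using y by linarith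
    then have 1: "(G ^^ Suc n) y - z = s * ((G ^^ n) y - z)" using contr by simp
    have "\<bar>s * ((G ^^ n) y - z)\<bar> \<le> \<bar>(G ^^ n) y - z\<bar>" using s by (simp add: abs_mult mult_left_le_one_le)
    from order_trans[OF this conjunct2[OF Suc]]
    have 2: "\<bar>(G ^^ Suc n) y - z\<bar> \<le> \<bar>y - z\<bar>" unfolding 1 .
    have "(G ^^ Suc n) y - z = s ^ Suc n * (y - z)" unfolding 1 using Suc by simp
    then show ?case using 2 by blast
  qed simp
  have conv: "(\<lambda>n. (G ^^ n) y) \<longlonglongrightarrow> z" if "\<bar>y - z\<bar> < e" for y
  proof -
    have "(\<lambda>n. s ^ n) \<longlonglongrightarrow> 0" using s by (intro LIMSEQ_realpow_zero) auto
    then have "(\<lambda>n. s ^ n * (y - z) + z) \<longlonglongrightarrow> 0 * (y - z) + z"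
      by (intro tendsto_add tendsto_mult tendsto_const)
    moreover have "s ^ n * (y - z) + z = (G ^^ n) y" for n using it[OF that, of n] by simp
    ultimately show ?thesis by simp
  qed
  define W where "W d = (\<Union>j\<in>{..<q}. (f ^^ j) ` to_circle ` ball z d)" for d
  have W: "open (W d)" "d > 0 \<Longrightarrow> orbit f ?c \<subseteq> W d" for d
  proof -
    show "open (W d)" unfolding W_def by (intro open_UN ballI open_iterate_image open_to_circle_image open_ball)
    show "orbit f ?c \<subseteq> W d" if "d > 0" unfolding W_def orbit_eq_image[OF fix_c q] using that by auto
  qed
  have stable: "\<exists>U. open U \<and> orbit f ?c \<subseteq> U \<and> (\<forall>n. (f ^^ n) ` U \<subseteq> V)" if V: "open V" "orbit f ?c \<subseteq> V" for V
  proof -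
    have "\<forall>j. \<exists>d>0. \<forall>y. \<bar>y - z\<bar> < d \<longrightarrow> (f ^^ j) (to_circle y) \<in> V"
    proof
      fix j
      have "continuous_on UNIV (\<lambda>y. (f ^^ j) (to_circle y))"
        by (rule continuous_on_compose2[OF funpow_continuous[OF f_cont] continuous_to_circle]) auto
      then have "open ((\<lambda>y. (f ^^ j) (to_circle y)) -` V)" using V(1) by (simp add: open_vimage)
      moreover have "z \<in> (\<lambda>y. (f ^^ j) (to_circle y)) -` V" using V(2) by (auto simp: orbit_def)
      ultimately obtain d where "d > 0" "ball z d \<subseteq> (\<lambda>y. (f ^^ j) (to_circle y)) -` V" using openE by blast
      then show "\<exists>d>0. \<forall>y. \<bar>y - z\<bar> < d \<longrightarrow> (f ^^ j) (to_circle y) \<in> V"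
        by (intro exI[of _ d]) (auto simp: subset_iff dist_real_def abs_minus_commute)
    qed
    then obtain d where d: "\<And>j. d j > 0" "\<And>j y. \<bar>y - z\<bar> < d j \<Longrightarrow> (f ^^ j) (to_circle y) \<in> V" by metis
    \<comment> \<open>Controlling q iterates is enough: an iterate of order n + j splits into full
      periods, which act as \<open>G\<close> and keep the ball about z, and a remainder below
      q.\<close>
    define m where "m = Min (insert e (d ` {..<q}))"
    have m: "m > 0" "m \<le> e" "\<And>j. j < q \<Longrightarrow> m \<le> d j" unfolding m_def using d e by auto
    have "(f ^^ n) ` W m \<subseteq> V" for n
    proof
      fix w assume "w \<in> (f ^^ n) ` W m"
      then obtain j y where jy: "w = (f ^^ n) ((f ^^ j) (to_circle y))" "\<bar>y - z\<bar> < m"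
        by (auto simp: W_def dist_real_def abs_minus_commute)
      define k where "k = (n + j) div q"
      have "w = (f ^^ ((n + j) mod q + q * k)) (to_circle y)" unfolding jy k_def by (simp flip: funpow_add comp_apply[of "f ^^ n" "f ^^ j"])
      also have "\<dots> = (f ^^ ((n + j) mod q)) (to_circle ((G ^^ k) y))" by (simp only: funpow_add comp_apply G_iterate)
      finally have w: "w = (f ^^ ((n + j) mod q)) (to_circle ((G ^^ k) y))" .
      have "\<bar>(G ^^ k) y - z\<bar> < m" using it[of y k] jy(2) m(2) by linarith
      then show "w \<in> V" unfolding w using q m(3)[of "(n + j) mod q"] by (intro d(2)) (simp add: less_le_trans)
    qed
    then show ?thesis using W[of m] m(1) by (intro exI[of _ "W m"]) auto
  qed
  have "omega_limit f w = orbit f ?c" if "w \<in> W e" for w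
  proof -
    obtain j y where jy: "w = (f ^^ j) (to_circle y)" "\<bar>y - z\<bar> < e"
      using \<open>w \<in> W e\<close> by (auto simp: W_def dist_real_def abs_minus_commute)
    have "(\<lambda>n. (f ^^ j) (to_circle ((G ^^ n) y))) \<longlonglongrightarrow> (f ^^ j) ?c"
      using continuous_on_tendsto_compose[OF funpow_continuous[OF f_cont] tendsto_to_circle[OF conv[OF jy(2)]]] by simp
    moreover have "(f ^^ j) (to_circle ((G ^^ n) y)) = (f ^^ (q * n)) w" for n
      unfolding jy G_iterate[symmetric] by (metis add.commute comp_apply funpow_add)
    ultimately have lim: "(\<lambda>n. (f ^^ (q * n)) w) \<longlonglongrightarrow> (f ^^ j) ?c" by simp
    have "(f ^^ q) ((f ^^ j) ?c) = (f ^^ j) ?c" using fix_c by (metis add.commute comp_apply funpow_add)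
    then have "omega_limit f w = orbit f ((f ^^ j) ?c)" by (rule omega_limit_orbit[OF f_cont q _ lim])
    then show ?thesis by (simp add: orbit_shift[OF fix_c q])
  qed
  then have "\<exists>U. open U \<and> orbit f ?c \<subseteq> U \<and> (\<forall>x\<in>U. omega_limit f x = orbit f ?c)"
    using W[of e] e by blast
  then show ?thesis unfolding attracting_def using stable by blast
qed

text \<open>This makes the locale available for \<open>inv f\<close>, so that repelling orbits are
  handled as attracting orbits of the inverse and \<alpha>-limits as \<omega>-limits.\<close>

lemma inverse_map:
  "periodic_circle_map (inv F) (inv f) q (- p)" "\<And>z. G z = z \<Longrightarrow> (inv F ^^ q) z - of_int (- p) = z"
  "\<And>z y w. G w - z = y - z \<Longrightarrow> (inv F ^^ q) y - of_int (- p) = w"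
proof -
  have inj: "inj F" using smono by (simp add: strict_mono_imp_inj_on)
  have surj: "surj F" using surj_F by (metis surjI)
  have FF: "F (inv F x) = x" "inv F (F x) = x" for x using inj surj by (simp_all add: surj_f_inv_f)
  have FFn: "(inv F ^^ n) ((F ^^ n) x) = x" for n x
  proof (induction n arbitrary: x)
    case (Suc n)
    have "(inv F ^^ Suc n) ((F ^^ Suc n) x) = (inv F ^^ n) (inv F (F ((F ^^ n) x)))" by (simp add: funpow_swap1)
    then show ?case using Suc FF by simp
  qed simp
  have Lm: "lift_map (inv F)"
  proof
    have sm: "strict_mono (inv F)" unfolding strict_mono_def by (metis FF(1) less_iff)
    then show "strict_mono (inv F)" .
    show "continuous_on UNIV (inv F)"
    proof (rule mono_dense_range_continuous)
      show "mono (inv F)" using sm by (rule strict_mono_mono)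
      fix a b :: real assume "a < b"
      then show "\<exists>x. a < inv F x \<and> inv F x < b"
        by (intro exI[of _ "F ((a + b) / 2)"]) (simp add: FF)
    qed
    show "inv F (x + 1) = inv F x + 1" for x by (metis FF deg1)
  qed
  interpret I: lift_map "inv F" by (rule Lm)
  have *: "(inv F ^^ q) y - of_int (- p) = w" if "G w - z = y - z" for z y w
  proof -
    have "(F ^^ q) w = y + of_int p" using that by (simp add: G_def)
    then have "(inv F ^^ q) (y + of_int p) = w" using FFn by metis
    then show ?thesis using I.funpow_add_int[of q y p] by simp
  qed
  then show "\<And>z y w. G w - z = y - z \<Longrightarrow> (inv F ^^ q) y - of_int (- p) = w" .
  have fx: "(inv F ^^ q) z - of_int (- p) = z" if "G z = z" for z
    by (rule *[of z z z]) (use that in simp)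
  then show "\<And>z. G z = z \<Longrightarrow> (inv F ^^ q) z - of_int (- p) = z" .
  show "periodic_circle_map (inv F) (inv f) q (- p)"
  proof (intro periodic_circle_map.intro Lm periodic_circle_map_axioms.intro)
    show "circle_homeo (inv f)" by (rule f_inv_homeo)
    show "to_circle (inv F x) = inv f (to_circle x)" for x
      by (metis FF(1) lift f_bij bij_inv_eq_iff)
    show "\<exists>x. (inv F ^^ q) x = x + of_int (- p)"
    proof -
      obtain x where "(F ^^ q) x = x + of_int p" using periodic by blast
      then have "G x = x" by (simp add: G_def)
      from fx[OF this] show ?thesis by (intro exI[of _ x]) simp
    qed
  qed (rule q)
qed

text \<open>On a point of period q, going k steps back is the same as going q * k - k steps
  forward.\<close>

lemma orbit_inv:
  assumes "(f ^^ q) e = e" shows "orbit (inv f) e = orbit f e"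
proof -
  have fi: "f (inv f x) = x" "inv f (f x) = x" for x using f_bij by (simp_all add: bij_is_surj surj_f_inv_f bij_is_inj)
  have 1: "(inv f ^^ k) ((f ^^ k) x) = x" "(f ^^ k) ((inv f ^^ k) x) = x" for k x
  proof (induction k arbitrary: x)
    case (Suc k)
    { case 1 show ?case using Suc fi by (simp add: funpow_swap1) }
    { case 2 show ?case using Suc fi by (simp add: funpow_swap1) }
  qed auto
  have k: "k + (q * k - k) = q * k" for k using q by simp
  have e': "(inv f ^^ q) e = e" using 1[of q e] assms by simp
  have "(inv f ^^ k) e = (f ^^ (q * k - k)) e" for k
  proof -
    have "(f ^^ k) ((f ^^ (q * k - k)) e) = e" by (metis k funpow_add comp_apply funpow_mult_fixed[OF assms])
    then show ?thesis using 1(1)[of k] by metis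
  qed
  moreover have "(f ^^ k) e = (inv f ^^ (q * k - k)) e" for k
  proof -
    have "(inv f ^^ k) ((inv f ^^ (q * k - k)) e) = e" by (metis k funpow_add comp_apply funpow_mult_fixed[OF e'])
    then show ?thesis using 1(2)[of k] by metis
  qed
  ultimately show ?thesis unfolding orbit_def by blast
qed

text \<open>A multiplier s different from 1 isolates each fixed point of \<open>G\<close>, so by
  compactness there are finitely many modulo 1. Those with s < 1 attract; for s > 1 the inverse has
  multiplier 1 / s and the orbit repels.\<close>

theorem hyperbolic_imp_morse_smale:
  assumes hyp: "\<And>z. G z = z \<Longrightarrow> \<exists>e>0. \<exists>s>0. s \<noteq> 1 \<and> (\<forall>y. \<bar>y - z\<bar> < e \<longrightarrow> G y - z = s * (y - z))"
  shows "morse_smale f"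
proof -
  interpret I: periodic_circle_map "inv F" "inv f" q "- p" by (rule inverse_map(1))
  define Z where "Z = {z\<in>{0..1}. G z = z}"
  define PP where "PP = (\<lambda>z. orbit f (to_circle z)) ` Z"
  have IG: "I.G z = z \<longleftrightarrow> G z = z" for z
  proof
    assume "I.G z = z"
    obtain w where w: "G w = z" using G.surj_F by blast
    then have "I.G z = w" using inverse_map(3)[of w z z] by (simp add: I.G_def)
    then show "G z = z" using w \<open>I.G z = z\<close> by simp
  qed (use inverse_map(2) in \<open>simp add: I.G_def\<close>)
  have finZ: "finite Z"
  proof (rule ccontr)
    assume "infinite Z"
    moreover have "bounded Z" unfolding Z_def by (rule bounded_subset[of "{0..1}"]) auto
    ultimately obtain z where lim: "z islimpt Z" using bounded_infinite_imp_islimpt[of Z Z] by blast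
    have "closed Z"
    proof -
      have "Z = {0..1} \<inter> {z. G z = z}" by (auto simp: Z_def)
      moreover have "closed {z. G z = z}" by (rule closed_Collect_eq[OF G.cont continuous_on_id])
      ultimately show ?thesis by auto
    qed
    then have "z \<in> Z" using lim by (simp add: closed_limpt)
    then have z: "G z = z" by (simp add: Z_def)
    obtain e s where es: "e > 0" "s \<noteq> 1" "\<And>y. \<bar>y - z\<bar> < e \<Longrightarrow> G y - z = s * (y - z)" using hyp[OF z] by blast
    obtain y where y: "y \<in> Z" "y \<noteq> z" "dist y z < e" using lim es(1) by (auto simp: islimpt_approachable)
    then have "y - z = s * (y - z)" using es(3)[of y] by (auto simp: Z_def dist_real_def)
    then show False using y es(2) by simp
  qed
  have inPP: "orbit f (to_circle z) \<in> PP" if z: "G z = z" for z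
  proof -
    have "G (frac z + of_int \<lfloor>z\<rfloor>) = frac z + of_int \<lfloor>z\<rfloor>" using z by (simp add: frac_def)
    then have "frac z \<in> Z" unfolding G.add_int Z_def using frac_lt_1[of z] by (auto simp: less_imp_le)
    then show ?thesis unfolding PP_def by (intro image_eqI[of _ _ "frac z"]) auto
  qed
  have "periodic_orbit f C \<and> (attracting f C \<or> repelling f C)" if C: "C \<in> PP" for C
  proof -
    obtain z where z: "G z = z" "C = orbit f (to_circle z)" using C by (auto simp: PP_def Z_def)
    have fx: "(f ^^ q) (to_circle z) = to_circle z" by (rule G_fixed[OF z(1)])
    obtain e s where es: "e > 0" "s > 0" "s \<noteq> 1" "\<And>y. \<bar>y - z\<bar> < e \<Longrightarrow> G y - z = s * (y - z)" using hyp[OF z(1)] by blast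
    have "attracting f C \<or> repelling f C"
    proof (cases "s < 1")
      case True
      then show ?thesis using attracting_orbit[OF z(1) es(1,2) _ es(4)] z(2) by blast
    next
      case False
      then have s1: "s > 1" using es by simp
      have "I.G y - z = (1 / s) * (y - z)" if y: "\<bar>y - z\<bar> < s * e" for y
      proof -
        define w where "w = z + (y - z) / s"
        have "\<bar>w - z\<bar> < e" using y es(2) by (simp add: w_def abs_divide field_simps)
        then have "G w - z = y - z" using es(4)[of w] es(2) by (simp add: w_def)
        then have "I.G y = w" unfolding I.G_def by (rule inverse_map(3))
        then show ?thesis by (simp add: w_def)
      qed
      then have "attracting (inv f) (orbit (inv f) (to_circle z))"
        using s1 es z by (intro I.attracting_orbit[of z "s * e" "1 / s"]) (auto simp: IG)
      then show ?thesis unfolding repelling_def z(2) orbit_inv[OF fx] by blast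
    qed
    moreover have "periodic_orbit f C" unfolding periodic_orbit_def z(2) orbit_def using fx q by blast
    ultimately show ?thesis by blast
  qed
  moreover have "alpha_limit f x \<in> PP \<and> omega_limit f x \<in> PP" for x
  proof
    obtain z where "G z = z" "omega_limit f x = orbit f (to_circle z)" by (rule omega_limit_exists)
    then show "omega_limit f x \<in> PP" using inPP by simp
    obtain z where "I.G z = z" "omega_limit (inv f) x = orbit (inv f) (to_circle z)" by (rule I.omega_limit_exists)
    then show "alpha_limit f x \<in> PP" unfolding alpha_limit_def using inPP orbit_inv[OF G_fixed] IG by simp
  qed
  moreover have "finite PP" using finZ by (simp add: PP_def)
  ultimately show ?thesis unfolding morse_smale_def using homeo by blast
qed

end


section \<open>Circle homeomorphisms with two break points\<close>

context pl_family
begin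

lemma H_locally_affine:
  assumes "\<not> break_pt w"
  shows "\<exists>e>0. \<forall>y. \<bar>y - w\<bar> < e \<longrightarrow> H y - H w = slope w * (y - w)"
proof -
  have away: "min (frac x) (1 - frac x) \<le> \<bar>x - of_int m\<bar>" for x :: real and m
  proof (cases "m \<le> \<lfloor>x\<rfloor>")
    case True
    then have "real_of_int m \<le> of_int \<lfloor>x\<rfloor>" by simp
    then have "frac x \<le> x - of_int m" by (simp add: frac_def)
    then show ?thesis by linarith
  next
    case False
    then have "\<lfloor>x\<rfloor> + 1 \<le> m" by simp
    then have "real_of_int (\<lfloor>x\<rfloor> + 1) \<le> of_int m" by (simp only: of_int_le_iff)
    then have "1 - frac x \<le> of_int m - x" by (simp add: frac_def)
    then show ?thesis by linarith
  qed
  have pos: "min (frac x) (1 - frac x) > 0" if "x \<notin> \<int>" for x :: real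
    using that frac_lt_1[of x] by (simp add: frac_gt_0_iff)
  \<comment> \<open>The distance of w from the set of all integers and their translates by l, that
    is, from the nearest break point.\<close>
  define e where "e = min (min (frac w) (1 - frac w)) (min (frac (w - l)) (1 - frac (w - l)))"
  have "w \<notin> \<int>" using assms by (auto simp: break_pt_def elim: Ints_cases)
  moreover have "w - l \<notin> \<int>"
  proof
    assume "w - l \<in> \<int>"
    then obtain m where "w - l = of_int m" by (auto elim: Ints_cases)
    then have "w = l + of_int m" by simp
    then show False using assms by (auto simp: break_pt_def)
  qed
  ultimately have e: "e > 0" using pos[of w] pos[of "w - l"] by (simp add: e_def)
  have nb: "\<not> break_pt v" if "\<bar>v - w\<bar> < e" for v
  proof
    assume "break_pt v"
    then obtain m :: int where "v = of_int m \<or> v = l + of_int m" by (auto simp: break_pt_def)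
    then have "\<bar>v - w\<bar> = \<bar>w - of_int m\<bar> \<or> \<bar>v - w\<bar> = \<bar>(w - l) - of_int m\<bar>" by auto
    moreover have "e \<le> \<bar>w - of_int m\<bar>" "e \<le> \<bar>(w - l) - of_int m\<bar>"
      unfolding e_def by (rule order_trans[OF min.cobounded1 away], rule order_trans[OF min.cobounded2 away])
    ultimately show False using that by auto
  qed
  have "H y - H w = slope w * (y - w)" if y: "\<bar>y - w\<bar> < e" for y
  proof (cases "w \<le> y")
    case True
    show ?thesis by (rule H_affine(1)[OF True]) (use nb y in auto)
  next
    case False
    then have yw: "y \<le> w" by simp
    have "H w - H y = slope y * (w - y)" "slope w = slope y"
      by (rule H_affine[OF yw]; use nb y in auto)+
    then show ?thesis by (simp add: algebra_simps)
  qed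
  then show ?thesis using e by blast
qed

lemma iterate_locally_affine:
  assumes "\<And>i. i < n \<Longrightarrow> \<not> break_pt ((F t ^^ i) z)"
  shows "\<exists>e>0. \<forall>y. \<bar>y - z\<bar> < e \<longrightarrow> (F t ^^ n) y - (F t ^^ n) z = orbit_slope t z n * (y - z)"
  using assms
proof (induction n)
  case 0 show ?case by (intro exI[of _ 1]) (simp add: orbit_slope_def)
next
  case (Suc n)
  have IH: "\<exists>e>0. \<forall>y. \<bar>y - z\<bar> < e \<longrightarrow> (F t ^^ n) y - (F t ^^ n) z = orbit_slope t z n * (y - z)"
    by (rule Suc.IH) (rule Suc.prems, simp)
  obtain e where e: "e > 0" "\<And>y. \<bar>y - z\<bar> < e \<Longrightarrow> (F t ^^ n) y - (F t ^^ n) z = orbit_slope t z n * (y - z)"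
    using IH by blast
  obtain d where d: "d > 0" "\<And>y. \<bar>y - (F t ^^ n) z\<bar> < d \<Longrightarrow> H y - H ((F t ^^ n) z) = slope ((F t ^^ n) z) * (y - (F t ^^ n) z)"
    using H_locally_affine[OF Suc.prems[of n]] by blast
  have op: "orbit_slope t z n > 0" by (rule orbit_slope_pos)
  show ?case
  proof (intro exI[of _ "min e (d / orbit_slope t z n)"] conjI allI impI)
    show "min e (d / orbit_slope t z n) > 0" using e d op by simp
    fix y assume "\<bar>y - z\<bar> < min e (d / orbit_slope t z n)"
    then have y: "\<bar>y - z\<bar> < e" "\<bar>y - z\<bar> * orbit_slope t z n < d" using op by (auto simp: field_simps)
    have 1: "(F t ^^ n) y - (F t ^^ n) z = orbit_slope t z n * (y - z)" by (rule e(2)[OF y(1)])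
    then have "\<bar>(F t ^^ n) y - (F t ^^ n) z\<bar> < d" using y(2) op by (simp add: abs_mult mult.commute)
    then have "H ((F t ^^ n) y) - H ((F t ^^ n) z) = slope ((F t ^^ n) z) * ((F t ^^ n) y - (F t ^^ n) z)" by (rule d(2))
    then show "(F t ^^ Suc n) y - (F t ^^ Suc n) z = orbit_slope t z (Suc n) * (y - z)"
      unfolding F_Suc 1 by (simp add: orbit_slope_def algebra_simps)
  qed
qed

lemma orbit_slope_eq: "\<exists>a b. a + b = n \<and> orbit_slope t z n = lam ^ a * mu ^ b"
proof (induction n)
  case 0 show ?case by (simp add: orbit_slope_def)
next
  case (Suc n)
  then obtain a b where ab: "a + b = n" "orbit_slope t z n = lam ^ a * mu ^ b" by blast
  show ?case
  proof (cases "frac ((F t ^^ n) z) < l")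
    case True
    then have "orbit_slope t z (Suc n) = lam ^ Suc a * mu ^ b" using ab by (simp add: orbit_slope_def slope_def)
    then show ?thesis using ab by (intro exI[of _ "Suc a"] exI[of _ b]) auto
  next
    case False
    then have "orbit_slope t z (Suc n) = lam ^ a * mu ^ Suc b" using ab by (simp add: orbit_slope_def slope_def)
    then show ?thesis using ab by (intro exI[of _ a] exI[of _ "Suc b"]) auto
  qed
qed

text \<open>A relation lam^a mu^b = 1 with a + b = n > 0 would, after taking logarithms, give kappa
  = a / (a + b).\<close>

lemma orbit_slope_ne_1:
  assumes ne: "lam \<noteq> mu" and "kappa \<notin> \<rat>" "n > 0" shows "orbit_slope t z n \<noteq> 1"
proof
  assume o: "orbit_slope t z n = 1"
  obtain a b where ab: "a + b = n" "orbit_slope t z n = lam ^ a * mu ^ b" using orbit_slope_eq by blast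
  have "ln (lam ^ a * mu ^ b) = 0" using o ab by simp
  then have s: "real a * ln lam + real b * ln mu = 0" using lam_pos mu_pos by (simp add: ln_mult ln_realpow)
  have d: "ln lam - ln mu \<noteq> 0" using ne lam_pos mu_pos by simp
  have n: "real a + real b \<noteq> 0" using ab(1) assms(3) by simp
  have "(real a + real b) * (- ln mu) = real a * (ln lam - ln mu)" using s by (simp add: algebra_simps)
  then have "kappa = real a / (real a + real b)" using d n by (simp add: kappa_def field_simps)
  also have "\<dots> \<in> \<rat>" by simp
  finally show False using assms(2) by simp
qed

text \<open>A break point on the orbit of z would itself be periodic, which is excluded; so the q-th
  iterate is affine near z, with the slope product along the orbit as multiplier.\<close>

lemma generic_fixed_point_hyperbolic:
  assumes gen: "generic_params l L t" and q: "q > 0" and z: "(F t ^^ q) z = z + of_int p"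
  shows "\<exists>e>0. \<exists>s>0. s \<noteq> 1 \<and> (\<forall>y. \<bar>y - z\<bar> < e \<longrightarrow> (F t ^^ q) y - of_int p - z = s * (y - z))"
proof -
  have g: "L \<noteq> l" "kappa \<notin> \<rat>" "\<And>p. (F t ^^ q) 0 \<noteq> of_int p" "\<And>p. (F t ^^ q) l \<noteq> l + of_int p"
    using gen q l L unfolding generic_params_def F_eq kappa_eq by auto
  have nb: "\<not> break_pt ((F t ^^ i) z)" for i
  proof
    assume "break_pt ((F t ^^ i) z)"
    then obtain m where m: "(F t ^^ i) z = 0 + of_int m \<or> (F t ^^ i) z = l + of_int m" by (auto simp: break_pt_def)
    have "(F t ^^ q) ((F t ^^ i) z) = (F t ^^ i) ((F t ^^ q) z)" by (metis add.commute comp_apply funpow_add)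
    then have "(F t ^^ q) ((F t ^^ i) z) = (F t ^^ i) z + of_int p" by (simp add: z F.funpow_add_int)
    then have "(F t ^^ q) 0 = of_int p \<or> (F t ^^ q) l = l + of_int p" using m
      using F.funpow_add_int[of q t 0 m] F.funpow_add_int[of q t l m] by auto
    then show False using g by blast
  qed
  obtain e where e: "e > 0" "\<And>y. \<bar>y - z\<bar> < e \<Longrightarrow> (F t ^^ q) y - (F t ^^ q) z = orbit_slope t z q * (y - z)"
    using iterate_locally_affine[of q t z] nb by blast
  have "lam \<noteq> mu" using g(1) lam_eq_mu_iff by simp
  then have "orbit_slope t z q \<noteq> 1" using g(2) q by (rule orbit_slope_ne_1)
  then show ?thesis using e orbit_slope_pos[of t z q] by (intro exI[of _ e] conjI exI[of _ "orbit_slope t z q"]) (auto simp: z algebra_simps)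
qed

lemma pl_map_on_arcs:
  shows "0 \<le> u \<Longrightarrow> u \<le> l \<Longrightarrow> pl_map l L t u = t + L / l * u"
    and "l \<le> u \<Longrightarrow> u < 1 \<Longrightarrow> pl_map l L t u = t + L + (1 - L) / (1 - l) * (u - l)"
proof -
  have fl: "\<lfloor>u\<rfloor> = 0" "frac u = u" if "0 \<le> u" "u < 1" using that by (auto simp: floor_eq_iff frac_eq)
  show "0 \<le> u \<Longrightarrow> u \<le> l \<Longrightarrow> pl_map l L t u = t + L / l * u" using fl l by (simp add: pl_map_def)
  show "l \<le> u \<Longrightarrow> u < 1 \<Longrightarrow> pl_map l L t u = t + L + (1 - L) / (1 - l) * (u - l)" using fl l by (simp add: pl_map_def)
qed

end

section \<open>From a circle map with two break points to its normal form\<close>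

lemma affine_of_affine_mod_1:
  fixes g :: "real \<Rightarrow> real"
  assumes g: "continuous_on UNIV g" and uv: "u < v" and int: "\<And>x. u < x \<Longrightarrow> x < v \<Longrightarrow> g x - (s * x + c) \<in> \<int>"
  shows "x \<in> {u..v} \<Longrightarrow> g x = g u + (g v - g u) / (v - u) * (x - u)"
proof -
  let ?k = "\<lambda>x. g x - (s * x + c)"
  have k: "continuous_on A ?k" for A
    by (intro continuous_intros continuous_on_subset[OF g]) auto
  \<comment> \<open>A continuous integer-valued function on an interval is constant; continuity then
    carries the formula to the end points, whose values determine it.\<close>
  have "?k constant_on {u<..<v}"
  proof (rule continuous_discrete_range_constant)
    fix x assume x: "x \<in> {u<..<v}"
    show "\<exists>e>0. \<forall>y. y \<in> {u<..<v} \<and> ?k y \<noteq> ?k x \<longrightarrow> e \<le> norm (?k y - ?k x)"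
    proof (intro exI[of _ 1] conjI allI impI)
      fix y assume y: "y \<in> {u<..<v} \<and> ?k y \<noteq> ?k x"
      then have "?k y \<in> \<int>" "?k x \<in> \<int>" using int[of x] int[of y] x by auto
      then have "?k y - ?k x \<in> \<int>" by (rule Ints_diff)
      then obtain m where "?k y - ?k x = of_int m" by (auto elim: Ints_cases)
      then show "1 \<le> norm (?k y - ?k x)" using y by (cases "m = 0") auto
    qed simp
  qed (auto intro: k)
  then obtain a where a: "\<And>x. x \<in> {u<..<v} \<Longrightarrow> ?k x = a" by (auto simp: constant_on_def)
  have kk: "?k x = a" if "x \<in> {u..v}" for x
    by (rule continuous_constant_on_closure[of "{u<..<v}" ?k a]) (use a that uv k in auto)
  assume x: "x \<in> {u..v}"
  have "g x = s * x + c + a" "g u = s * u + c + a" "g v = s * v + c + a" using kk[OF x] kk[of u] kk[of v] uv by auto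
  then show ?thesis using uv by (simp add: field_simps)
qed

text \<open>Translation by x1 moves the first break point to 0. The translated lift
  \<open>\<Psi>\<close> is affine on [0, l] and [l, 1] with values t, t + L, t + 1 at the ends,
  hence equals \<open>pl.F t\<close>, and the generic properties transfer to
  \<open>f\<close>.\<close>

theorem generic_two_breaks_morse_smale:
  assumes pa: "pa_homeo_two_breaks f (to_circle x1) (to_circle x2)"
    and y1: "f (to_circle x1) = to_circle y1" and y2: "f (to_circle x2) = to_circle y2"
    and gen: "generic_params (frac (x2 - x1)) (frac (y2 - y1)) (y1 - x1)"
  shows "morse_smale f"
proof -
  have homeo: "circle_homeo f" and or: "orientation_preserving f" and ne: "to_circle x1 \<noteq> to_circle x2"
    and aff: "affine_on_arcs_of (- {to_circle x1, to_circle x2}) f"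
    using pa by (auto simp: pa_homeo_two_breaks_def)
  have inj: "f a = f b \<Longrightarrow> a = b" for a b using homeo unfolding circle_homeo_def homeomorphism_def by (metis UNIV_I)
  obtain \<Phi>' where \<Phi>': "continuous_on UNIV \<Phi>'" "\<And>x. to_circle (\<Phi>' x) = f (to_circle x)" "strict_mono \<Phi>'"
    using or by (auto simp: orientation_preserving_def circle_lift_def)
  have "to_circle (\<Phi>' x1) = to_circle y1" using \<Phi>'(2) y1 by simp
  then obtain k where k: "\<Phi>' x1 - y1 = of_int k" by (auto simp: to_circle_eq_iff elim: Ints_cases)
  define \<Phi> where "\<Phi> x = \<Phi>' x - of_int k" for x
  have \<Phi>: "continuous_on UNIV \<Phi>" "strict_mono \<Phi>" "\<Phi> x1 = y1"
    using \<Phi>' k unfolding \<Phi>_def by (auto intro!: continuous_intros simp: strict_mono_def)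
  have lift: "to_circle (\<Phi> x) = f (to_circle x)" for x
    using \<Phi>'(2)[of x] to_circle_add_int[of "\<Phi>' x" "- k"] by (simp add: \<Phi>_def)
  \<comment> \<open>The increment over a period is a positive integer. If it were at least 2, the
    value \<Phi> x + 1 would be taken strictly between x and x + 1, against injectivity of
    \<open>f\<close>.\<close>
  have dg: "\<Phi> (x + 1) = \<Phi> x + 1" for x
  proof -
    have "to_circle (\<Phi> (x + 1)) = to_circle (\<Phi> x)" using to_circle_add_int[of x 1] by (simp add: lift)
    then obtain m where m: "\<Phi> (x + 1) - \<Phi> x = of_int m" by (auto simp: to_circle_eq_iff elim: Ints_cases)
    have "\<Phi> x < \<Phi> (x + 1)" using \<Phi>(2) by (simp add: strict_mono_def)
    then have "m \<ge> 1" using m by linarith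
    have "m = 1"
    proof (rule ccontr)
      assume "m \<noteq> 1"
      then have "real_of_int m \<ge> 2" using \<open>m \<ge> 1\<close> by linarith
      then have "\<Phi> x \<le> \<Phi> x + 1" "\<Phi> x + 1 \<le> \<Phi> (x + 1)" using m by linarith+
      then obtain w where w: "x \<le> w" "w \<le> x + 1" "\<Phi> w = \<Phi> x + 1"
        using IVT'[of \<Phi> x "\<Phi> x + 1" "x + 1"] continuous_on_subset[OF \<Phi>(1)] by auto
      then have "w \<noteq> x" "w \<noteq> x + 1" using m \<open>real_of_int m \<ge> 2\<close> by auto
      have "to_circle (\<Phi> w) = to_circle (\<Phi> x)" unfolding w(3) using to_circle_add_int[of "\<Phi> x" 1] by simp
      then have "to_circle w = to_circle x" using inj by (simp add: lift)
      then obtain j where j: "w - x = of_int j" by (auto simp: to_circle_eq_iff elim: Ints_cases)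
      then have "0 < real_of_int j" "real_of_int j < 1" using w \<open>w \<noteq> x\<close> \<open>w \<noteq> x + 1\<close> by linarith+
      then show False by simp
    qed
    then show ?thesis using m by simp
  qed
  interpret \<Phi>: lift_map \<Phi> by unfold_locales (use \<Phi> dg in auto)
  define l where "l = frac (x2 - x1)"
  define L where "L = frac (y2 - y1)"
  define t where "t = y1 - x1"
  have "x2 - x1 \<notin> \<int>"
  proof
    assume "x2 - x1 \<in> \<int>"
    then have "to_circle x2 = to_circle x1" by (simp add: to_circle_eq_iff)
    then show False using ne by simp
  qed
  then have l: "0 < l" "l < 1" by (auto simp: l_def frac_gt_0_iff frac_lt_1)
  have x2: "to_circle (x1 + l) = to_circle x2" by (simp add: l_def frac_def to_circle_eq_iff)
  define \<Psi> where "\<Psi> u = \<Phi> (x1 + u) - x1" for u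
  have \<Psi>0: "\<Psi> 0 = t" by (simp add: \<Psi>_def t_def \<Phi>)
  \<comment> \<open>The increment D from x1 to x1 + l lies strictly between 0 and 1 because \<Phi>
    gains 1 over a period; so it equals \<open>frac (y2 - y1)\<close> without integer
    ambiguity.\<close>
  have \<Psi>l: "\<Psi> l = t + L"
  proof -
    define D where "D = \<Phi> (x1 + l) - y1"
    have "y1 < \<Phi> (x1 + l)" "\<Phi> (x1 + l) < \<Phi> (x1 + 1)" using l \<Phi>.less_iff[of x1 "x1 + l"] \<Phi>(3) by (auto simp: \<Phi>.less_iff)
    then have D: "0 < D" "D < 1" using dg[of x1] \<Phi>(3) by (auto simp: D_def)
    have "to_circle (\<Phi> (x1 + l)) = to_circle y2" unfolding lift x2 y2 ..
    then obtain m where m: "\<Phi> (x1 + l) - y2 = of_int m" by (auto simp: to_circle_eq_iff elim: Ints_cases)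
    have "y2 - y1 = D + of_int (- m)" using m by (simp add: D_def)
    then have "L = D" unfolding L_def using D by (simp add: frac_unique_iff)
    then show ?thesis by (simp add: \<Psi>_def D_def t_def)
  qed
  have "\<Psi> 0 < \<Psi> l" "\<Psi> l < \<Psi> 1" using l by (auto simp: \<Psi>_def \<Phi>.less_iff)
  moreover have \<Psi>1: "\<Psi> 1 = t + 1" using \<Psi>0 dg[of x1] by (simp add: \<Psi>_def)
  ultimately have L: "0 < L" "L < 1" using \<Psi>0 \<Psi>l by auto
  interpret pl: pl_family l L by unfold_locales (use l L in auto)
  have \<Psi>c: "continuous_on UNIV \<Psi>" unfolding \<Psi>_def
    by (intro continuous_intros continuous_on_compose2[OF \<Phi>(1)]) auto
  have arc: "\<Psi> u = \<Psi> a + (\<Psi> b - \<Psi> a) / (b - a) * (u - a)"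
    if ab: "0 \<le> a" "a < b" "b \<le> 1" "b \<le> l \<or> l \<le> a" and u: "u \<in> {a..b}" for a b u
  proof -
    have "to_circle ` {x1 + a<..<x1 + b} \<subseteq> - {to_circle x1, to_circle x2}"
    proof
      fix c assume "c \<in> to_circle ` {x1 + a<..<x1 + b}"
      then obtain x where x: "c = to_circle x" "x1 + a < x" "x < x1 + b" by auto
      have "c \<noteq> to_circle x1"
      proof
        assume "c = to_circle x1"
        then obtain m where "x - x1 = of_int m" using x by (auto simp: to_circle_eq_iff elim: Ints_cases)
        then have "0 < real_of_int m" "real_of_int m < 1" using x ab by linarith+
        then show False by simp
      qed
      moreover have "c \<noteq> to_circle x2"
      proof
        assume "c = to_circle x2"
        then have "to_circle x = to_circle (x1 + l)" using x x2 by simp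
        then obtain m where "x - (x1 + l) = of_int m" unfolding to_circle_eq_iff by (rule Ints_cases)
        then have m: "x = x1 + l + of_int m" by simp
        have "real_of_int (- 1) < of_int m" "real_of_int m < of_int 1" using m x(2,3) ab(1,3) l by simp_all
        then have "- 1 < m" "m < 1" by (simp_all only: of_int_less_iff)
        then have "m = 0" by simp
        then show False using m x(2,3) ab(4) by auto
      qed
      ultimately show "c \<in> - {to_circle x1, to_circle x2}" by simp
    qed
    then obtain s c where sc: "\<And>x. x \<in> {x1 + a<..<x1 + b} \<Longrightarrow> f (to_circle x) = to_circle (s * x + c)"
      using aff ab unfolding affine_on_arcs_of_def by (meson add_strict_left_mono)
    show ?thesis
    proof (rule affine_of_affine_mod_1[OF \<Psi>c ab(2) _ u])
      fix x assume "a < x" "x < b"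
      then have "to_circle (\<Phi> (x1 + x)) = to_circle (s * (x1 + x) + c)" using sc[of "x1 + x"] by (simp add: lift)
      then show "\<Psi> x - (s * x + (s * x1 + c - x1)) \<in> \<int>" by (simp add: \<Psi>_def to_circle_eq_iff algebra_simps)
    qed
  qed
  have eq01: "\<Psi> u = pl_map l L t u" if "0 \<le> u" "u < 1" for u
  proof (cases "u \<le> l")
    case True
    then show ?thesis using arc[of 0 l u] l that pl.pl_map_on_arcs(1)[of u t] by (simp add: \<Psi>0 \<Psi>l)
  next
    case False
    then show ?thesis using arc[of l 1 u] l that pl.pl_map_on_arcs(2)[of u t] by (simp add: \<Psi>1 \<Psi>l)
  qed
  have \<Psi>F: "\<Psi> u = pl.F t u" for u
  proof -
    have "\<Psi> u = \<Psi> (frac u) + of_int \<lfloor>u\<rfloor>"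
      using \<Phi>.add_int[of "x1 + frac u" "\<lfloor>u\<rfloor>"] by (simp add: \<Psi>_def frac_def algebra_simps)
    also have "\<dots> = pl.F t (frac u) + of_int \<lfloor>u\<rfloor>" using eq01[of "frac u"] frac_lt_1[of u] by (simp add: pl.F_eq)
    also have "\<dots> = pl.F t u" using pl.F.add_int[of t "frac u" "\<lfloor>u\<rfloor>"] by (simp add: frac_def)
    finally show ?thesis .
  qed
  have \<Phi>n: "(\<Phi> ^^ n) x = x1 + (pl.F t ^^ n) (x - x1)" for n x
  proof (induction n)
    case (Suc n)
    have "(\<Phi> ^^ Suc n) x = x1 + \<Psi> ((pl.F t ^^ n) (x - x1))" using Suc by (simp add: \<Psi>_def)
    then show ?case by (simp add: \<Psi>F)
  qed simp
  have gen': "generic_params l L t" using gen by (simp add: l_def L_def t_def)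
  then obtain q p where q: "q > 0" and "\<forall>k. \<exists>u\<in>\<rat>. \<bar>(pl.F t ^^ q) u - u - of_int p\<bar> < 1 / real (Suc k)"
    using l L unfolding generic_params_def pl.F_eq by blast
  then obtain z where z: "(pl.F t ^^ q) z = z + of_int p" using pl.F.periodic_point_approx_iff by blast
  interpret periodic_circle_map \<Phi> f q p
  proof (intro periodic_circle_map.intro periodic_circle_map_axioms.intro)
    show "\<exists>x. (\<Phi> ^^ q) x = x + of_int p" using z by (intro exI[of _ "x1 + z"]) (simp add: \<Phi>n)
  qed (use homeo lift q in \<open>auto intro: \<Phi>.lift_map_axioms'\<close>)
  show "morse_smale f"
  proof (rule hyperbolic_imp_morse_smale)
    fix z assume "G z = z"
    then have "(pl.F t ^^ q) (z - x1) = (z - x1) + of_int p" by (simp add: G_def \<Phi>n)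
    from pl.generic_fixed_point_hyperbolic[OF gen' q this]
    obtain e s where es: "e > 0" "s > 0" "s \<noteq> 1"
      "\<And>y. \<bar>y - (z - x1)\<bar> < e \<Longrightarrow> (pl.F t ^^ q) y - of_int p - (z - x1) = s * (y - (z - x1))" by blast
    have "G y - z = s * (y - z)" if "\<bar>y - z\<bar> < e" for y
      using es(4)[of "y - x1"] that by (simp add: G_def \<Phi>n algebra_simps)
    then show "\<exists>e>0. \<exists>s>0. s \<noteq> 1 \<and> (\<forall>y. \<bar>y - z\<bar> < e \<longrightarrow> G y - z = s * (y - z))" using es by blast
  qed
qed

theorem theorem2:
  shows "{(x\<^sub>1, x\<^sub>2, y\<^sub>1, y\<^sub>2).
            x\<^sub>1 \<in> {0..<1} \<and> x\<^sub>2 \<in> {0..<1} \<and> y\<^sub>1 \<in> {0..<1} \<and> y\<^sub>2 \<in> {0..<1} \<and>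
            (\<exists>f. pa_homeo_two_breaks f (to_circle x\<^sub>1) (to_circle x\<^sub>2) \<and>
                 f (to_circle x\<^sub>1) = to_circle y\<^sub>1 \<and> f (to_circle x\<^sub>2) = to_circle y\<^sub>2 \<and>
                 \<not> morse_smale f)}
         \<in> null_sets (lebesgue :: (real \<times> real \<times> real \<times> real) measure)"
  unfolding negligible_iff_null_sets[symmetric]
  by (rule negligible_subset[OF generic_params_AE_4[unfolded AE_lborel_iff_negligible]])
    (use generic_two_breaks_morse_smale in auto)

end
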